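(* Assume that $$\rho>\mu+\sigma\quad\text{and}\quad\mu-\sigma>0.$$ Then $$u_+=a\,\frac{\rho}{\rho-\mu-\sigma},$$ and, with $$C=\frac{1-b}{\Omega\,u_+^{\Omega-1}},$$ $$N=\omega_+\Omega_+-\omega_-\Omega_--\frac{\lambda\,\omega_+\omega_-}{\lambda+\rho}(\Omega_+-\Omega_-),$$ $$D=\omega_+(\Omega_+-1)-\omega_-(\Omega_--1)-\frac{\lambda\,\omega_+\omega_-}{\lambda+\rho-\mu-\sigma}(\Omega_+-\Omega_-),$$ $u_-$ is the smallest solution $u\in[0,\infty)$ of the equation $$\Phi(u)=a\frac{N}{D},\qquad\text{where}\quad \Phi(u)=u-C\,\frac{\omega_+\omega_-(\Omega_+-\Omega_-)}{D}\,u^{\Omega}.$$ Moreover, with $$C_+=u_-^{-\Omega_+}\frac{u_-(\Omega_--1)-a\Omega_-}{\omega_+(\Omega_--\Omega_+)},\qquad C_-=u_-^{-\Omega_-}\frac{u_-(\Omega_+-1)-a\Omega_+}{\omega_-(\Omega_+-\Omega_-)},$$ the value function is given by $$g(y,-1)=\begin{cases}C_-\omega_-y^{\Omega_-}+C_+\omega_+y^{\Omega_+},&0\le y\le u_-,\\ y-a,&y\ge u_-,\end{cases}\qquad g(y,+1)=\begin{cases}C_-y^{\Omega_-}+C_+y^{\Omega_+},&0\le y\le u_-,\\ by-a\frac{\lambda}{\lambda+\rho}+Cy^{\Omega},&u_-\le y\le u_+,\\ y-a,&y\ge u_+.\end{cases}$$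
   Context: Fix real parameters $\lambda>0$, $\mu>0$, $\sigma>0$, $a>0$, $\rho>0$. Let $(\xi(t),t\ge 0)$ be the continuous-time Markov chain with (right-continuous) piecewise constant paths in $S=\{-1,+1\}$, which jumps from each state to the other at rate $\lambda$ (infinitesimal generator $\begin{pmatrix}-\lambda&\lambda\\ \lambda&-\lambda\end{pmatrix}$). For $Y_0\ge 0$, let $Y_t=Y_0\exp\left(\mu t+\sigma\int_0^t\xi(u)\,du\right)$, i.e. $dY_t/dt=(\mu+\sigma\xi(t))Y_t$. Let $(\mathcal F_t)$ be the completed natural filtration of $(\xi(t))$. $P_{y,s}$ and $E_{y,s}$ denote probability and expectation given $Y_0=y$, $\xi(0)=s$. The reward process is $X_t=e^{-\rho t}(Y_t-a)$ for $0\le t<\infty$, and $X_{+\infty}=0$. The value function is $g(y,s)=\sup_\tau E_{y,s}(X_\tau)$, the supremum being over all $(\mathcal F_t)$-stopping times $\tau$ with values in $[0,\infty]$. For $s=\pm1$, the set $\{y\in\mathbb R_+=[0,\infty): g(y,s)=y-a\}$ is an interval $[u_s,+\infty)$, which defines $u_\pm:=u_{\pm 1}\in[0,+\infty]$ (with $u_s=+\infty$ if the set is empty). (The condition $\rho>\mu-\lambda+\sqrt{\sigma^2+\lambda^2}$, which guarantees finiteness of $g$, is automatically satisfied when $\rho>\mu+\sigma$.) Constants: $b=\lambda(\lambda+\rho-\mu-\sigma)^{-1}$, $\Omega=(\lambda+\rho)(\mu+\sigma)^{-1}$, $$\Omega_\pm=\frac{(\lambda+\rho)\mu\pm\sqrt{\lambda^2\mu^2+\sigma^2(\rho^2+2\lambda\rho)}}{\mu^2-\sigma^2},\qquad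 \omega_\pm=1+\frac{\rho}{\lambda}-\frac{\mu+\sigma}{\lambda}\Omega_\pm.$$ *)

theory Defs
  imports "HOL-Probability.Probability"
begin

text \<open>
  A time-homogeneous continuous-time Markov chain on a finite state space \<open>S\<close> is given as a family of
  laws \<open>P s\<close> (\<open>s \<in> S\<close>, the chain started in \<open>s\<close>) on one measurable space; only the \<open>\<sigma>\<close>-algebra of \<open>M\<close>
  matters. Times are real numbers, and only \<open>\<xi> t\<close> with \<open>t \<ge> 0\<close> is ever used. Filtrations are indexed
  by \<open>ennreal\<close>, so that \<open>stopping_time\<close> covers times with values in \<open>[0, \<infinity>]\<close>.
\<close>

definition natural_filtration ::
    "'a measure \<Rightarrow> (real \<Rightarrow> 'a \<Rightarrow> real) \<Rightarrow> ennreal \<Rightarrow> 'a measure" where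
  "natural_filtration M \<xi> t =
     sigma (space M) {\<xi> u -` B \<inter> space M | u B. 0 \<le> u \<and> ennreal u \<le> t \<and> B \<in> sets borel}"

text \<open>
  The sets adjoined are those that are negligible (possibly not in \<open>M\<close>) under each of the laws \<open>P s\<close>.
  Since the events \<open>\<xi> 0 = s\<close> belong to the filtration and \<open>P s\<close> is carried by \<open>\<xi> 0 = s\<close>, this amounts
  to completing with respect to any initial distribution charging all of \<open>S\<close>.
\<close>

definition completed_filtration ::
    "real set \<Rightarrow> 'a measure \<Rightarrow> (real \<Rightarrow> 'a measure) \<Rightarrow> (real \<Rightarrow> 'a \<Rightarrow> real) \<Rightarrow> ennreal \<Rightarrow> 'a measure"
  where
  "completed_filtration S M P \<xi> t =
     sigma (space M)
       (sets (natural_filtration M \<xi> t) \<union>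
        {A. A \<subseteq> space M \<and> (\<forall>s\<in>S. A \<in> null_sets (completion (P s)))})"

text \<open>
  Right-continuous paths in the finite set \<open>S\<close> with finitely many discontinuities in bounded time
  intervals are exactly the right-continuous piecewise constant ones. The transition function is
  \<open>p\<^sub>h(x, y) = P x (\<xi> h = y)\<close>, and \<open>Q\<close> is its derivative at \<open>h = 0\<close>.
\<close>

locale markov_chain_family =
  fixes S :: "real set"
    and Q :: "real \<Rightarrow> real \<Rightarrow> real"
    and M :: "'a measure"
    and P :: "real \<Rightarrow> 'a measure"
    and \<xi> :: "real \<Rightarrow> 'a \<Rightarrow> real"
  assumes finite_states: "finite S"
    and prob_space_P: "\<And>s. s \<in> S \<Longrightarrow> prob_space (P s)"
    and sets_P: "\<And>s. s \<in> S \<Longrightarrow> sets (P s) = sets M"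
    and measurable_chain: "\<And>t. 0 \<le> t \<Longrightarrow> \<xi> t \<in> measurable M (count_space S)"
    and start: "\<And>s. s \<in> S \<Longrightarrow> AE \<omega> in P s. \<xi> 0 \<omega> = s"
    and right_continuous:
      "\<And>\<omega> t. \<omega> \<in> space M \<Longrightarrow> 0 \<le> t \<Longrightarrow> continuous (at_right t) (\<lambda>u. \<xi> u \<omega>)"
    and finitely_many_jumps:
      "\<And>\<omega> T. \<omega> \<in> space M \<Longrightarrow> finite {t \<in> {0<..T}. \<not> isCont (\<lambda>u. \<xi> u \<omega>) t}"
    and markov_property:
      "\<And>s x y t h A. \<lbrakk>s \<in> S; x \<in> S; y \<in> S; 0 \<le> t; 0 \<le> h;
          A \<in> sets (natural_filtration M \<xi> (ennreal t))\<rbrakk> \<Longrightarrow>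
        measure (P s) {\<omega> \<in> A. \<xi> t \<omega> = x \<and> \<xi> (t + h) \<omega> = y} =
        measure (P s) {\<omega> \<in> A. \<xi> t \<omega> = x} * measure (P x) {\<omega> \<in> space M. \<xi> h \<omega> = y}"
    and generator:
      "\<And>x y. x \<in> S \<Longrightarrow> y \<in> S \<Longrightarrow>
        ((\<lambda>h. (measure (P x) {\<omega> \<in> space M. \<xi> h \<omega> = y} - of_bool (x = y)) / h) \<longlongrightarrow> Q x y)
          (at_right 0)"

definition switching_chain ::
    "real \<Rightarrow> 'a measure \<Rightarrow> (real \<Rightarrow> 'a measure) \<Rightarrow> (real \<Rightarrow> 'a \<Rightarrow> real) \<Rightarrow> bool" where
  "switching_chain lam M P \<xi> \<longleftrightarrow>
     markov_chain_family {-1, 1} (\<lambda>x y. if x = y then - lam else lam) M P \<xi>"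

definition price :: "real \<Rightarrow> real \<Rightarrow> (real \<Rightarrow> 'a \<Rightarrow> real) \<Rightarrow> real \<Rightarrow> real \<Rightarrow> 'a \<Rightarrow> real" where
  "price \<mu> \<sigma> \<xi> y t \<omega> = y * exp (\<mu> * t + \<sigma> * integral {0..t} (\<lambda>u. \<xi> u \<omega>))"

definition reward ::
    "real \<Rightarrow> real \<Rightarrow> real \<Rightarrow> real \<Rightarrow> (real \<Rightarrow> 'a \<Rightarrow> real) \<Rightarrow> real \<Rightarrow> ennreal \<Rightarrow> 'a \<Rightarrow> real" where
  "reward \<mu> \<sigma> a \<rho> \<xi> y t \<omega> =
     (if t = \<infinity> then 0
      else exp (- \<rho> * enn2real t) * (price \<mu> \<sigma> \<xi> y (enn2real t) \<omega> - a))"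

text \<open>
  Stopping times are measurable only with respect to the completed \<open>\<sigma>\<close>-algebra, so expectations are
  taken under \<open>completion (P s)\<close>. The supremum is that of the reals: if \<open>\<rho> > \<mu> + \<sigma>\<close>, every reward is
  bounded by \<open>y + a\<close> in absolute value, so that the integrals exist and are bounded.
\<close>

definition value_function ::
    "real \<Rightarrow> real \<Rightarrow> real \<Rightarrow> real \<Rightarrow> 'a measure \<Rightarrow> (real \<Rightarrow> 'a measure) \<Rightarrow> (real \<Rightarrow> 'a \<Rightarrow> real) \<Rightarrow>
      real \<Rightarrow> real \<Rightarrow> real" where
  "value_function \<mu> \<sigma> a \<rho> M P \<xi> y s =
     (SUP \<tau> \<in> {\<tau>. stopping_time (completed_filtration {-1, 1} M P \<xi>) \<tau>}.
        integral\<^sup>L (completion (P s)) (\<lambda>\<omega>. reward \<mu> \<sigma> a \<rho> \<xi> y (\<tau> \<omega>) \<omega>))"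

text \<open>The end point \<open>u \<in> [0, \<infinity>]\<close> for which \<open>{y \<ge> 0. g y = y - a}\<close> is the interval \<open>[u, \<infinity>)\<close>.\<close>

definition is_threshold :: "real \<Rightarrow> (real \<Rightarrow> real) \<Rightarrow> ereal \<Rightarrow> bool" where
  "is_threshold a g u \<longleftrightarrow> 0 \<le> u \<and> {y. 0 \<le> y \<and> g y = y - a} = {y. u \<le> ereal y}"

end

theory Submission
  imports Defs
begin

text \<open>
  In logarithmic coordinates the price is \<open>X\<^sub>t = x + \<mu> t + \<sigma> \<integral>\<xi>\<close>, which increases strictly because \<open>\<mu> > \<sigma>\<close>. For a
  \<open>C\<^sup>1\<close> function \<open>v\<close> with generator image \<open>L v\<close>, the process
  \<open>e\<^bsup>-\<rho>t\<^esup> v(\<xi>\<^sub>t, X\<^sub>t) - \<integral>\<^sub>0\<^sup>t e\<^bsup>-\<rho>u\<^esup> L v(\<xi>\<^sub>u, X\<^sub>u) du\<close> is a martingale: its expectation over an event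
  of the past is continuous in \<open>t\<close> with vanishing right derivative. Only the one-step Markov property
  enters, since the increment splits into a part that is Lipschitz in the time step and a part carried
  by the event that the state at the end of the step differs from the state at its beginning.

  The candidate value function is glued from the solutions of \<open>L v = 0\<close> by smooth fit, and the equation
  for \<open>u\<^sub>-\<close> becomes \<open>H u = 0\<close> for a convex function \<open>H\<close> with \<open>H 0 > 0 > H u\<^sub>+\<close>. The sign of \<open>H\<close> on \<open>[u\<^sub>-, u\<^sub>+]\<close>
  gives \<open>L v \<le> 0\<close>, and convexity of each branch gives \<open>v \<ge> y - a\<close>. Optional stopping then bounds every
  expected reward by \<open>v\<close>, with equality for the hitting time of the contact set.
\<close>

text \<open>Below both thresholds the two states are coupled, and L v = 0 is solved by exp (q z) in
  state 1 together with \<omega> exp (q z) in state -1, where (lam + \<rho> - (\<mu> + \<sigma>) q)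
  (lam + \<rho> - (\<mu> - \<sigma>) q) = lam^2. Between the thresholds state -1 is already stopped,
  which leaves one inhomogeneous first-order equation in state 1, solved by \<open>G\<close>. At the
  lower threshold four matching conditions meet three unknowns. They are compatible because smooth
  fit makes L v continuous: in state -1 it is 0 on the left and \<open>H\<close> on the right, so
  \<open>H um = 0\<close>; the last condition then follows from the equation in state 1.

  As \<mu> > \<sigma>, a deterministic time bounds the hitting time, so bounded optional stopping
  suffices there; other stopping times are truncated, and \<rho> > \<mu> + \<sigma> makes the
  truncated rewards converge. A path may switch many times within a time step. No count of switches
  is needed: comparing the values of the initial and the final state at one and the same price
  isolates the part of the increment that is not Lipschitz in the step.\<close>

subsection \<open>Right derivatives and right-continuous processes\<close>

text \<open>Consider the last time at which \<open>f\<close> is not above a line of positive slope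
  through its starting point. If that time came before \<open>d\<close>, the vanishing right
  derivative would keep \<open>f\<close> below the line a little longer.\<close>

lemma nonincreasing_if_right_derivative_zero:
  fixes f :: "real \<Rightarrow> real"
  assumes cd: "c \<le> d" and cont: "continuous_on {c..d} f"
    and der: "\<And>t. c \<le> t \<Longrightarrow> t < d \<Longrightarrow> ((\<lambda>h. (f (t + h) - f t) / h) \<longlongrightarrow> 0) (at_right 0)"
  shows "f d \<le> f c"
proof (rule ccontr)
  assume *: "\<not> f d \<le> f c"
  then have "c < d" using cd by (cases "c = d") auto
  \<comment> \<open>Half the mean slope, so that \<open>f\<close> lies strictly above the line at
    \<open>d\<close> if the claim fails.\<close>
  define e where "e = (f d - f c) / (2 * (d - c))"
  have e: "e > 0" "f d - f c - e * (d - c) > 0"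
  proof -
    show "e > 0" using * \<open>c < d\<close> by (simp add: e_def)
    have "e * (d - c) = (f d - f c) / 2"
      using \<open>c < d\<close> by (simp add: e_def nonzero_divide_eq_eq nonzero_eq_divide_eq)
    then show "f d - f c - e * (d - c) > 0" using * by simp
  qed
  define g where "g t = f t - f c - e * (t - c)" for t
  have cg: "continuous_on {c..d} g"
    unfolding g_def by (intro continuous_intros cont)
  define S where "S = {t \<in> {c..d}. g t \<le> 0}"
  have "S = {c..d} \<inter> g -` {..0}" by (auto simp: S_def)
  then have "closed S"
    using continuous_closed_preimage[OF cg, of "{..0}"] by simp
  moreover have "bounded S"
    by (rule bounded_subset[OF bounded_closed_interval[of c d]]) (auto simp: S_def)
  ultimately have "compact S" by (simp add: compact_eq_bounded_closed)
  moreover have "c \<in> S" using cd by (auto simp: S_def g_def)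
  ultimately obtain t where t: "t \<in> S" "\<And>s. s \<in> S \<Longrightarrow> s \<le> t"
    using compact_attains_sup[of S] by blast
  have "t < d" using t(1) e(2) by (cases "t = d") (auto simp: S_def g_def)
  have "eventually (\<lambda>h. (f (t + h) - f t) / h < e) (at_right 0)"
    using der[of t] t(1) \<open>t < d\<close> e(1) by (intro order_tendstoD) (auto simp: S_def)
  moreover have "eventually (\<lambda>h. 0 < h \<and> h < d - t) (at_right 0)"
    using \<open>t < d\<close> by (auto simp: eventually_at_right_field intro!: exI[of _ "d - t"])
  ultimately have "eventually (\<lambda>h. (f (t + h) - f t) / h < e \<and> 0 < h \<and> h < d - t) (at_right 0)"
    by eventually_elim auto
  then obtain h where h: "(f (t + h) - f t) / h < e" "0 < h" "h < d - t"
    using eventually_happens[of _ "at_right (0::real)"] by (auto simp: trivial_limit_at_right_real)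
  then have "f (t + h) - f t < e * h" by (simp add: field_simps)
  then have "g (t + h) \<le> 0" using t(1) by (simp add: S_def g_def algebra_simps)
  then have "t + h \<in> S" using h t(1) by (auto simp: S_def)
  with t(2) h(2) show False by fastforce
qed

lemma constant_if_right_derivative_zero:
  fixes f :: "real \<Rightarrow> real"
  assumes cd: "c \<le> d" and cont: "continuous_on {c..d} f"
    and der: "\<And>t. c \<le> t \<Longrightarrow> t < d \<Longrightarrow> ((\<lambda>h. (f (t + h) - f t) / h) \<longlongrightarrow> 0) (at_right 0)"
  shows "f d = f c"
proof (rule antisym)
  show "f d \<le> f c" by (rule nonincreasing_if_right_derivative_zero[OF assms])
  have "- f d \<le> - f c"
  proof (rule nonincreasing_if_right_derivative_zero[OF cd])
    show "continuous_on {c..d} (\<lambda>t. - f t)" by (intro continuous_intros cont)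
    show "((\<lambda>h. (- f (t + h) - - f t) / h) \<longlongrightarrow> 0) (at_right 0)" if "c \<le> t" "t < d" for t
    proof -
      have "(\<lambda>h. (- f (t + h) - - f t) / h) = (\<lambda>h. - ((f (t + h) - f t) / h))"
        by (simp add: fun_eq_iff diff_divide_distrib)
      then show ?thesis using tendsto_minus[OF der[OF that]] by simp
    qed
  qed
  then show "f c \<le> f d" by simp
qed

text \<open>The times \<open>s n\<close> may equal \<open>t\<close>, a point that
  \<open>at_right t\<close> leaves out; adjoining \<open>t\<close> to the set does not change the
  filter.\<close>

lemma continuous_at_right_sequentially:
  fixes f :: "real \<Rightarrow> real"
  assumes "continuous (at_right t) f" "s \<longlonglongrightarrow> t" "\<And>n. t \<le> s n"
  shows "(\<lambda>n. f (s n)) \<longlonglongrightarrow> f t"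
proof -
  have "at t within insert t {t<..} = at_right t"
    by (simp add: at_within_def)
  then have "continuous (at t within insert t {t<..}) f"
    using assms(1) by (simp add: continuous_within)
  then show ?thesis
    using assms(2,3) by (subst (asm) continuous_within_sequentially) (auto simp: le_less comp_def)
qed

text \<open>Rounding up approaches \<open>u\<close> from the side on which the paths are continuous
  and takes only countably many values. It gives joint measurability of right-continuous processes
  here and discretises stopping times later.\<close>

lemma grid_above_tendsto:
  fixes u :: real
  shows "(\<lambda>n. real_of_int \<lceil>real (Suc n) * u\<rceil> / real (Suc n)) \<longlonglongrightarrow> u"
    and "u \<le> real_of_int \<lceil>real (Suc n) * u\<rceil> / real (Suc n)"
proof -
  have ge: "u \<le> real_of_int \<lceil>real (Suc n) * u\<rceil> / real (Suc n)" for n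
    by (simp add: field_simps del: of_nat_Suc)
  have le: "real_of_int \<lceil>real (Suc n) * u\<rceil> / real (Suc n) \<le> u + 1 / real (Suc n)" for n
  proof -
    have "real_of_int \<lceil>real (Suc n) * u\<rceil> \<le> real (Suc n) * u + 1" by linarith
    then show ?thesis by (simp add: field_simps del: of_nat_Suc)
  qed
  show "u \<le> real_of_int \<lceil>real (Suc n) * u\<rceil> / real (Suc n)" by (rule ge)
  have "(\<lambda>n. u + 1 / real (Suc n)) \<longlonglongrightarrow> u + 0"
    by (intro tendsto_intros LIMSEQ_Suc[OF lim_const_over_n])
  then have *: "(\<lambda>n. u + 1 / real (Suc n)) \<longlonglongrightarrow> u" by (simp only: add_0_right)
  show "(\<lambda>n. real_of_int \<lceil>real (Suc n) * u\<rceil> / real (Suc n)) \<longlonglongrightarrow> u"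
    by (rule tendsto_sandwich[OF eventuallyI[OF ge] eventuallyI[OF le] tendsto_const *])
qed

lemma right_continuous_jointly_measurable:
  fixes \<phi> :: "real \<Rightarrow> 'a \<Rightarrow> real"
  assumes m: "\<And>u. \<phi> u \<in> borel_measurable N"
    and rc: "\<And>\<omega> u. \<omega> \<in> space N \<Longrightarrow> continuous (at_right u) (\<lambda>u. \<phi> u \<omega>)"
  shows "(\<lambda>(\<omega>, u). \<phi> u \<omega>) \<in> borel_measurable (N \<Otimes>\<^sub>M lborel)"
proof (rule borel_measurable_LIMSEQ_real)
  show "(\<lambda>n. case z of (\<omega>, u) \<Rightarrow> \<phi> (real_of_int \<lceil>real (Suc n) * u\<rceil> / real (Suc n)) \<omega>)
      \<longlonglongrightarrow> (case z of (\<omega>, u) \<Rightarrow> \<phi> u \<omega>)" if z': "z \<in> space (N \<Otimes>\<^sub>M lborel)" for z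
  proof -
    obtain \<omega> u where z: "z = (\<omega>, u)" "\<omega> \<in> space N"
      using z' by (metis mem_Times_iff prod.collapse space_pair_measure)
    show ?thesis
      unfolding z(1) prod.case
      by (rule continuous_at_right_sequentially[OF rc[OF z(2)] grid_above_tendsto])
  qed
  fix n
  have "(\<lambda>z. \<phi> (real_of_int \<lceil>real (Suc n) * snd z\<rceil> / real (Suc n)) (fst z))
      \<in> borel_measurable (N \<Otimes>\<^sub>M lborel)"
    by (rule measurable_compose_countable[where g = "\<lambda>z. \<lceil>real (Suc n) * snd z\<rceil>"
          and f = "\<lambda>k z. \<phi> (real_of_int k / real (Suc n)) (fst z)"])
       (use m in measurable)
  then show "(\<lambda>z. case z of (\<omega>, u) \<Rightarrow> \<phi> (real_of_int \<lceil>real (Suc n) * u\<rceil> / real (Suc n)) \<omega>)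
      \<in> borel_measurable (N \<Otimes>\<^sub>M lborel)"
    by (simp add: case_prod_beta')
qed

text \<open>Freezing a process before 0 and after \<open>T\<close> defines it at all real times, as
  joint measurability demands, while using only its values on \<open>[0, T]\<close>. Time integrals
  up to \<open>T\<close> therefore stay measurable for the information available at
  \<open>T\<close>.\<close>

lemma clamp_right_continuous:
  fixes f :: "real \<Rightarrow> real"
  assumes "0 \<le> T" and rc: "\<And>u. 0 \<le> u \<Longrightarrow> continuous (at_right u) f"
  shows "continuous (at_right u) (\<lambda>u. f (max 0 (min T u)))"
proof -
  consider "u < 0" | "0 \<le> u" "u < T" | "T \<le> u" by linarith
  then show ?thesis
  proof cases
    case 1
    then have "eventually (\<lambda>s. f (max 0 (min T s)) = f (max 0 (min T u))) (at_right u)"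
      using \<open>0 \<le> T\<close> unfolding eventually_at_right_field by (intro exI[of _ 0]) auto
    then show ?thesis
      by (simp add: continuous_within tendsto_eventually)
  next
    case 2
    then have "eventually (\<lambda>s. f s = f (max 0 (min T s))) (at_right u)"
      unfolding eventually_at_right_field by (intro exI[of _ T]) auto
    moreover have "(f \<longlongrightarrow> f u) (at_right u)"
      using rc[of u] 2 by (simp add: continuous_within)
    ultimately have "((\<lambda>u. f (max 0 (min T u))) \<longlongrightarrow> f u) (at_right u)"
      by (rule Lim_transform_eventually[rotated])
    moreover have "max 0 (min T u) = u" using 2 by simp
    ultimately show ?thesis by (simp only: continuous_within)
  next
    case 3
    then have "eventually (\<lambda>s. f (max 0 (min T s)) = f (max 0 (min T u))) (at_right u)"
      unfolding eventually_at_right_field by (intro exI[of _ "u + 1"]) auto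
    then show ?thesis
      by (simp add: continuous_within tendsto_eventually)
  qed
qed

lemma right_continuous_time_integral:
  fixes \<phi> :: "real \<Rightarrow> 'a \<Rightarrow> real"
  assumes T: "0 \<le> T" and m: "\<And>u. 0 \<le> u \<Longrightarrow> u \<le> T \<Longrightarrow> \<phi> u \<in> borel_measurable N"
    and rc: "\<And>\<omega> u. \<omega> \<in> space N \<Longrightarrow> 0 \<le> u \<Longrightarrow> continuous (at_right u) (\<lambda>u. \<phi> u \<omega>)"
    and bd: "\<And>\<omega> u. \<omega> \<in> space N \<Longrightarrow> 0 \<le> u \<Longrightarrow> u \<le> T \<Longrightarrow> \<bar>\<phi> u \<omega>\<bar> \<le> K"
  shows "\<And>\<omega>. \<omega> \<in> space N \<Longrightarrow> (\<lambda>u. \<phi> u \<omega>) integrable_on {0..T}"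
    and "(\<lambda>\<omega>. integral {0..T} (\<lambda>u. \<phi> u \<omega>)) \<in> borel_measurable N"
proof -
  define \<psi> where "\<psi> u = \<phi> (max 0 (min T u))" for u
  have jm [measurable]: "(\<lambda>(\<omega>, u). \<psi> u \<omega>) \<in> borel_measurable (N \<Otimes>\<^sub>M lborel)"
    unfolding \<psi>_def using T
    by (intro right_continuous_jointly_measurable m clamp_right_continuous rc) auto
  have eq: "\<psi> u \<omega> = \<phi> u \<omega>" if "u \<in> {0..T}" for u \<omega>
    using that by (simp add: \<psi>_def)
  have int: "set_integrable lborel {0..T} (\<lambda>u. \<psi> u \<omega>)" if \<omega>: "\<omega> \<in> space N" for \<omega>
    unfolding set_integrable_def
  proof (rule Bochner_Integration.integrable_bound)
    show "integrable lborel (\<lambda>u. indicator {0..T} u *\<^sub>R K)"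
      using T by (intro integrable_scaleR_left integrable_real_indicator)
        (simp_all add: emeasure_lborel_Icc)
    have "(\<lambda>u. \<psi> u \<omega>) \<in> borel_measurable lborel"
      using measurable_Pair2[OF jm \<omega>] by simp
    then show "(\<lambda>u. indicator {0..T} u *\<^sub>R \<psi> u \<omega>) \<in> borel_measurable lborel"
      by measurable
    show "AE u in lborel. norm (indicator {0..T} u *\<^sub>R \<psi> u \<omega>) \<le> norm (indicator {0..T} u *\<^sub>R K)"
    proof (rule AE_I2)
      fix u
      show "norm (indicator {0..T} u *\<^sub>R \<psi> u \<omega>) \<le> norm (indicator {0..T} u *\<^sub>R K)"
        using bd[OF \<omega>, of u] eq[of u \<omega>] by (cases "u \<in> {0..T}") auto
    qed
  qed
  show "(\<lambda>u. \<phi> u \<omega>) integrable_on {0..T}" if "\<omega> \<in> space N" for \<omega>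
    using set_borel_integral_eq_integral(1)[OF int[OF that]] eq integrable_cong by (metis (no_types, lifting))
  have "(\<lambda>\<omega>. LINT u|lborel. indicator {0..T} u *\<^sub>R \<psi> u \<omega>) \<in> borel_measurable N"
    by measurable
  moreover have "integral {0..T} (\<lambda>u. \<phi> u \<omega>) = (LINT u|lborel. indicator {0..T} u *\<^sub>R \<psi> u \<omega>)"
    if "\<omega> \<in> space N" for \<omega>
  proof -
    have "integral {0..T} (\<lambda>u. \<phi> u \<omega>) = integral {0..T} (\<lambda>u. \<psi> u \<omega>)"
      by (rule integral_cong) (simp add: eq)
    then show ?thesis
      using set_borel_integral_eq_integral(2)[OF int[OF that]]
      by (simp add: set_lebesgue_integral_def)
  qed
  ultimately show "(\<lambda>\<omega>. integral {0..T} (\<lambda>u. \<phi> u \<omega>)) \<in> borel_measurable N"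
    by (simp cong: measurable_cong)
qed

lemma continuous_on_if_increment_bound:
  fixes f :: "real \<Rightarrow> real"
  assumes "0 < \<delta>"
    and bd: "\<And>t h. c \<le> t \<Longrightarrow> 0 \<le> h \<Longrightarrow> h < \<delta> \<Longrightarrow> t + h \<le> d \<Longrightarrow> \<bar>f (t + h) - f t\<bar> \<le> K * h"
  shows "continuous_on {c..d} f"
proof (rule continuous_onI)
  fix t e :: real assume t: "t \<in> {c..d}" and "0 < e"
  define \<eta> where "\<eta> = min \<delta> (e / (\<bar>K\<bar> + 1))"
  have \<eta>: "\<eta> > 0" using \<open>0 < \<delta>\<close> \<open>0 < e\<close> by (simp add: \<eta>_def)
  have "dist (f s) (f t) \<le> e" if s: "s \<in> {c..d}" "dist s t < \<eta>" for s
  proof -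
    define h where "h = \<bar>s - t\<bar>"
    have h: "0 \<le> h" "h < \<delta>" "h < e / (\<bar>K\<bar> + 1)"
      using s(2) by (auto simp: h_def \<eta>_def dist_real_def)
    have "\<bar>f s - f t\<bar> \<le> K * h"
    proof (cases "s \<le> t")
      case True
      then show ?thesis using bd[of s h] h t s by (auto simp: h_def)
    next
      case False
      then show ?thesis using bd[of t h] h t s by (auto simp: h_def)
    qed
    also have "\<dots> \<le> (\<bar>K\<bar> + 1) * h" using h(1) by (intro mult_right_mono) auto
    also have "\<dots> \<le> e" using h(3) by (simp add: field_simps)
    finally show ?thesis by (simp add: dist_real_def)
  qed
  with \<eta> show "\<exists>d'>0. \<forall>s\<in>{c..d}. dist s t < d' \<longrightarrow> dist (f s) (f t) \<le> e" by blast
qed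

lemma time_integral_increment_bound:
  fixes f :: "real \<Rightarrow> real"
  assumes "f integrable_on {0..t + h}" "0 \<le> t" "0 \<le> h"
    and bd: "\<And>u. t \<le> u \<Longrightarrow> u \<le> t + h \<Longrightarrow> \<bar>f u\<bar> \<le> K"
  shows "\<bar>integral {0..t + h} f - integral {0..t} f\<bar> \<le> K * h"
proof -
  have "integral {0..t} f + integral {t..t + h} f = integral {0..t + h} f"
    using assms by (intro Henstock_Kurzweil_Integration.integral_combine) auto
  moreover have "norm (integral {t..t + h} f) \<le> integral {t..t + h} (\<lambda>_. K)"
  proof (rule integral_norm_bound_integral)
    show "f integrable_on {t..t + h}"
      using assms by (intro integrable_subinterval_real[OF assms(1)]) auto
  qed (use bd in auto)
  ultimately show ?thesis using \<open>0 \<le> h\<close> by (simp add: mult.commute)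
qed

lemma time_integral_right_derivative:
  fixes f :: "real \<Rightarrow> real"
  assumes int: "f integrable_on {0..t + 1}" and "0 \<le> t" and rc: "continuous (at_right t) f"
  shows "((\<lambda>h. (integral {0..t + h} f - integral {0..t} f) / h) \<longlongrightarrow> f t) (at_right 0)"
proof -
  have "at t within {t..t + 1} - {} = at_right t"
    by (simp add: at_within_Icc_at_right)
  then have "((\<lambda>u. integral {t..u} f) has_vector_derivative f t) (at_right t)"
    using integral_has_vector_derivative_continuous_at[of f t "t + 1" t "{}"] rc
      integrable_subinterval_real[OF int, of t "t + 1"] \<open>0 \<le> t\<close> by simp
  then have "((\<lambda>u. integral {t..u} f / (u - t)) \<longlongrightarrow> f t) (at_right t)"
    by (simp add: has_real_derivative_iff_has_vector_derivative[symmetric] has_field_derivative_iff)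
  then have *: "((\<lambda>h. integral {t..t + h} f / h) \<longlongrightarrow> f t) (at_right 0)"
    by (subst (asm) at_right_to_0) (simp add: filterlim_filtermap add.commute)
  have "eventually (\<lambda>h. integral {t..t + h} f / h
      = (integral {0..t + h} f - integral {0..t} f) / h) (at_right 0)"
    unfolding eventually_at_right_field
  proof (intro exI[of _ 1] conjI allI impI)
    fix h :: real assume "0 < h" "h < 1"
    then have "integral {0..t} f + integral {t..t + h} f = integral {0..t + h} f"
      using \<open>0 \<le> t\<close> integrable_subinterval_real[OF int, of 0 "t + h"]
      by (intro Henstock_Kurzweil_Integration.integral_combine) auto
    then show "integral {t..t + h} f / h = (integral {0..t + h} f - integral {0..t} f) / h"
      by (simp add: algebra_simps)
  qed simp
  from Lim_transform_eventually[OF * this] show ?thesis .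
qed

subsection \<open>Tangent inequalities and smooth gluing\<close>

text \<open>The strict Bernoulli inequality: \<open>t powr q - q * t\<close> decreases up to 1 and
  increases after it.\<close>

lemma powr_above_tangent:
  fixes t q :: real
  assumes "0 < t" "t \<noteq> 1" "1 < q"
  shows "1 + q * (t - 1) < t powr q"
proof -
  define f where "f t = t powr q - q * t" for t :: real
  have der: "(f has_real_derivative q * s powr (q - 1) - q) (at s)" if "0 < s" for s
    unfolding f_def using that by (auto intro!: derivative_eq_intros)
  have "f 1 < f t"
  proof (cases "t < 1")
    case True
    have "\<exists>d. (f has_real_derivative d) (at s) \<and> d < 0" if s: "t < s" "s < 1" for s
    proof (intro exI conjI)
      show "(f has_real_derivative q * s powr (q - 1) - q) (at s)" using s assms by (intro der) simp
      have "s powr (q - 1) < 1 powr (q - 1)" using s assms by (intro powr_less_mono2) auto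
      then show "q * s powr (q - 1) - q < 0" using assms by simp
    qed
    moreover have "continuous_on {t..1} f"
      by (rule DERIV_atLeastAtMost_imp_continuous_on, rule exI, rule der) (use assms in linarith)
    ultimately show ?thesis using DERIV_neg_imp_decreasing_open[OF True] by blast
  next
    case False
    then have "1 < t" using assms by simp
    have "\<exists>d. (f has_real_derivative d) (at s) \<and> d > 0" if s: "1 < s" "s < t" for s
    proof (intro exI conjI)
      show "(f has_real_derivative q * s powr (q - 1) - q) (at s)" using s by (intro der) simp
      have "1 powr (q - 1) < s powr (q - 1)" using s assms by (intro powr_less_mono2) auto
      then show "q * s powr (q - 1) - q > 0" using assms by simp
    qed
    moreover have "continuous_on {1..t} f"
      by (rule DERIV_atLeastAtMost_imp_continuous_on, rule exI, rule der) linarith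
    ultimately show ?thesis using DERIV_pos_imp_increasing_open[OF \<open>1 < t\<close>] by blast
  qed
  then show ?thesis by (simp add: f_def algebra_simps)
qed

lemma powr_above_tangent_at:
  fixes u y q :: real
  assumes "0 < u" "0 < y" "y \<noteq> u" "1 < q"
  shows "u powr q + q * u powr (q - 1) * (y - u) < y powr q"
proof -
  have "u powr q * (1 + q * (y / u - 1)) < u powr q * (y / u) powr q"
    using powr_above_tangent[of "y / u" q] assms by simp
  moreover have "u powr q * (y / u) powr q = y powr q"
    using assms by (simp add: powr_divide)
  moreover have "u powr q * (1 + q * (y / u - 1)) = u powr q + q * u powr (q - 1) * (y - u)"
    using assms by (simp add: powr_diff field_simps)
  ultimately show ?thesis by simp
qed

text \<open>With two exponents above 1 and the smaller one carrying a positive coefficient, the second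
  derivative at 1 controls its sign on the whole of \<open>(0, 1]\<close>.\<close>

lemma two_powers_above_tangent:
  fixes c d \<alpha> \<beta> t :: real
  assumes exps: "1 < \<alpha>" "\<alpha> < \<beta>" and "0 < c" and convex: "0 \<le> c * \<alpha> * (\<alpha> - 1) + d * \<beta> * (\<beta> - 1)"
    and t: "0 < t" "t < 1"
  shows "c + d + (c * \<alpha> + d * \<beta>) * (t - 1) < c * t powr \<alpha> + d * t powr \<beta>"
proof -
  define f where "f t = c * t powr \<alpha> + d * t powr \<beta> - (c * \<alpha> + d * \<beta>) * t" for t :: real
  define f' where "f' s = c * (\<alpha> * s powr (\<alpha> - 1)) + d * (\<beta> * s powr (\<beta> - 1)) - (c * \<alpha> + d * \<beta>)" for s :: real
  have der: "(f has_real_derivative f' s) (at s)" if "0 < s" for s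
    unfolding f_def f'_def using that by (auto intro!: derivative_eq_intros)
  have neg: "f' s < 0" if s: "0 < s" "s < 1" for s
  proof -
    \<comment> \<open>In terms of \<open>z\<close> the other power is \<open>z\<close> to the
      exponent (\<beta> - 1) / (\<alpha> - 1) > 1, so Bernoulli's inequality bounds its deficit from
      1 by a multiple of \<open>1 - z\<close>. This is what controls a negative
      \<open>d\<close>.\<close>
    define z where "z = s powr (\<alpha> - 1)"
    have z: "0 < z" "z < 1"
      using s exps powr_less_mono2[of "\<alpha> - 1" s 1] by (auto simp: z_def)
    have "s powr (\<beta> - 1) = z powr ((\<beta> - 1) / (\<alpha> - 1))"
      using exps by (simp add: z_def powr_powr)
    moreover have "1 + (\<beta> - 1) / (\<alpha> - 1) * (z - 1) < z powr ((\<beta> - 1) / (\<alpha> - 1))"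
      using z exps by (intro powr_above_tangent) auto
    ultimately have b: "(\<alpha> - 1) * (1 - s powr (\<beta> - 1)) < (\<beta> - 1) * (1 - z)"
      using exps by (simp add: field_simps)
    have b0: "s powr (\<beta> - 1) < 1"
      using s exps powr_less_mono2[of "\<beta> - 1" s 1] by auto
    have "0 < (\<alpha> - 1) * (c * \<alpha> * (1 - z) + d * \<beta> * (1 - s powr (\<beta> - 1)))"
    proof (cases "0 \<le> d")
      case True
      then have "0 \<le> d * \<beta> * (1 - s powr (\<beta> - 1))" using exps b0 by simp
      moreover have "0 < c * \<alpha> * (1 - z)" using \<open>0 < c\<close> exps z by simp
      ultimately have "0 < c * \<alpha> * (1 - z) + d * \<beta> * (1 - s powr (\<beta> - 1))" by linarith
      then show ?thesis using exps by (intro mult_pos_pos) auto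
    next
      case False
      then have "d * \<beta> < 0" using exps by (simp add: mult_less_0_iff)
      from mult_strict_left_mono_neg[OF b this]
      have "d * \<beta> * ((\<beta> - 1) * (1 - z)) < d * \<beta> * ((\<alpha> - 1) * (1 - s powr (\<beta> - 1)))"
        .
      moreover have "0 \<le> (c * \<alpha> * (\<alpha> - 1) + d * \<beta> * (\<beta> - 1)) * (1 - z)"
        using convex z by simp
      ultimately show ?thesis by (simp add: algebra_simps)
    qed
    then have "0 < c * \<alpha> * (1 - z) + d * \<beta> * (1 - s powr (\<beta> - 1))"
      using exps by (simp add: zero_less_mult_iff)
    then show ?thesis by (simp add: f'_def z_def algebra_simps)
  qed
  have "f 1 < f t"
  proof (rule DERIV_neg_imp_decreasing_open[OF t(2)])
    show "\<exists>d. (f has_real_derivative d) (at s) \<and> d < 0" if "t < s" "s < 1" for s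
      using der[of s] neg[of s] that t by auto
    show "continuous_on {t..1} f"
      by (rule DERIV_atLeastAtMost_imp_continuous_on, rule exI, rule der) (use t in linarith)
  qed
  then show ?thesis by (simp add: f_def algebra_simps)
qed

lemma has_real_derivative_glue:
  fixes f g :: "real \<Rightarrow> real"
  assumes f: "\<And>z. (f has_real_derivative f' z) (at z)" and g: "\<And>z. (g has_real_derivative g' z) (at z)"
    and eq: "f c = g c" "f' c = g' c"
  shows "((\<lambda>z. if z \<le> c then f z else g z) has_real_derivative (if z \<le> c then f' z else g' z)) (at z)"
proof -
  consider "z < c" | "c < z" | "z = c" by linarith
  then show ?thesis
  proof cases
    case 1
    then have "eventually (\<lambda>y. y \<in> {..<c}) (nhds z)" by (intro eventually_nhds_in_open) auto
    then have "eventually (\<lambda>y. (if y \<le> c then f y else g y) = f y) (nhds z)"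
      by eventually_elim auto
    from DERIV_cong_ev[OF refl this refl] show ?thesis using f[of z] 1 by simp
  next
    case 2
    then have "eventually (\<lambda>y. y \<in> {c<..}) (nhds z)" by (intro eventually_nhds_in_open) auto
    then have "eventually (\<lambda>y. (if y \<le> c then f y else g y) = g y) (nhds z)"
      by eventually_elim auto
    from DERIV_cong_ev[OF refl this refl] show ?thesis using g[of z] 2 by simp
  next
    case 3
    have "((\<lambda>y. ((if y \<le> c then f y else g y) - f c) / (y - c)) \<longlongrightarrow> f' c) (at c)"
    proof (rule filterlim_split_at_real)
      have "((\<lambda>y. (f y - f c) / (y - c)) \<longlongrightarrow> f' c) (at_left c)"
        using f[of c] by (auto simp: has_field_derivative_iff filterlim_at_split)
      moreover have "eventually (\<lambda>y. (f y - f c) / (y - c)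
          = ((if y \<le> c then f y else g y) - f c) / (y - c)) (at_left c)"
        by (auto simp: eventually_at_filter)
      ultimately show "((\<lambda>y. ((if y \<le> c then f y else g y) - f c) / (y - c)) \<longlongrightarrow> f' c) (at_left c)"
        by (rule Lim_transform_eventually)
      have "((\<lambda>y. (g y - g c) / (y - c)) \<longlongrightarrow> g' c) (at_right c)"
        using g[of c] by (auto simp: has_field_derivative_iff filterlim_at_split)
      moreover have "eventually (\<lambda>y. (g y - g c) / (y - c)
          = ((if y \<le> c then f y else g y) - f c) / (y - c)) (at_right c)"
        by (auto simp: eventually_at_filter eq)
      ultimately show "((\<lambda>y. ((if y \<le> c then f y else g y) - f c) / (y - c)) \<longlongrightarrow> f' c) (at_right c)"
        unfolding eq by (rule Lim_transform_eventually)
    qed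
    then show ?thesis unfolding 3 by (simp add: has_field_derivative_iff)
  qed
qed

lemma continuous_glue:
  fixes f g :: "real \<Rightarrow> real"
  assumes "continuous_on UNIV f" "continuous_on UNIV g" "f c = g c"
  shows "continuous_on UNIV (\<lambda>z. if z \<le> c then f z else g z)"
  using assms by (intro continuous_on_cases_le) (auto intro: continuous_on_subset)

subsection \<open>The free boundary problem\<close>

locale stopping_problem =
  fixes lam \<mu> \<sigma> a \<rho> :: real
  assumes params: "0 < lam" "0 < \<mu>" "0 < \<sigma>" "0 < a" "0 < \<rho>" "\<mu> + \<sigma> < \<rho>" "\<sigma> < \<mu>"
begin

text \<open>Between the thresholds state -1 pays \<open>y - a\<close>; then
  \<open>b * y - a * (lam / (lam + \<rho>))\<close> is a particular solution of the equation in
  state 1, and \<open>y powr \<Omega>\<close> solves the homogeneous one.\<close>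

definition "b = lam / (lam + \<rho> - \<mu> - \<sigma>)"
definition "\<Omega> = (lam + \<rho>) / (\<mu> + \<sigma>)"
definition "discr = sqrt (lam\<^sup>2 * \<mu>\<^sup>2 + \<sigma>\<^sup>2 * (\<rho>\<^sup>2 + 2 * lam * \<rho>))"
text \<open>\<open>\<Omega>p\<close> and \<open>\<Omega>m\<close> are the roots q of (lam + \<rho> -
  (\<mu> + \<sigma>) q) (lam + \<rho> - (\<mu> - \<sigma>) q) = lam^2, the exponents for which
  powers of the price solve the coupled equations.\<close>

definition "\<Omega>p = ((lam + \<rho>) * \<mu> + discr) / (\<mu>\<^sup>2 - \<sigma>\<^sup>2)"
definition "\<Omega>m = ((lam + \<rho>) * \<mu> - discr) / (\<mu>\<^sup>2 - \<sigma>\<^sup>2)"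
text \<open>The ratio of the state -1 component to the state 1 component of the power solution, read
  off from the equation in state 1.\<close>

definition "\<omega>p = 1 + \<rho> / lam - (\<mu> + \<sigma>) / lam * \<Omega>p"
definition "\<omega>m = 1 + \<rho> / lam - (\<mu> + \<sigma>) / lam * \<Omega>m"
text \<open>The price at which the discounted payoff has zero drift in state 1:
  \<open>(\<mu> + \<sigma>) * up = \<rho> * (up - a)\<close>.\<close>

definition "up = a * (\<rho> / (\<rho> - \<mu> - \<sigma>))"
text \<open>Chosen so that \<open>G\<close> has slope 1 at \<open>up\<close>.\<close>

definition "C = (1 - b) / (\<Omega> * up powr (\<Omega> - 1))"
definition "G u = b * u - a * (lam / (lam + \<rho>)) + C * u powr \<Omega>"
text \<open>The generator in state -1 at price \<open>u\<close> when that state pays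
  \<open>u - a\<close> and state 1 is worth \<open>G u\<close>.\<close>

definition "H u = (\<mu> - \<sigma>) * u + lam * G u - (lam + \<rho>) * (u - a)"

section \<open>Location of the exponents and signs of the ratios\<close>

lemma AB: "\<mu>\<^sup>2 - \<sigma>\<^sup>2 = (\<mu> + \<sigma>) * (\<mu> - \<sigma>)"
  by (simp add: power2_eq_square algebra_simps)

text \<open>This rests on \<rho>^2 + 2 lam \<rho> = (lam + \<rho>)^2 - lam^2. The difference of
  squares is the product of the two quantities that appear in \<open>root_identities\<close>, so it
  both fixes their signs and evaluates the products of linear factors at the roots.\<close>

lemma discr_square: "discr\<^sup>2 - ((lam + \<rho>) * \<sigma>)\<^sup>2 = lam\<^sup>2 * ((\<mu> + \<sigma>) * (\<mu> - \<sigma>))"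
proof -
  have "discr\<^sup>2 = lam\<^sup>2 * \<mu>\<^sup>2 + \<sigma>\<^sup>2 * (\<rho>\<^sup>2 + 2 * lam * \<rho>)"
    using params unfolding discr_def by (intro real_sqrt_pow2) (auto intro!: add_nonneg_nonneg mult_nonneg_nonneg)
  then show ?thesis by (simp add: power2_eq_square algebra_simps)
qed

lemma discr_gt: "(lam + \<rho>) * \<sigma> < discr"
proof -
  have "0 < discr\<^sup>2 - ((lam + \<rho>) * \<sigma>)\<^sup>2" unfolding discr_square using params by simp
  moreover have "0 \<le> discr" unfolding discr_def using params by simp
  ultimately show ?thesis using power2_less_imp_less[of "(lam + \<rho>) * \<sigma>" discr] by simp
qed

text \<open>This is \<open>1 < \<Omega>m\<close> with the denominator cleared. The difference of the
  squares is a positive multiple of the characteristic polynomial at 1, which is positive since both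
  of its factors exceed \<open>lam\<close> when \<rho> > \<mu> + \<sigma>.\<close>

lemma discr_lt: "discr < (lam + \<rho>) * \<mu> - (\<mu> + \<sigma>) * (\<mu> - \<sigma>)"
proof (rule power2_less_imp_less)
  have "(lam + \<rho>) * \<mu> - (\<mu> + \<sigma>) * (\<mu> - \<sigma>) > 0"
  proof -
    have "\<mu> * (\<mu> + \<sigma>) < \<mu> * (lam + \<rho>)" using params by (intro mult_strict_left_mono) auto
    moreover have "(\<mu> + \<sigma>) * (\<mu> - \<sigma>) \<le> \<mu> * (\<mu> + \<sigma>)" using params by (simp add: algebra_simps)
    ultimately show ?thesis by (simp add: algebra_simps)
  qed
  then show "0 \<le> (lam + \<rho>) * \<mu> - (\<mu> + \<sigma>) * (\<mu> - \<sigma>)" by simp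
  have "((lam + \<rho>) * \<mu> - (\<mu> + \<sigma>) * (\<mu> - \<sigma>))\<^sup>2 - discr\<^sup>2
      = (\<mu> + \<sigma>) * (\<mu> - \<sigma>) * ((lam + \<rho> - (\<mu> + \<sigma>)) * (lam + \<rho> - (\<mu> - \<sigma>)) - lam\<^sup>2)"
    using discr_square by (simp add: power2_eq_square algebra_simps)
  moreover have "lam * lam < (lam + \<rho> - (\<mu> + \<sigma>)) * (lam + \<rho> - (\<mu> - \<sigma>))"
    using params by (intro mult_strict_mono) auto
  then have "0 < (\<mu> + \<sigma>) * (\<mu> - \<sigma>) * ((lam + \<rho> - (\<mu> + \<sigma>)) * (lam + \<rho> - (\<mu> - \<sigma>)) - lam\<^sup>2)"
    using params by (intro mult_pos_pos) (auto simp: power2_eq_square)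
  ultimately show "discr\<^sup>2 < ((lam + \<rho>) * \<mu> - (\<mu> + \<sigma>) * (\<mu> - \<sigma>))\<^sup>2"
    by linarith
qed

lemma AB_nonzero: "(\<mu> + \<sigma>) * (\<mu> - \<sigma>) \<noteq> 0"
  using params by simp

lemma root_eqs:
  "\<Omega>p * ((\<mu> + \<sigma>) * (\<mu> - \<sigma>)) = (lam + \<rho>) * \<mu> + discr"
  "\<Omega>m * ((\<mu> + \<sigma>) * (\<mu> - \<sigma>)) = (lam + \<rho>) * \<mu> - discr"
  unfolding \<Omega>p_def \<Omega>m_def AB using AB_nonzero by simp_all

text \<open>After multiplication by a positive constant, the linear factors of the characteristic
  equation at its roots become \<open>discr\<close> plus or minus
  \<open>(lam + \<rho>) * \<sigma>\<close>, up to sign. Hence \<open>discr_gt\<close> decides all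
  their signs.\<close>

lemma root_identities:
  "(\<mu> - \<sigma>) * ((\<mu> + \<sigma>) * \<Omega>p - (lam + \<rho>)) = discr + (lam + \<rho>) * \<sigma>"
  "(\<mu> + \<sigma>) * ((\<mu> - \<sigma>) * \<Omega>p - (lam + \<rho>)) = discr - (lam + \<rho>) * \<sigma>"
  "(\<mu> - \<sigma>) * ((\<mu> + \<sigma>) * \<Omega>m - (lam + \<rho>)) = - (discr - (lam + \<rho>) * \<sigma>)"
  "(\<mu> + \<sigma>) * ((\<mu> - \<sigma>) * \<Omega>m - (lam + \<rho>)) = - (discr + (lam + \<rho>) * \<sigma>)"
  using root_eqs by algebra+

lemma \<omega>_eq: "lam * \<omega>p = lam + \<rho> - (\<mu> + \<sigma>) * \<Omega>p" "lam * \<omega>m = lam + \<rho> - (\<mu> + \<sigma>) * \<Omega>m"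
  unfolding \<omega>p_def \<omega>m_def using params by (simp_all add: field_simps)

text \<open>\<omega> was defined by the equation in state 1; this is the equation in state
  -1.\<close>

lemma characteristic:
  "(lam + \<rho> - (\<mu> - \<sigma>) * \<Omega>p) * \<omega>p = lam" "(lam + \<rho> - (\<mu> - \<sigma>) * \<Omega>m) * \<omega>m = lam"
proof -
  \<comment> \<open>The extra factors turn the product into the two quantities of
    \<open>root_identities\<close>, whose product \<open>discr_square\<close> supplies.\<close>
  have "(\<mu> + \<sigma>) * (\<mu> - \<sigma>) * lam * ((lam + \<rho> - (\<mu> - \<sigma>) * \<Omega>p) * \<omega>p) = (\<mu> + \<sigma>) * (\<mu> - \<sigma>) * lam * lam"
    using \<omega>_eq(1) root_identities(1,2) discr_square by algebra
  then show "(lam + \<rho> - (\<mu> - \<sigma>) * \<Omega>p) * \<omega>p = lam" using params by simp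
  have "(\<mu> + \<sigma>) * (\<mu> - \<sigma>) * lam * ((lam + \<rho> - (\<mu> - \<sigma>) * \<Omega>m) * \<omega>m) = (\<mu> + \<sigma>) * (\<mu> - \<sigma>) * lam * lam"
    using \<omega>_eq(2) root_identities(3,4) discr_square by algebra
  then show "(lam + \<rho> - (\<mu> - \<sigma>) * \<Omega>m) * \<omega>m = lam" using params by simp
qed

lemma discr_pos: "0 < discr"
proof -
  have "0 < (lam + \<rho>) * \<sigma>" using params by simp
  then show ?thesis using discr_gt by linarith
qed

lemma \<omega>_signs: "\<omega>p < 0" "0 < \<omega>m"
proof -
  have "0 < (\<mu> - \<sigma>) * ((\<mu> + \<sigma>) * \<Omega>p - (lam + \<rho>))"
    unfolding root_identities using params discr_pos by (simp add: add_pos_pos)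
  then have "lam * \<omega>p < 0" using \<omega>_eq params by (simp add: zero_less_mult_iff)
  then show "\<omega>p < 0" using params by (simp add: mult_less_0_iff)
  have "(\<mu> - \<sigma>) * ((\<mu> + \<sigma>) * \<Omega>m - (lam + \<rho>)) < 0"
    unfolding root_identities using discr_gt by simp
  then have "0 < lam * \<omega>m" using \<omega>_eq params by (simp add: mult_less_0_iff)
  then show "0 < \<omega>m" using params by (simp add: zero_less_mult_iff)
qed

lemma roots_order: "1 < \<Omega>m" "\<Omega>m < \<Omega>p" "lam + \<rho> < (\<mu> - \<sigma>) * \<Omega>p"
proof -
  have AB0: "0 < (\<mu> + \<sigma>) * (\<mu> - \<sigma>)" using params by simp
  show "1 < \<Omega>m" unfolding \<Omega>m_def AB using discr_lt AB0 by (simp add: less_divide_eq)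
  show "\<Omega>m < \<Omega>p" unfolding \<Omega>m_def \<Omega>p_def AB using AB0 discr_pos by (intro divide_strict_right_mono) auto
  have "0 < (\<mu> + \<sigma>) * ((\<mu> - \<sigma>) * \<Omega>p - (lam + \<rho>))"
    unfolding root_identities using discr_gt by simp
  then show "lam + \<rho> < (\<mu> - \<sigma>) * \<Omega>p" using params by (simp add: zero_less_mult_iff)
qed

section \<open>The middle branch and the sign pattern of \<open>H\<close>\<close>

lemma b_eq: "b * (lam + \<rho> - \<mu> - \<sigma>) = lam" and b_lt: "b < 1"
  using params by (simp_all add: b_def)

lemma \<Omega>_eq: "\<Omega> * (\<mu> + \<sigma>) = lam + \<rho>" and \<Omega>_gt: "1 < \<Omega>"
  using params by (simp_all add: \<Omega>_def)

lemma up_pos: "0 < up" and up_eq: "up * (\<rho> - \<mu> - \<sigma>) = a * \<rho>"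
  using params by (simp_all add: up_def)

lemma C_pos: "0 < C"
  unfolding C_def using b_lt \<Omega>_gt up_pos by simp

lemma G_slope_up: "b + C * \<Omega> * up powr (\<Omega> - 1) = 1"
  unfolding C_def using \<Omega>_gt up_pos by simp

lemma powr_step: "0 < u \<Longrightarrow> u powr \<Omega> = u * u powr (\<Omega> - 1)"
  by (simp add: powr_diff)

text \<open>\<open>C\<close> was fixed by the slope alone. With slope 1 at \<open>up\<close>, the
  equation in state 1 determines the value there, and the choice of \<open>up\<close> makes this
  value the payoff.\<close>

lemma G_up: "G up = up - a"
proof -
  \<comment> \<open>Naming the power makes the claim a polynomial identity modulo the defining
    equations of the constants.\<close>
  define c where "c = C * up powr (\<Omega> - 1)"
  define q where "q = lam / (lam + \<rho>)"
  have c: "c * \<Omega> = 1 - b" using G_slope_up by (simp add: c_def mult.commute mult.left_commute)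
  have q: "q * (lam + \<rho>) = lam" using params by (simp add: q_def)
  have "\<Omega> * (lam + \<rho>) * (b * up - a * q + c * up - (up - a)) = 0"
    using c q b_eq \<Omega>_eq up_eq by algebra
  moreover have "G up = b * up - a * q + c * up"
    unfolding G_def powr_step[OF up_pos] c_def q_def by simp
  ultimately show ?thesis using \<Omega>_gt params by simp
qed

lemma G_above_tangent:
  assumes "0 < u" "0 < y" "y \<noteq> u"
  shows "G u + (b + C * \<Omega> * u powr (\<Omega> - 1)) * (y - u) < G y"
proof -
  have "C * (u powr \<Omega> + \<Omega> * u powr (\<Omega> - 1) * (y - u)) < C * y powr \<Omega>"
    using powr_above_tangent_at[OF assms \<Omega>_gt] C_pos by simp
  then show ?thesis by (simp add: G_def algebra_simps)
qed

lemma G_gt: "0 < y \<Longrightarrow> y \<noteq> up \<Longrightarrow> y - a < G y"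
  using G_above_tangent[OF up_pos, of y] G_up G_slope_up by simp

lemma H_0: "0 < H 0"
proof -
  have "lam * lam < (lam + \<rho>) * (lam + \<rho>)" using params by (intro mult_strict_mono) auto
  then have "lam * (lam / (lam + \<rho>)) < lam + \<rho>" using params by (simp add: field_simps)
  then have "a * (lam * (lam / (lam + \<rho>))) < a * (lam + \<rho>)"
    using params by (intro mult_strict_left_mono) auto
  then show ?thesis by (simp add: H_def G_def algebra_simps)
qed

text \<open>At \<open>up\<close> state 1 is worth the payoff as well, so only the drift of the
  payoff remains. It vanishes in state 1, and passing to state -1 lowers it by
  \<open>2 * \<sigma> * up\<close>.\<close>

lemma H_up: "H up < 0"
proof -
  have "H up = (\<mu> - \<sigma>) * up - \<rho> * (up - a)" unfolding H_def G_up by (simp add: algebra_simps)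
  also have "\<dots> = - 2 * \<sigma> * up" using up_eq by (simp add: algebra_simps)
  finally show ?thesis using up_pos params by simp
qed

lemma H_convex: "convex_on {0<..} H"
proof -
  define c where "c = (\<mu> - \<sigma>) + lam * b - (lam + \<rho>)"
  define e where "e = (lam + \<rho>) * a - lam * (a * (lam / (lam + \<rho>)))"
  have "convex_on {0<..} (\<lambda>u. (lam * C) * u powr \<Omega>)"
    using params C_pos \<Omega>_gt by (intro convex_on_cmul powr_convex) auto
  moreover have "convex_on {0<..} (\<lambda>u. c * u + e)"
    by (intro convex_onI) (auto simp: algebra_simps)
  ultimately have "convex_on {0<..} (\<lambda>u. (lam * C) * u powr \<Omega> + (c * u + e))"
    by (rule convex_on_add)
  also have "(\<lambda>u. (lam * C) * u powr \<Omega> + (c * u + e)) = H"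
    by (auto simp: fun_eq_iff H_def G_def c_def e_def algebra_simps)
  finally show ?thesis .
qed

lemma H_root_exists: "\<exists>u. 0 < u \<and> u < up \<and> H u = 0"
proof -
  have "continuous_on {0..up} H"
    unfolding H_def G_def using \<Omega>_gt by (intro continuous_intros continuous_on_powr') auto
  then obtain u where "0 \<le> u" "u \<le> up" "H u = 0"
    using IVT2'[of H up 0 0] H_0 H_up up_pos by auto
  then show ?thesis using H_0 H_up by (metis less_eq_real_def less_irrefl)
qed

section \<open>The threshold equation in its explicit form\<close>

definition "\<Delta> = \<Omega>p - \<Omega>m"
definition "N = \<omega>p * \<Omega>p - \<omega>m * \<Omega>m - lam * \<omega>p * \<omega>m / (lam + \<rho>) * (\<Omega>p - \<Omega>m)"
definition "D = \<omega>p * (\<Omega>p - 1) - \<omega>m * (\<Omega>m - 1) - lam * \<omega>p * \<omega>m / (lam + \<rho> - \<mu> - \<sigma>) * (\<Omega>p - \<Omega>m)"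
definition "\<Phi> u = u - C * (\<omega>p * \<omega>m * (\<Omega>p - \<Omega>m) / D) * u powr \<Omega>"

text \<open>By \<open>root_identities\<close> the two factors are, up to the same constant,
  \<open>- (discr + (lam + \<rho>) * \<sigma>)\<close> and
  \<open>discr - (lam + \<rho>) * \<sigma>\<close>.\<close>

lemma \<omega>_product: "\<omega>p * \<omega>m * (\<mu> - \<sigma>) = - (\<mu> + \<sigma>)"
proof -
  have "(\<mu> - \<sigma>) * lam\<^sup>2 * (\<omega>p * \<omega>m * (\<mu> - \<sigma>)) = (\<mu> - \<sigma>) * lam\<^sup>2 * (- (\<mu> + \<sigma>))"
    using \<omega>_eq root_identities(1,3) discr_square by algebra
  then show ?thesis using params by simp
qed

lemma \<Omega>_sum: "(\<Omega>p + \<Omega>m) * ((\<mu> + \<sigma>) * (\<mu> - \<sigma>)) = 2 * \<mu> * (lam + \<rho>)"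
  using root_eqs by (simp add: algebra_simps)

lemma \<omega>\<Omega>_difference: "lam * (\<mu> - \<sigma>) * (\<omega>p * \<Omega>p - \<omega>m * \<Omega>m) = - (lam + \<rho>) * (\<mu> + \<sigma>) * \<Delta>"
proof -
  have "lam * (\<mu> - \<sigma>) * (\<omega>p * \<Omega>p - \<omega>m * \<Omega>m)
    = \<Delta> * ((lam + \<rho>) * (\<mu> - \<sigma>) - (\<Omega>p + \<Omega>m) * ((\<mu> + \<sigma>) * (\<mu> - \<sigma>)))"
    using \<omega>_eq unfolding \<Delta>_def by algebra
  then show ?thesis unfolding \<Omega>_sum by (simp add: algebra_simps)
qed

text \<open>Up to the common factor \<open>\<Delta> * (\<mu> + \<sigma>)\<close>, this is the
  constant term of \<open>H\<close> divided by \<open>- a\<close>; \<open>D_eq\<close> likewise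
  produces the linear coefficient of \<open>H\<close>.\<close>

lemma N_eq: "lam * (\<mu> - \<sigma>) * N = \<Delta> * (\<mu> + \<sigma>) * (lam * (lam / (lam + \<rho>)) - (lam + \<rho>))"
proof -
  define q where "q = lam / (lam + \<rho>)"
  have "N = \<omega>p * \<Omega>p - \<omega>m * \<Omega>m - q * (\<omega>p * \<omega>m) * \<Delta>"
    by (simp add: N_def q_def \<Delta>_def)
  then show ?thesis
    unfolding q_def[symmetric] using \<omega>\<Omega>_difference \<omega>_product by algebra
qed

lemma D_eq: "lam * (\<mu> - \<sigma>) * D = \<Delta> * (\<mu> + \<sigma>) * (\<mu> - \<sigma> + lam * b - (lam + \<rho>))"
proof -
  have "lam * (\<omega>p - \<omega>m) = - (\<mu> + \<sigma>) * \<Delta>"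
    using \<omega>_eq unfolding \<Delta>_def by algebra
  moreover have "D = (\<omega>p * \<Omega>p - \<omega>m * \<Omega>m) - (\<omega>p - \<omega>m) - b * (\<omega>p * \<omega>m) * \<Delta>"
    by (simp add: D_def b_def \<Delta>_def algebra_simps)
  ultimately show ?thesis
    using \<omega>\<Omega>_difference \<omega>_product by algebra
qed

lemma \<Delta>_pos: "0 < \<Delta>"
  using roots_order by (simp add: \<Delta>_def)

lemma D_nonzero: "D \<noteq> 0"
proof -
  have "lam * b < lam" using b_lt params by simp
  then have "\<mu> - \<sigma> + lam * b - (lam + \<rho>) < 0" using params by linarith
  then have "\<Delta> * (\<mu> + \<sigma>) * (\<mu> - \<sigma> + lam * b - (lam + \<rho>)) \<noteq> 0" using \<Delta>_pos params by simp
  then show ?thesis using D_eq by auto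
qed

text \<open>After multiplication by \<open>lam * (\<mu> - \<sigma>) * D\<close>, the exponents and
  ratios survive only in an overall factor of \<open>H u\<close>: the coefficients come from
  \<open>D_eq\<close>, \<open>N_eq\<close> and \<open>\<omega>_product\<close>.\<close>

lemma \<Phi>_iff: "\<Phi> u = a * (N / D) \<longleftrightarrow> H u = 0"
proof -
  have "lam * (\<mu> - \<sigma>) * (D * (\<Phi> u - a * (N / D)))
      = (lam * (\<mu> - \<sigma>) * D) * u - lam * C * (\<omega>p * \<omega>m * (\<mu> - \<sigma>)) * \<Delta> * u powr \<Omega> - a * (lam * (\<mu> - \<sigma>) * N)"
    unfolding \<Phi>_def \<Delta>_def using D_nonzero by (simp add: field_simps)
  also have "\<dots> = \<Delta> * (\<mu> + \<sigma>) * H u"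
    unfolding D_eq N_eq \<omega>_product H_def G_def by (simp add: algebra_simps)
  finally have *: "lam * (\<mu> - \<sigma>) * D * (\<Phi> u - a * (N / D)) = \<Delta> * (\<mu> + \<sigma>) * H u"
    by (simp add: mult.assoc)
  have "lam * (\<mu> - \<sigma>) * D \<noteq> 0" "\<Delta> * (\<mu> + \<sigma>) \<noteq> 0"
    using D_nonzero \<Delta>_pos params by auto
  with * show ?thesis by (metis eq_iff_diff_eq_0 mult_eq_0_iff)
qed

end

section \<open>Smooth fit at the lower threshold\<close>

locale smooth_fit = stopping_problem +
  fixes um :: real
  assumes um: "0 < um" "um < up" "H um = 0"
begin

lemma H_nonpos:
  assumes "um \<le> u" "u \<le> up"
  shows "H u \<le> 0"
proof -
  define t where "t = (u - um) / (up - um)"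
  have t: "0 \<le> t" "t \<le> 1" using assms um by (auto simp: t_def)
  have "t * (up - um) = u - um" using um by (simp add: t_def)
  then have u: "(1 - t) * um + t * up = u" by (simp add: algebra_simps)
  have "H ((1 - t) *\<^sub>R um + t *\<^sub>R up) \<le> (1 - t) * H um + t * H up"
    using um up_pos by (intro convex_onD[OF H_convex t]) auto
  also have "\<dots> \<le> 0" using um(3) H_up t by (simp add: mult_le_0_iff)
  finally show ?thesis using u by simp
qed

text \<open>The locale takes an arbitrary zero \<open>um\<close> of \<open>H\<close> in the interval
  from 0 to \<open>up\<close>. An earlier zero would place \<open>um\<close> on a chord that runs
  from 0 to a negative value, so convexity would make \<open>H um\<close> negative.\<close>

lemma um_least:
  assumes "0 \<le> u" "H u = 0"
  shows "um \<le> u"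
proof (rule ccontr)
  assume "\<not> um \<le> u"
  then have "u < um" by simp
  have "0 < u" using assms H_0 by (cases "u = 0") auto
  define t where "t = (um - u) / (up - u)"
  have t: "0 < t" "t \<le> 1" using \<open>u < um\<close> um by (auto simp: t_def)
  have "t * (up - u) = um - u" using um \<open>u < um\<close> by (simp add: t_def)
  then have u: "(1 - t) * u + t * up = um" by (simp add: algebra_simps)
  have "H ((1 - t) *\<^sub>R u + t *\<^sub>R up) \<le> (1 - t) * H u + t * H up"
    using t up_pos \<open>0 < u\<close> by (intro convex_onD[OF H_convex]) auto
  also have "\<dots> < 0" using assms H_up t by (simp add: mult_less_0_iff)
  finally show False using u um(3) by simp
qed

text \<open>The derivative of \<open>G\<close> at \<open>um\<close>.\<close>

definition "slope = b + C * \<Omega> * um powr (\<Omega> - 1)"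

text \<open>The derivative of \<open>H\<close> at \<open>um\<close> is negative, because
  \<open>H\<close> vanishes at \<open>um\<close>, is negative at \<open>up\<close> and lies above
  its tangents. This becomes the convexity of the state -1 branch in
  \<open>P_convex\<close>.\<close>

lemma slope_lt: "\<mu> - \<sigma> + lam * slope < lam + \<rho>"
proof -
  have "G um + slope * (up - um) < G up"
    unfolding slope_def using G_above_tangent[OF um(1) up_pos] um(2) by simp
  then have "lam * (G um + slope * (up - um)) < lam * G up" using params by simp
  then have "(\<mu> - \<sigma> + lam * slope - (lam + \<rho>)) * (up - um) < H up - H um"
    by (simp add: H_def algebra_simps)
  also have "\<dots> < 0" using H_up um(3) by simp
  finally show ?thesis using um(2) by (simp add: mult_less_0_iff)
qed

lemma slope_le: "slope \<le> 1"
proof -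
  have "um powr (\<Omega> - 1) \<le> up powr (\<Omega> - 1)" using um \<Omega>_gt by (intro powr_mono2) auto
  then have "C * \<Omega> * um powr (\<Omega> - 1) \<le> C * \<Omega> * up powr (\<Omega> - 1)"
    using C_pos \<Omega>_gt by (intro mult_left_mono) auto
  then show ?thesis using G_slope_up by (simp add: slope_def)
qed

text \<open>Since \<open>G um\<close> exceeds the payoff, \<open>H um = 0\<close> leaves a negative
  drift for the discounted payoff in state -1.\<close>

lemma um_gt: "\<rho> * a < um * (\<rho> - (\<mu> - \<sigma>))" "a < um"
proof -
  have "lam * (um - a) < lam * G um" using G_gt[of um] um params by simp
  then show *: "\<rho> * a < um * (\<rho> - (\<mu> - \<sigma>))" using um(3) by (simp add: H_def algebra_simps)
  have "um * (\<rho> - (\<mu> - \<sigma>)) < um * \<rho>" using um params by simp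
  with * have "\<rho> * a < \<rho> * um" by (simp add: mult.commute)
  then show "a < um" using params by simp
qed

text \<open>\<open>Pm\<close> and \<open>Pp\<close> solve the linear system of value and slope
  matching in state -1. They are the values at \<open>um\<close> of the two power terms, as the
  exponentials below are centred at \<open>ln um\<close>.\<close>

definition "Pm = (um * (\<Omega>p - 1) - a * \<Omega>p) / (\<Omega>p - \<Omega>m)"
definition "Pp = (um * (\<Omega>m - 1) - a * \<Omega>m) / (\<Omega>m - \<Omega>p)"

lemma P_eqs: "Pm * (\<Omega>p - \<Omega>m) = um * (\<Omega>p - 1) - a * \<Omega>p" "Pp * (\<Omega>m - \<Omega>p) = um * (\<Omega>m - 1) - a * \<Omega>m"
  using roots_order by (simp_all add: Pm_def Pp_def)

lemma P_sum: "Pm + Pp = um - a" and P_weighted: "\<Omega>m * Pm + \<Omega>p * Pp = um"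
proof -
  have nz: "\<Omega>p - \<Omega>m \<noteq> 0" using roots_order by simp
  have "(\<Omega>p - \<Omega>m) * (Pm + Pp) = (\<Omega>p - \<Omega>m) * (um - a)" using P_eqs by algebra
  then show "Pm + Pp = um - a" using nz by simp
  have "(\<Omega>p - \<Omega>m) * (\<Omega>m * Pm + \<Omega>p * Pp) = (\<Omega>p - \<Omega>m) * um" using P_eqs by algebra
  then show "\<Omega>m * Pm + \<Omega>p * Pp = um" using nz by simp
qed

lemma Pm_pos: "0 < Pm"
proof -
  have "(\<mu> - \<sigma>) * um < \<rho> * (um - a)" using um_gt(1) by (simp add: algebra_simps)
  also have "\<dots> \<le> ((\<mu> - \<sigma>) * \<Omega>p) * (um - a)"
    using roots_order(3) um_gt(2) params by (intro mult_right_mono) auto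
  finally have "(\<mu> - \<sigma>) * um < (\<mu> - \<sigma>) * (\<Omega>p * (um - a))" by (simp add: mult.assoc)
  then have "um < \<Omega>p * (um - a)" using params by simp
  then show ?thesis unfolding Pm_def using roots_order by (simp add: algebra_simps)
qed

definition "Rm = Pm / \<omega>m"
definition "Rp = Pp / \<omega>p"

lemma R_eqs: "\<omega>m * Rm = Pm" "\<omega>p * Rp = Pp"
  using \<omega>_signs by (simp_all add: Rm_def Rp_def)

text \<open>The equation in state -1 for each exponent separately; \<open>lam_P\<close> is the one
  in state 1.\<close>

lemma lam_R: "lam * Rm = (lam + \<rho> - (\<mu> - \<sigma>) * \<Omega>m) * Pm" "lam * Rp = (lam + \<rho> - (\<mu> - \<sigma>) * \<Omega>p) * Pp"
  unfolding R_eqs[symmetric] by (simp_all only: mult.assoc[symmetric] characteristic)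

lemma lam_P: "lam * Pm = (lam + \<rho> - (\<mu> + \<sigma>) * \<Omega>m) * Rm" "lam * Pp = (lam + \<rho> - (\<mu> + \<sigma>) * \<Omega>p) * Rp"
  unfolding R_eqs[symmetric] by (simp_all only: mult.assoc[symmetric] \<omega>_eq)

text \<open>Value matching in state 1, and the place where \<open>H um = 0\<close> acts: the
  equation in state -1 on the left determines the value of state 1 from the value and slope of state
  -1, and \<open>H um = 0\<close> is the same relation for \<open>G um\<close>.\<close>

lemma R_sum: "Rm + Rp = G um"
proof -
  have "lam * (Rm + Rp) = lam * G um"
    using lam_R P_sum P_weighted um(3) unfolding H_def by algebra
  then show ?thesis using params by simp
qed

lemma G_ode: "(\<mu> + \<sigma>) * (um * slope) + lam * (um - a) = (lam + \<rho>) * G um"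
proof -
  define c where "c = C * um powr (\<Omega> - 1)"
  define q where "q = lam / (lam + \<rho>)"
  have q: "q * (lam + \<rho>) = lam" using params by (simp add: q_def)
  have "G um = b * um - a * q + c * um" "slope = b + c * \<Omega>"
    unfolding G_def powr_step[OF um(1)] c_def q_def slope_def by (simp_all add: algebra_simps)
  then show ?thesis using q b_eq \<Omega>_eq by algebra
qed

text \<open>Slope matching in state 1 comes for free: both branches satisfy the same first-order
  equation at \<open>um\<close>, and the values of both states already match.\<close>

lemma R_weighted: "\<Omega>m * Rm + \<Omega>p * Rp = um * slope"
proof -
  have "(\<mu> + \<sigma>) * (\<Omega>m * Rm + \<Omega>p * Rp) = (\<mu> + \<sigma>) * (um * slope)"
    using lam_P R_sum P_sum G_ode by algebra
  then show ?thesis using params by simp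
qed

text \<open>The expression is um^2 times the second derivative of the state -1 branch at
  \<open>um\<close>. Differentiating the equation in state -1 expresses it through the slopes 1 and
  \<open>slope\<close> of the two states.\<close>

lemma P_convex: "0 < Pm * \<Omega>m * (\<Omega>m - 1) + Pp * \<Omega>p * (\<Omega>p - 1)"
proof -
  have "(\<mu> - \<sigma>) * (Pm * \<Omega>m * (\<Omega>m - 1) + Pp * \<Omega>p * (\<Omega>p - 1))
      = um * (lam + \<rho> - (\<mu> - \<sigma> + lam * slope))"
    using lam_R P_weighted R_weighted by algebra
  moreover have "0 < um * (lam + \<rho> - (\<mu> - \<sigma> + lam * slope))" using um slope_lt by simp
  ultimately have "0 < (\<mu> - \<sigma>) * (Pm * \<Omega>m * (\<Omega>m - 1) + Pp * \<Omega>p * (\<Omega>p - 1))" by simp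
  then show ?thesis by (rule zero_less_mult_pos) (use params in simp)
qed

text \<open>The same differentiation in state 1 involves only the slopes of the two states, so the
  second derivative agrees with that of \<open>G\<close> at \<open>um\<close>, which is positive by
  its power term.\<close>

lemma R_convex: "0 < Rm * \<Omega>m * (\<Omega>m - 1) + Rp * \<Omega>p * (\<Omega>p - 1)"
proof -
  have "(\<mu> + \<sigma>) * (Rm * \<Omega>m * (\<Omega>m - 1) + Rp * \<Omega>p * (\<Omega>p - 1))
      = um * ((lam + \<rho> - \<mu> - \<sigma>) * slope - lam)"
    using lam_P P_weighted R_weighted by algebra
  also have "(lam + \<rho> - \<mu> - \<sigma>) * slope - lam = (lam + \<rho> - \<mu> - \<sigma>) * (C * \<Omega> * um powr (\<Omega> - 1))"
    using b_eq by (simp add: slope_def algebra_simps)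
  finally have "0 < (\<mu> + \<sigma>) * (Rm * \<Omega>m * (\<Omega>m - 1) + Rp * \<Omega>p * (\<Omega>p - 1))"
    using params um C_pos \<Omega>_gt by simp
  then show ?thesis by (rule zero_less_mult_pos) (use params in simp)
qed

section \<open>The candidate in the logarithm of the price\<close>

definition wm :: "real \<Rightarrow> real" where
  "wm z = Pm * exp (\<Omega>m * (z - ln um)) + Pp * exp (\<Omega>p * (z - ln um))"

definition wm' :: "real \<Rightarrow> real" where
  "wm' z = \<Omega>m * Pm * exp (\<Omega>m * (z - ln um)) + \<Omega>p * Pp * exp (\<Omega>p * (z - ln um))"

definition wp :: "real \<Rightarrow> real" where
  "wp z = Rm * exp (\<Omega>m * (z - ln um)) + Rp * exp (\<Omega>p * (z - ln um))"

definition wp' :: "real \<Rightarrow> real" where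
  "wp' z = \<Omega>m * Rm * exp (\<Omega>m * (z - ln um)) + \<Omega>p * Rp * exp (\<Omega>p * (z - ln um))"

definition wo :: "real \<Rightarrow> real" where
  "wo z = b * exp z - a * (lam / (lam + \<rho>)) + C * exp (\<Omega> * z)"

definition wo' :: "real \<Rightarrow> real" where
  "wo' z = b * exp z + C * \<Omega> * exp (\<Omega> * z)"

text \<open>The variable \<open>z\<close> is the logarithm of the price; only the states \<open>s = 1\<close> and \<open>s = -1\<close> matter.\<close>

definition v :: "real \<Rightarrow> real \<Rightarrow> real" where
  "v s = (if s = 1 then (\<lambda>z. if z \<le> ln um then wp z else if z \<le> ln up then wo z else exp z - a)
     else (\<lambda>z. if z \<le> ln um then wm z else exp z - a))"

definition v' :: "real \<Rightarrow> real \<Rightarrow> real" where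
  "v' s = (if s = 1 then (\<lambda>z. if z \<le> ln um then wp' z else if z \<le> ln up then wo' z else exp z)
     else (\<lambda>z. if z \<le> ln um then wm' z else exp z))"

lemma wo_eq: "wo z = G (exp z)"
  by (simp add: wo_def G_def powr_def)

lemma wo'_eq: "wo' z = exp z * (b + C * \<Omega> * exp z powr (\<Omega> - 1))"
  by (simp add: wo'_def powr_def exp_diff algebra_simps)

lemma ln_um_up: "ln um < ln up"
  using um by simp

lemma glue_values:
  "wm (ln um) = exp (ln um) - a" "wm' (ln um) = exp (ln um)" "wp (ln um) = wo (ln um)" "wp' (ln um) = wo' (ln um)"
  "wo (ln up) = exp (ln up) - a" "wo' (ln up) = exp (ln up)"
  using um up_pos P_sum P_weighted R_sum R_weighted G_up G_slope_up
  by (simp_all add: wm_def wm'_def wp_def wp'_def wo_eq wo'_eq slope_def)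

lemma v_derivative: "(v s has_real_derivative v' s z) (at z)"
proof -
  have e: "((\<lambda>z. exp z - a) has_real_derivative exp z) (at z)" for z
    by (auto intro!: derivative_eq_intros)
  have m: "(wm has_real_derivative wm' z) (at z)" "(wp has_real_derivative wp' z) (at z)" "(wo has_real_derivative wo' z) (at z)" for z
    unfolding wm_def wm'_def wp_def wp'_def wo_def wo'_def by (auto intro!: derivative_eq_intros)
  have o: "((\<lambda>z. if z \<le> ln up then wo z else exp z - a) has_real_derivative (if z \<le> ln up then wo' z else exp z)) (at z)" for z
    by (rule has_real_derivative_glue[OF m(3) e glue_values(5,6)])
  show ?thesis
  proof (cases "s = 1")
    case True
    show ?thesis unfolding v_def v'_def True
      using has_real_derivative_glue[OF m(2) o, of "ln um"] glue_values ln_um_up by simp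
  next
    case False
    then show ?thesis unfolding v_def v'_def
      using has_real_derivative_glue[OF m(1) e glue_values(1,2)] by simp
  qed
qed

lemma v'_continuous: "continuous_on UNIV (v' s)"
proof -
  have c: "continuous_on UNIV wm'" "continuous_on UNIV wp'" "continuous_on UNIV wo'" "continuous_on UNIV (exp :: real \<Rightarrow> real)"
    unfolding wm'_def wp'_def wo'_def by (auto intro!: continuous_intros)
  have o: "continuous_on UNIV (\<lambda>z. if z \<le> ln up then wo' z else exp z)"
    by (rule continuous_glue[OF c(3,4) glue_values(6)])
  show ?thesis
  proof (cases "s = 1")
    case True
    show ?thesis unfolding v'_def True
      using continuous_glue[OF c(2) o, of "ln um"] glue_values ln_um_up by simp
  next
    case False
    then show ?thesis unfolding v'_def
      using continuous_glue[OF c(1,4) glue_values(2)] by simp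
  qed
qed

section \<open>The sign of the generator on the candidate\<close>

definition L where
  "L s z = (\<mu> + \<sigma> * s) * v' s z + lam * (v (- s) z - v s z) - \<rho> * v s z"

lemma L_below:
  assumes "z \<le> ln um"
  shows "L 1 z = 0" "L (-1) z = 0"
proof -
  define e f where "e = exp (\<Omega>m * (z - ln um))" "f = exp (\<Omega>p * (z - ln um))"
  have "L 1 z = (\<mu> + \<sigma>) * (\<Omega>m * Rm * e + \<Omega>p * Rp * f) + lam * ((Pm * e + Pp * f) - (Rm * e + Rp * f)) - \<rho> * (Rm * e + Rp * f)"
    using assms by (simp add: L_def v_def v'_def wm_def wp_def wp'_def e_f_def)
  also have "\<dots> = 0" using lam_P by algebra
  finally show "L 1 z = 0" .
  have "L (-1) z = (\<mu> - \<sigma>) * (\<Omega>m * Pm * e + \<Omega>p * Pp * f) + lam * ((Rm * e + Rp * f) - (Pm * e + Pp * f)) - \<rho> * (Pm * e + Pp * f)"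
    using assms by (simp add: L_def v_def v'_def wm_def wp_def wm'_def e_f_def)
  also have "\<dots> = 0" using lam_R by algebra
  finally show "L (-1) z = 0" .
qed

lemma L_between:
  assumes "ln um < z" "z \<le> ln up"
  shows "L 1 z = 0" "L (-1) z = H (exp z)"
proof -
  define e f q where "e = exp z" "f = exp (\<Omega> * z)" "q = lam / (lam + \<rho>)"
  have q: "q * (lam + \<rho>) = lam" using params by (simp add: e_f_q_def)
  have "L 1 z = (\<mu> + \<sigma>) * (b * e + C * \<Omega> * f) + lam * ((e - a) - (b * e - a * q + C * f)) - \<rho> * (b * e - a * q + C * f)"
    using assms by (simp add: L_def v_def v'_def wo_def wo'_def e_f_q_def)
  also have "\<dots> = e * (lam - b * (lam + \<rho> - \<mu> - \<sigma>)) + C * f * (\<Omega> * (\<mu> + \<sigma>) - (lam + \<rho>)) + a * (q * (lam + \<rho>) - lam)"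
    by (simp add: algebra_simps)
  also have "\<dots> = 0" unfolding q b_eq \<Omega>_eq by simp
  finally show "L 1 z = 0" .
  show "L (-1) z = H (exp z)"
    using assms by (simp add: L_def v_def v'_def wo_eq H_def algebra_simps)
qed

lemma L_plus_zero: "z \<le> ln up \<Longrightarrow> L 1 z = 0"
  using L_below(1) L_between(1) by (cases "z \<le> ln um") auto

text \<open>Both states carry the payoff here. Its generator in state 1 is affine in the price,
  decreasing, and zero at \<open>up\<close>; the smaller drift in state -1 only lowers it.\<close>

lemma L_above:
  assumes "ln up < z"
  shows "L 1 z \<le> 0" "L (-1) z \<le> 0"
proof -
  have z: "ln um < z" "\<not> z \<le> ln um" using assms ln_um_up by auto
  have "up < exp z" using assms up_pos by (metis exp_ln exp_less_mono)
  then have "up * (\<rho> - \<mu> - \<sigma>) \<le> exp z * (\<rho> - \<mu> - \<sigma>)" using params by (intro mult_right_mono) auto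
  then have *: "a * \<rho> \<le> exp z * (\<rho> - \<mu> - \<sigma>)" by (simp add: up_eq)
  then show "L 1 z \<le> 0" using assms z by (simp add: L_def v_def v'_def algebra_simps)
  have "0 \<le> \<sigma> * exp z" using params by simp
  with * show "L (-1) z \<le> 0" using assms z by (simp add: L_def v_def v'_def algebra_simps)
qed

lemma L_nonpos: "s \<in> {-1, 1} \<Longrightarrow> L s z \<le> 0"
proof -
  have "H (exp z) \<le> 0" if "ln um < z" "z \<le> ln up"
  proof (rule H_nonpos)
    show "um \<le> exp z" using that um by (metis exp_le_cancel_iff exp_ln less_imp_le)
    show "exp z \<le> up" using that up_pos by (metis exp_le_cancel_iff exp_ln)
  qed
  moreover assume "s \<in> {-1, 1}"
  ultimately show ?thesis
    using L_below[of z] L_between[of z] L_above[of z]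
    by (cases "z \<le> ln um"; cases "z \<le> ln up") auto
qed

section \<open>Domination of the payoff, strict off the contact set\<close>

lemma exp_powr: "exp (q * (z - ln um)) = exp (z - ln um) powr q"
  by (simp add: powr_def)

text \<open>By value and slope matching, the payoff line is the tangent at \<open>um\<close> of the
  state -1 branch as a function of the price.\<close>

lemma v_minus_gt:
  assumes "z < ln um"
  shows "exp z - a < v (-1) z"
proof -
  define t where "t = exp (z - ln um)"
  have t: "0 < t" "t < 1" using assms by (auto simp: t_def)
  have "um * t = exp z" using um by (simp add: t_def exp_diff)
  moreover have "Pm + Pp + (Pm * \<Omega>m + Pp * \<Omega>p) * (t - 1) < Pm * t powr \<Omega>m + Pp * t powr \<Omega>p"
    using roots_order Pm_pos P_convex t by (intro two_powers_above_tangent) auto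
  moreover have "Pm * \<Omega>m + Pp * \<Omega>p = um" using P_weighted by (simp add: mult.commute)
  moreover have "v (-1) z = Pm * t powr \<Omega>m + Pp * t powr \<Omega>p"
    using assms by (simp add: v_def wm_def exp_powr t_def)
  ultimately show ?thesis
    using P_sum by (simp add: right_diff_distrib)
qed

lemma v_plus_gt:
  assumes "z < ln up"
  shows "exp z - a < v 1 z"
proof (cases "z \<le> ln um")
  case True
  define t where "t = exp (z - ln um)"
  have t: "0 < t" "t \<le> 1" using True by (auto simp: t_def)
  have ut: "um * t = exp z" using um by (simp add: t_def exp_diff)
  have G: "um - a < G um" using G_gt um by simp
  have v: "v 1 z = Rm * t powr \<Omega>m + Rp * t powr \<Omega>p"
    using True by (simp add: v_def wp_def exp_powr t_def[symmetric])
  show ?thesis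
  \<comment> \<open>At the junction the tangent inequality is not strict; strictness comes from
    \<open>G_gt\<close>.\<close>
  proof (cases "t = 1")
    case True
    then show ?thesis using v ut G R_sum by simp
  next
    case False
    have "0 < Rm" using Pm_pos \<omega>_signs by (simp add: Rm_def)
    then have "Rm + Rp + (Rm * \<Omega>m + Rp * \<Omega>p) * (t - 1) < Rm * t powr \<Omega>m + Rp * t powr \<Omega>p"
      using roots_order R_convex t False by (intro two_powers_above_tangent) auto
    moreover have "(Rm * \<Omega>m + Rp * \<Omega>p) * (t - 1) = um * (t - 1) * slope"
      using R_weighted by (simp add: mult.commute mult.left_commute)
    \<comment> \<open>To the left of \<open>um\<close> a tangent of slope at most 1 falls no faster
      than the payoff line, and it starts strictly above it.\<close>
    moreover have "um * (t - 1) \<le> um * (t - 1) * slope"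
      using mult_left_mono_neg[of slope 1 "um * (t - 1)"] slope_le um t by (simp add: mult_le_0_iff)
    moreover have "um * (t - 1) = exp z - um" using ut by (simp add: right_diff_distrib)
    ultimately show ?thesis using v G R_sum by linarith
  qed
next
  case False
  have "exp z < up" using assms up_pos by (metis exp_less_cancel_iff exp_ln)
  then show ?thesis using False assms G_gt[of "exp z"] by (simp add: v_def wo_eq)
qed

lemma v_above: "ln um \<le> z \<Longrightarrow> v (-1) z = exp z - a" "ln up \<le> z \<Longrightarrow> v 1 z = exp z - a"
proof -
  show "ln um \<le> z \<Longrightarrow> v (-1) z = exp z - a"
    using glue_values(1) by (auto simp: v_def)
  show "ln up \<le> z \<Longrightarrow> v 1 z = exp z - a"
    using glue_values(5) ln_um_up by (auto simp: v_def)
qed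

lemma v_ge: "s \<in> {-1, 1} \<Longrightarrow> exp z - a \<le> v s z"
  using v_minus_gt[of z] v_plus_gt[of z] v_above[of z]
  by (cases "z < ln um"; cases "z < ln up") auto

section \<open>Formulas in the price itself\<close>

definition "Cp = um powr (- \<Omega>p) * ((um * (\<Omega>m - 1) - a * \<Omega>m) / (\<omega>p * (\<Omega>m - \<Omega>p)))"
definition "Cm = um powr (- \<Omega>m) * ((um * (\<Omega>p - 1) - a * \<Omega>p) / (\<omega>m * (\<Omega>p - \<Omega>m)))"

lemma C_eqs: "Cp = um powr (- \<Omega>p) * Rp" "Cm = um powr (- \<Omega>m) * Rm"
  by (simp_all add: Cp_def Cm_def Rp_def Rm_def Pp_def Pm_def mult.commute)

lemma exp_ln_power: "0 < y \<Longrightarrow> exp (q * (ln y - ln um)) = um powr (- q) * y powr q"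
  using um by (simp add: powr_def mult_exp_exp algebra_simps)

lemma v_formulas:
  assumes "0 < y"
  shows "y \<le> um \<Longrightarrow> v (-1) (ln y) = Cm * \<omega>m * y powr \<Omega>m + Cp * \<omega>p * y powr \<Omega>p"
    and "um \<le> y \<Longrightarrow> v (-1) (ln y) = y - a"
    and "y \<le> um \<Longrightarrow> v 1 (ln y) = Cm * y powr \<Omega>m + Cp * y powr \<Omega>p"
    and "um \<le> y \<Longrightarrow> y \<le> up \<Longrightarrow> v 1 (ln y) = b * y - a * (lam / (lam + \<rho>)) + C * y powr \<Omega>"
    and "up \<le> y \<Longrightarrow> v 1 (ln y) = y - a"
proof -
  show "v (-1) (ln y) = Cm * \<omega>m * y powr \<Omega>m + Cp * \<omega>p * y powr \<Omega>p" if "y \<le> um"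
  proof -
    have "v (-1) (ln y) = Pm * (um powr (- \<Omega>m) * y powr \<Omega>m) + Pp * (um powr (- \<Omega>p) * y powr \<Omega>p)"
      using that assms um by (simp add: v_def wm_def exp_ln_power)
    then show ?thesis by (simp add: C_eqs R_eqs[symmetric] mult_ac)
  qed
  show "um \<le> y \<Longrightarrow> v (-1) (ln y) = y - a" "up \<le> y \<Longrightarrow> v 1 (ln y) = y - a"
    using v_above[of "ln y"] assms um up_pos by simp_all
  show "y \<le> um \<Longrightarrow> v 1 (ln y) = Cm * y powr \<Omega>m + Cp * y powr \<Omega>p"
    using assms um by (simp add: v_def wp_def exp_ln_power C_eqs)
  show "v 1 (ln y) = b * y - a * (lam / (lam + \<rho>)) + C * y powr \<Omega>" if "um \<le> y" "y \<le> up"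
  proof -
    have "v 1 (ln y) = wo (ln y)"
      using that assms um up_pos glue_values(3) by (auto simp: v_def)
    then show ?thesis using assms by (simp add: wo_eq G_def)
  qed
qed

end

subsection \<open>The switching chain and its filtrations\<close>

locale switching = markov_chain_family "{-1, 1}" "\<lambda>x y. if x = y then - lam else lam" M P \<xi>
  for lam :: real and M :: "'a measure" and P :: "real \<Rightarrow> 'a measure"
    and \<xi> :: "real \<Rightarrow> 'a \<Rightarrow> real"
begin

abbreviation F :: "real \<Rightarrow> 'a measure" where
  "F t \<equiv> natural_filtration M \<xi> (ennreal t)"

abbreviation p :: "real \<Rightarrow> real \<Rightarrow> real \<Rightarrow> real" where
  "p h x y \<equiv> measure (P x) {\<omega> \<in> space M. \<xi> h \<omega> = y}"

lemma space_P: "s \<in> {-1, 1} \<Longrightarrow> space (P s) = space M"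
  using sets_P sets_eq_imp_space_eq by blast

lemma chain_values: "\<omega> \<in> space M \<Longrightarrow> 0 \<le> t \<Longrightarrow> \<xi> t \<omega> = -1 \<or> \<xi> t \<omega> = 1"
  using measurable_space[OF measurable_chain, of t \<omega>] by auto

lemma chain_borel: "0 \<le> t \<Longrightarrow> \<xi> t \<in> borel_measurable M"
  by (rule measurable_compose[OF measurable_chain]) (auto simp: measurable_count_space_eq1)

lemma space_natural_filtration [simp]: "space (natural_filtration M \<xi> t) = space M"
  unfolding natural_filtration_def by (rule space_measure_of) auto

lemma sets_natural_filtration:
  "sets (natural_filtration M \<xi> t) = sigma_sets (space M)
     {\<xi> u -` B \<inter> space M | u B. 0 \<le> u \<and> ennreal u \<le> t \<and> B \<in> sets borel}"
  unfolding natural_filtration_def by (rule sets_measure_of) auto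

lemma natural_filtration_subset: "sets (natural_filtration M \<xi> t) \<subseteq> sets M"
  unfolding sets_natural_filtration
  using measurable_sets[OF chain_borel] by (intro sets.sigma_sets_subset) auto

lemma natural_filtration_mono:
  "s \<le> t \<Longrightarrow> sets (natural_filtration M \<xi> s) \<subseteq> sets (natural_filtration M \<xi> t)"
  unfolding sets_natural_filtration by (intro sigma_sets_mono') (auto intro: order_trans)

lemma chain_adapted:
  "0 \<le> u \<Longrightarrow> ennreal u \<le> t \<Longrightarrow> \<xi> u \<in> borel_measurable (natural_filtration M \<xi> t)"
  by (rule measurableI) (auto simp: sets_natural_filtration)

text \<open>The two states are at distance 2, so right continuity forces the chain to stay put for a
  short time.\<close>

lemma chain_eventually_right:
  assumes "\<omega> \<in> space M" "0 \<le> t"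
  shows "eventually (\<lambda>u. \<xi> u \<omega> = \<xi> t \<omega>) (at_right t)"
proof -
  have "eventually (\<lambda>u. \<bar>\<xi> u \<omega> - \<xi> t \<omega>\<bar> < 1) (at_right t)"
    using right_continuous[OF assms] tendstoD[of "\<lambda>u. \<xi> u \<omega>" "\<xi> t \<omega>" "at_right t" 1]
    by (simp add: continuous_within dist_real_def)
  moreover have "eventually (\<lambda>u. t < u) (at_right t)"
    by (simp add: eventually_at_right_less)
  ultimately show ?thesis
  proof eventually_elim
    case (elim u)
    then show ?case
      using chain_values[OF assms] chain_values[OF assms(1), of u] assms(2) by auto
  qed
qed

lemma finite_measure_subalgebra_F:
  assumes "s \<in> {-1, 1}"
  shows "finite_measure_subalgebra (P s) (natural_filtration M \<xi> t)"
proof -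
  interpret prob_space "P s" by (rule prob_space_P[OF assms])
  show ?thesis
    by standard (use natural_filtration_subset in \<open>simp add: subalgebra_def space_P[OF assms] sets_P[OF assms]\<close>)
qed

text \<open>The Markov property on events of the past identifies the conditional probability of the
  transition given \<open>F t\<close>; the bounded factor \<open>U\<close>, known at time
  \<open>t\<close>, can then be pulled out.\<close>

lemma markov_expectation:
  assumes s: "s \<in> {-1, 1}" and x: "x \<in> {-1, 1}" and y: "y \<in> {-1, 1}" and t: "0 \<le> t" and h: "0 \<le> h"
    and U: "U \<in> borel_measurable (F t)" and bd: "\<And>\<omega>. \<omega> \<in> space M \<Longrightarrow> \<bar>U \<omega>\<bar> \<le> K"
  shows "(\<integral>\<omega>. U \<omega> * of_bool (\<xi> t \<omega> = x \<and> \<xi> (t + h) \<omega> = y) \<partial>P s)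
    = p h x y * (\<integral>\<omega>. U \<omega> * of_bool (\<xi> t \<omega> = x) \<partial>P s)"
proof -
  interpret prob_space "P s" by (rule prob_space_P[OF s])
  interpret finite_measure_subalgebra "P s" "F t" by (rule finite_measure_subalgebra_F[OF s])
  define f where "f \<omega> = (of_bool (\<xi> t \<omega> = x \<and> \<xi> (t + h) \<omega> = y) :: real)" for \<omega>
  define g where "g \<omega> = p h x y * (of_bool (\<xi> t \<omega> = x) :: real)" for \<omega>
  have [measurable]: "\<xi> t \<in> borel_measurable (F t)" using t by (intro chain_adapted) auto
  have [measurable]: "\<xi> t \<in> borel_measurable (P s)" "\<xi> (t + h) \<in> borel_measurable (P s)"
    using chain_borel[of t] chain_borel[of "t + h"] t h measurable_cong_sets[OF sets_P[OF s] refl]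
    by auto
  have g [measurable]: "g \<in> borel_measurable (F t)" unfolding g_def by measurable
  have gP [measurable]: "g \<in> borel_measurable (P s)" unfolding g_def by measurable
  have f [measurable]: "f \<in> borel_measurable (P s)" unfolding f_def by measurable
  have UP [measurable]: "U \<in> borel_measurable (P s)"
    by (rule measurable_from_subalg[OF subalg U])
  have intf: "integrable (P s) f"
    by (rule integrable_const_bound[of _ 1]) (auto simp: f_def)
  have intg: "integrable (P s) g"
    by (rule integrable_const_bound[of _ "p h x y"]) (auto simp: g_def)
  have "AE \<omega> in P s. real_cond_exp (P s) (F t) f \<omega> = g \<omega>"
  proof (rule real_cond_exp_charact[OF _ intf intg g])
    fix A assume A: "A \<in> sets (F t)"
    then have AM: "A \<in> sets (P s)" using natural_filtration_subset sets_P[OF s] by auto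
    have sub: "A \<subseteq> space M" using A sets.sets_into_space by fastforce
    have "(\<integral>\<omega>\<in>A. f \<omega> \<partial>P s) = (\<integral>\<omega>. indicator {\<omega> \<in> A. \<xi> t \<omega> = x \<and> \<xi> (t + h) \<omega> = y} \<omega> \<partial>P s)"
      unfolding set_lebesgue_integral_def
      by (rule Bochner_Integration.integral_cong) (auto simp: f_def indicator_def)
    also have "\<dots> = measure (P s) {\<omega> \<in> A. \<xi> t \<omega> = x \<and> \<xi> (t + h) \<omega> = y}"
      using sub by (simp add: space_P[OF s] Int_absorb1 Int_absorb2 subset_eq)
    also have "\<dots> = p h x y * measure (P s) {\<omega> \<in> A. \<xi> t \<omega> = x}"
      using markov_property[OF s x y t h A] by simp
    also have "measure (P s) {\<omega> \<in> A. \<xi> t \<omega> = x} = (\<integral>\<omega>. indicator {\<omega> \<in> A. \<xi> t \<omega> = x} \<omega> \<partial>P s)"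
      using sub by (simp add: space_P[OF s] Int_absorb1 Int_absorb2 subset_eq)
    also have "p h x y * \<dots> = (\<integral>\<omega>. p h x y * indicator {\<omega> \<in> A. \<xi> t \<omega> = x} \<omega> \<partial>P s)"
      by simp
    also have "\<dots> = (\<integral>\<omega>\<in>A. g \<omega> \<partial>P s)"
      unfolding set_lebesgue_integral_def
      by (rule Bochner_Integration.integral_cong) (auto simp: g_def indicator_def)
    finally show "(\<integral>\<omega>\<in>A. f \<omega> \<partial>P s) = (\<integral>\<omega>\<in>A. g \<omega> \<partial>P s)" .
  qed
  then have ae: "AE \<omega> in P s. U \<omega> * real_cond_exp (P s) (F t) f \<omega> = U \<omega> * g \<omega>"
    by eventually_elim simp
  have intUf: "integrable (P s) (\<lambda>\<omega>. U \<omega> * f \<omega>)"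
  proof (rule integrable_const_bound[of _ K])
    show "AE \<omega> in P s. norm (U \<omega> * f \<omega>) \<le> K"
      using bd order_trans[OF abs_ge_zero bd] by (intro AE_I2) (auto simp: f_def space_P[OF s])
  qed simp
  have "(\<integral>\<omega>. U \<omega> * f \<omega> \<partial>P s) = (\<integral>\<omega>. U \<omega> * real_cond_exp (P s) (F t) f \<omega> \<partial>P s)"
    using real_cond_exp_intg(2)[OF intUf U f] by simp
  also have "\<dots> = (\<integral>\<omega>. U \<omega> * g \<omega> \<partial>P s)"
    by (rule integral_cong_AE) (use ae in auto)
  also have "\<dots> = (\<integral>\<omega>. p h x y * (U \<omega> * of_bool (\<xi> t \<omega> = x)) \<partial>P s)"
    by (simp add: g_def mult.left_commute)
  finally show ?thesis by (simp add: f_def)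
qed

text \<open>The time spent in state 1 minus the time spent in state -1.\<close>

definition occ :: "real \<Rightarrow> 'a \<Rightarrow> real" where
  "occ t \<omega> = integral {0..t} (\<lambda>u. \<xi> u \<omega>)"

lemma chain_integrable: "\<omega> \<in> space M \<Longrightarrow> (\<lambda>u. \<xi> u \<omega>) integrable_on {0..t}"
  and occ_adapted: "0 \<le> t \<Longrightarrow> occ t \<in> borel_measurable (F t)"
proof -
  have *: "\<bar>\<xi> u \<omega>\<bar> \<le> 1" if "\<omega> \<in> space M" "0 \<le> u" for u \<omega>
    using chain_values[OF that] by auto
  show "(\<lambda>u. \<xi> u \<omega>) integrable_on {0..t}" if "\<omega> \<in> space M"
  proof (cases "0 \<le> t")
    case True
    then show ?thesis
      using that * by (intro right_continuous_time_integral(1)[of t \<xi> M 1]) (auto intro: chain_borel right_continuous)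
  qed auto
  show "occ t \<in> borel_measurable (F t)" if "0 \<le> t"
    unfolding occ_def using that *
    by (intro right_continuous_time_integral(2)[of t \<xi> _ 1])
      (auto intro: chain_adapted right_continuous ennreal_leI)
qed

lemma occ_increment:
  assumes "\<omega> \<in> space M" "0 \<le> t" "0 \<le> h"
  shows "\<bar>occ (t + h) \<omega> - occ t \<omega>\<bar> \<le> h"
proof -
  have "\<bar>occ (t + h) \<omega> - occ t \<omega>\<bar> \<le> 1 * h"
    unfolding occ_def
  proof (rule time_integral_increment_bound[OF chain_integrable])
    show "\<bar>\<xi> u \<omega>\<bar> \<le> 1" if "t \<le> u" for u
      using chain_values[of \<omega> u] assms that by auto
  qed (use assms in auto)
  then show ?thesis by simp
qed

lemma occ_right_derivative:
  assumes "\<omega> \<in> space M" "0 \<le> t"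
  shows "((\<lambda>h. (occ (t + h) \<omega> - occ t \<omega>) / h) \<longlongrightarrow> \<xi> t \<omega>) (at_right 0)"
  unfolding occ_def
  by (intro time_integral_right_derivative chain_integrable right_continuous assms)

lemma occ_0 [simp]: "occ 0 \<omega> = 0"
  by (simp add: occ_def)

section \<open>The completed filtration\<close>

abbreviation Fc :: "ennreal \<Rightarrow> 'a measure" where
  "Fc \<equiv> completed_filtration {-1, 1} M P \<xi>"

lemma space_completed [simp]: "space (Fc t) = space M"
  unfolding completed_filtration_def
  using sets.sets_into_space[of _ "natural_filtration M \<xi> t"] by (intro space_measure_of) auto

lemma sets_completed:
  "sets (Fc t) = sigma_sets (space M) (sets (natural_filtration M \<xi> t) \<union>
     {A. A \<subseteq> space M \<and> (\<forall>s\<in>{-1, 1}. A \<in> null_sets (completion (P s)))})"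
  unfolding completed_filtration_def
  using sets.sets_into_space[of _ "natural_filtration M \<xi> t"] by (intro sets_measure_of) auto

lemma natural_subset_completed: "sets (natural_filtration M \<xi> t) \<subseteq> sets (Fc t)"
  unfolding sets_completed by (auto intro: sigma_sets.Basic)

lemma completed_mono: "s \<le> t \<Longrightarrow> sets (Fc s) \<subseteq> sets (Fc t)"
  unfolding sets_completed using natural_filtration_mono[of s t] by (intro sigma_sets_mono') auto

text \<open>Sets that agree almost surely with an event of the natural filtration form a
  \<sigma>-algebra. Expectations over completed events thus reduce to natural ones, the only ones
  the Markov property speaks of.\<close>

lemma completed_almost_natural:
  assumes s: "s \<in> {-1, 1}" and A: "A \<in> sets (Fc t)"
  shows "A \<in> sets (completion (P s)) \<and>
    (\<exists>A'\<in>sets (natural_filtration M \<xi> t). AE \<omega> in completion (P s). \<omega> \<in> A \<longleftrightarrow> \<omega> \<in> A')"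
  using A unfolding sets_completed
proof (induction rule: sigma_sets.induct)
  case (Basic A)
  then show ?case
  proof
    assume "A \<in> sets (natural_filtration M \<xi> t)"
    then show ?thesis
      using natural_filtration_subset sets_P[OF s] by (auto intro!: bexI[of _ A])
  next
    assume "A \<in> {A. A \<subseteq> space M \<and> (\<forall>s\<in>{-1, 1}. A \<in> null_sets (completion (P s)))}"
    then have N: "A \<in> null_sets (completion (P s))" using s by auto
    moreover have "AE \<omega> in completion (P s). \<omega> \<in> A \<longleftrightarrow> \<omega> \<in> {}"
      using AE_not_in[OF N] by eventually_elim simp
    ultimately show ?thesis by (intro conjI bexI[of _ "{}"]) auto
  qed
next
  case Empty
  then show ?case by (auto intro!: bexI[of _ "{}"])
next
  case (Compl A)
  then obtain A' where A': "A' \<in> sets (natural_filtration M \<xi> t)"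
    "AE \<omega> in completion (P s). \<omega> \<in> A \<longleftrightarrow> \<omega> \<in> A'" by auto
  have "AE \<omega> in completion (P s). \<omega> \<in> space M - A \<longleftrightarrow> \<omega> \<in> space M - A'"
    using A'(2) by eventually_elim auto
  moreover have "space M - A' \<in> sets (natural_filtration M \<xi> t)"
    using sets.compl_sets[OF A'(1)] by simp
  moreover have "space M - A \<in> sets (completion (P s))"
    using sets.compl_sets[of A "completion (P s)"] Compl by (simp add: space_P[OF s])
  ultimately show ?case by blast
next
  case (Union A)
  then have "\<forall>i. \<exists>A'\<in>sets (natural_filtration M \<xi> t). AE \<omega> in completion (P s). \<omega> \<in> A i \<longleftrightarrow> \<omega> \<in> A'"
    by auto
  then obtain A' where A': "\<And>i. A' i \<in> sets (natural_filtration M \<xi> t)"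
    "\<And>i. AE \<omega> in completion (P s). \<omega> \<in> A i \<longleftrightarrow> \<omega> \<in> A' i" by metis
  have "AE \<omega> in completion (P s). \<forall>i. \<omega> \<in> A i \<longleftrightarrow> \<omega> \<in> A' i"
    using A'(2) by (simp add: AE_all_countable)
  then have "AE \<omega> in completion (P s). \<omega> \<in> (\<Union>i. A i) \<longleftrightarrow> \<omega> \<in> (\<Union>i. A' i)"
    by eventually_elim simp
  moreover have "(\<Union>i. A' i) \<in> sets (natural_filtration M \<xi> t)" using A'(1) by auto
  moreover have "(\<Union>i. A i) \<in> sets (completion (P s))" using Union by auto
  ultimately show ?case by blast
qed

end

subsection \<open>Dynkin's formula\<close>

locale test_function = switching lam M P \<xi>
  for lam :: real and M :: "'a measure" and P :: "real \<Rightarrow> 'a measure"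
    and \<xi> :: "real \<Rightarrow> 'a \<Rightarrow> real" +
  fixes \<mu> \<sigma> \<rho> x s\<^sub>0 :: real and v v' :: "real \<Rightarrow> real \<Rightarrow> real"
  assumes pos: "0 < \<mu>" "0 < \<sigma>" "0 < \<rho>"
    and initial: "s\<^sub>0 \<in> {-1, 1}"
    and deriv_v: "\<And>s z. s \<in> {-1, 1} \<Longrightarrow> (v s has_real_derivative v' s z) (at z)"
    and cont_v': "\<And>s. s \<in> {-1, 1} \<Longrightarrow> continuous_on UNIV (v' s)"
begin

sublocale Prob: prob_space "P s\<^sub>0"
  by (rule prob_space_P[OF initial])

definition X :: "real \<Rightarrow> 'a \<Rightarrow> real" where
  "X t \<omega> = x + \<mu> * t + \<sigma> * occ t \<omega>"

definition L :: "real \<Rightarrow> real \<Rightarrow> real" where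
  "L s z = (\<mu> + \<sigma> * s) * v' s z + lam * (v (- s) z - v s z) - \<rho> * v s z"

definition Z :: "real \<Rightarrow> 'a \<Rightarrow> real" where
  "Z t \<omega> = exp (- \<rho> * t) * v (\<xi> t \<omega>) (X t \<omega>)"

definition drift :: "real \<Rightarrow> 'a \<Rightarrow> real" where
  "drift t \<omega> = exp (- \<rho> * t) * L (\<xi> t \<omega>) (X t \<omega>)"

definition Mart :: "real \<Rightarrow> 'a \<Rightarrow> real" where
  "Mart t \<omega> = Z t \<omega> - integral {0..t} (\<lambda>u. drift u \<omega>)"

lemma cont_v: "s \<in> {-1, 1} \<Longrightarrow> continuous_on UNIV (v s)"
  using deriv_v by (meson DERIV_continuous_on has_field_derivative_at_within)

lemma cont_L: "s \<in> {-1, 1} \<Longrightarrow> continuous_on UNIV (L s)"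
  unfolding L_def using cont_v[of s] cont_v[of "- s"] cont_v'[of s]
  by (intro continuous_intros) auto

lemma space_P\<^sub>0: "space (P s\<^sub>0) = space M"
  by (rule space_P[OF initial])

lemma borel_P\<^sub>0: "f \<in> borel_measurable M \<Longrightarrow> f \<in> borel_measurable (P s\<^sub>0)"
  using measurable_cong_sets[OF sets_P[OF initial] refl] by auto

lemma adapted_borel: "f \<in> borel_measurable (F t) \<Longrightarrow> f \<in> borel_measurable M"
  by (rule measurable_from_subalg) (auto simp: subalgebra_def natural_filtration_subset[THEN subsetD])

lemma adapted_mono: "f \<in> borel_measurable (F s) \<Longrightarrow> s \<le> t \<Longrightarrow> f \<in> borel_measurable (F t)"
  by (rule measurable_from_subalg)
     (auto simp: subalgebra_def natural_filtration_mono[OF ennreal_leI, THEN subsetD])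

lemma X_adapted: "0 \<le> t \<Longrightarrow> X t \<in> borel_measurable (F t)"
  unfolding X_def using occ_adapted[of t] by measurable

lemma X_increment:
  assumes "\<omega> \<in> space M" "0 \<le> t" "0 \<le> h"
  shows "(\<mu> - \<sigma>) * h \<le> X (t + h) \<omega> - X t \<omega>" "X (t + h) \<omega> - X t \<omega> \<le> (\<mu> + \<sigma>) * h"
    "\<bar>X (t + h) \<omega> - X t \<omega>\<bar> \<le> (\<mu> + \<sigma>) * h"
proof -
  have o: "\<sigma> * (occ (t + h) \<omega> - occ t \<omega>) \<le> \<sigma> * h" "\<sigma> * (- h) \<le> \<sigma> * (occ (t + h) \<omega> - occ t \<omega>)"
    using occ_increment[OF assms] pos by (intro mult_left_mono; linarith)+
  have "0 \<le> \<mu> * h" using pos \<open>0 \<le> h\<close> by simp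
  then show "(\<mu> - \<sigma>) * h \<le> X (t + h) \<omega> - X t \<omega>" "X (t + h) \<omega> - X t \<omega> \<le> (\<mu> + \<sigma>) * h"
    "\<bar>X (t + h) \<omega> - X t \<omega>\<bar> \<le> (\<mu> + \<sigma>) * h"
    using o unfolding X_def by (auto simp: algebra_simps abs_le_iff)
qed

lemma X_0 [simp]: "X 0 \<omega> = x"
  by (simp add: X_def)

lemma X_range:
  assumes "\<omega> \<in> space M" "0 \<le> t" "t \<le> T"
  shows "X t \<omega> \<in> {x - (\<mu> + \<sigma>) * T .. x + (\<mu> + \<sigma>) * T}"
proof -
  have "\<bar>X t \<omega> - x\<bar> \<le> (\<mu> + \<sigma>) * t"
    using X_increment(3)[OF assms(1), of 0 t] assms(2) by simp
  also have "\<dots> \<le> (\<mu> + \<sigma>) * T" using assms pos by (intro mult_left_mono) auto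
  finally show ?thesis by auto
qed

lemma X_right_derivative:
  assumes "\<omega> \<in> space M" "0 \<le> t"
  shows "((\<lambda>h. X (t + h) \<omega>) has_real_derivative \<mu> + \<sigma> * \<xi> t \<omega>) (at_right 0)"
proof -
  have "((\<lambda>h. \<mu> + \<sigma> * ((occ (t + h) \<omega> - occ t \<omega>) / h)) \<longlongrightarrow> \<mu> + \<sigma> * \<xi> t \<omega>) (at_right 0)"
    by (intro tendsto_intros occ_right_derivative assms)
  moreover have "eventually (\<lambda>h. \<mu> + \<sigma> * ((occ (t + h) \<omega> - occ t \<omega>) / h)
      = (X (t + h) \<omega> - X (t + 0) \<omega>) / (h - 0)) (at_right 0)"
    unfolding eventually_at_right_field X_def by (intro exI[of _ 1]) (auto simp: field_simps)
  ultimately show ?thesis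
    unfolding has_field_derivative_iff by (rule Lim_transform_eventually)
qed

lemma X_right_continuous:
  assumes "\<omega> \<in> space M" "0 \<le> t"
  shows "continuous (at_right t) (\<lambda>t. X t \<omega>)"
proof -
  have "((\<lambda>h. X (t + h) \<omega>) \<longlongrightarrow> X (t + 0) \<omega>) (at_right 0)"
    using DERIV_continuous[OF X_right_derivative[OF assms]] by (simp add: continuous_within)
  then show ?thesis
    by (simp add: continuous_within) (subst at_right_to_0, simp add: filterlim_filtermap add.commute)
qed

text \<open>Nothing is assumed about the dependence on the state; with two states the composition is
  a case distinction.\<close>

lemma state_function_adapted:
  assumes f: "\<And>s. s \<in> {-1, 1} \<Longrightarrow> continuous_on UNIV (f s)" and t: "0 \<le> t"
  shows "(\<lambda>\<omega>. f (\<xi> t \<omega>) (X t \<omega>) :: real) \<in> borel_measurable (F t)"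
proof -
  have [measurable]: "X t \<in> borel_measurable (F t)" "\<xi> t \<in> borel_measurable (F t)"
    using X_adapted chain_adapted t by auto
  have [measurable]: "f 1 \<in> borel_measurable borel" "f (-1) \<in> borel_measurable borel"
    using f by (auto intro: borel_measurable_continuous_onI)
  have "(\<lambda>\<omega>. if \<xi> t \<omega> = 1 then f 1 (X t \<omega>) else f (-1) (X t \<omega>)) \<in> borel_measurable (F t)"
    by measurable
  moreover have "(if \<xi> t \<omega> = 1 then f 1 (X t \<omega>) else f (-1) (X t \<omega>)) = f (\<xi> t \<omega>) (X t \<omega>)"
    if "\<omega> \<in> space (F t)" for \<omega>
    using chain_values[of \<omega> t] that t by auto
  ultimately show ?thesis
    by (subst measurable_cong[where g = "\<lambda>\<omega>. if \<xi> t \<omega> = 1 then f 1 (X t \<omega>) else f (-1) (X t \<omega>)"]) auto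
qed

lemma state_function_right_continuous:
  assumes f: "\<And>s. s \<in> {-1, 1} \<Longrightarrow> continuous_on UNIV (f s)" and \<omega>: "\<omega> \<in> space M" and t: "0 \<le> t"
  shows "continuous (at_right t) (\<lambda>t. f (\<xi> t \<omega>) (X t \<omega>) :: real)"
proof -
  have "isCont (f (\<xi> t \<omega>)) (X t \<omega>)"
    using f[of "\<xi> t \<omega>"] chain_values[OF \<omega> t] by (auto simp: continuous_on_eq_continuous_at)
  then have "((\<lambda>u. f (\<xi> t \<omega>) (X u \<omega>)) \<longlongrightarrow> f (\<xi> t \<omega>) (X t \<omega>)) (at_right t)"
    using X_right_continuous[OF \<omega> t] by (auto simp: continuous_within intro: isCont_tendsto_compose)
  moreover have "eventually (\<lambda>u. f (\<xi> t \<omega>) (X u \<omega>) = f (\<xi> u \<omega>) (X u \<omega>)) (at_right t)"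
    using chain_eventually_right[OF \<omega> t] by eventually_elim simp
  ultimately show ?thesis
    unfolding continuous_within by (rule Lim_transform_eventually)
qed

text \<open>The candidate grows like the price, so no global bound is available; up to time
  \<open>T\<close>, however, the log price stays in this compact interval.\<close>

lemma state_function_bounded:
  assumes f: "\<And>s. s \<in> {-1, 1} \<Longrightarrow> continuous_on UNIV (f s)"
  shows "\<exists>K>0. \<forall>s\<in>{-1, 1}. \<forall>z\<in>{x - (\<mu> + \<sigma>) * T .. x + (\<mu> + \<sigma>) * T}. \<bar>f s z :: real\<bar> \<le> K"
proof -
  let ?I = "{x - (\<mu> + \<sigma>) * T .. x + (\<mu> + \<sigma>) * T}"
  have "\<exists>B>0. \<forall>z\<in>?I. \<bar>f s z\<bar> \<le> B" if "s \<in> {-1, 1}" for s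
  proof -
    have "compact (f s ` ?I)"
      by (intro compact_continuous_image continuous_on_subset[OF f[OF that]]) auto
    then show ?thesis
      using compact_imp_bounded[THEN bounded_pos[THEN iffD1]] by fastforce
  qed
  from this[of 1] this[of "-1"] obtain B C where
    "B > 0" "\<And>z. z \<in> ?I \<Longrightarrow> \<bar>f 1 z\<bar> \<le> B" "C > 0" "\<And>z. z \<in> ?I \<Longrightarrow> \<bar>f (-1) z\<bar> \<le> C"
    by auto
  then show ?thesis by (intro exI[of _ "B + C"]) (fastforce simp: add_increasing add_increasing2)
qed

lemma drift_adapted: "0 \<le> u \<Longrightarrow> u \<le> t \<Longrightarrow> drift u \<in> borel_measurable (F t)"
  unfolding drift_def
  by (intro borel_measurable_times borel_measurable_const
      adapted_mono[OF state_function_adapted[OF cont_L]]) auto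

lemma drift_right_continuous:
  "\<omega> \<in> space M \<Longrightarrow> 0 \<le> t \<Longrightarrow> continuous (at_right t) (\<lambda>t. drift t \<omega>)"
  unfolding drift_def
  by (intro continuous_intros state_function_right_continuous cont_L) auto

lemma Z_adapted: "0 \<le> t \<Longrightarrow> Z t \<in> borel_measurable (F t)"
  unfolding Z_def
  by (intro borel_measurable_times borel_measurable_const state_function_adapted cont_v) auto

lemma Z_right_continuous:
  "\<omega> \<in> space M \<Longrightarrow> 0 \<le> t \<Longrightarrow> continuous (at_right t) (\<lambda>t. Z t \<omega>)"
  unfolding Z_def
  by (intro continuous_intros state_function_right_continuous cont_v) auto

lemma discounted_bound: "0 \<le> t \<Longrightarrow> \<bar>y\<bar> \<le> K \<Longrightarrow> \<bar>exp (- \<rho> * t) * y\<bar> \<le> K"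
  using pos mult_mono[of "exp (- \<rho> * t)" 1 "\<bar>y\<bar>" K] by (auto simp: abs_mult)

lemma process_bounds:
  obtains K where "K > 0"
    "\<And>\<omega> t. \<omega> \<in> space M \<Longrightarrow> 0 \<le> t \<Longrightarrow> t \<le> T \<Longrightarrow> \<bar>drift t \<omega>\<bar> \<le> K"
    "\<And>\<omega> t. \<omega> \<in> space M \<Longrightarrow> 0 \<le> t \<Longrightarrow> t \<le> T \<Longrightarrow> \<bar>Z t \<omega>\<bar> \<le> K"
    "\<And>s z. s \<in> {-1, 1} \<Longrightarrow> z \<in> {x - (\<mu> + \<sigma>) * T .. x + (\<mu> + \<sigma>) * T} \<Longrightarrow> \<bar>v s z\<bar> \<le> K"
    "\<And>s z. s \<in> {-1, 1} \<Longrightarrow> z \<in> {x - (\<mu> + \<sigma>) * T .. x + (\<mu> + \<sigma>) * T} \<Longrightarrow> \<bar>v' s z\<bar> \<le> K"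
proof -
  let ?I = "{x - (\<mu> + \<sigma>) * T .. x + (\<mu> + \<sigma>) * T}"
  obtain A where A: "A > 0" "\<forall>s\<in>{-1, 1}. \<forall>z\<in>?I. \<bar>v s z\<bar> \<le> A"
    using state_function_bounded[where f = v, OF cont_v, where T = T] by blast
  obtain B where B: "B > 0" "\<forall>s\<in>{-1, 1}. \<forall>z\<in>?I. \<bar>v' s z\<bar> \<le> B"
    using state_function_bounded[where f = v', OF cont_v', where T = T] by blast
  obtain C where C: "C > 0" "\<forall>s\<in>{-1, 1}. \<forall>z\<in>?I. \<bar>L s z\<bar> \<le> C"
    using state_function_bounded[where f = L, OF cont_L, where T = T] by blast
  define K where "K = A + B + C"
  have le: "A \<le> K" "B \<le> K" "C \<le> K" "K > 0" using A(1) B(1) C(1) by (auto simp: K_def)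
  have v: "\<bar>v s z\<bar> \<le> K" "\<bar>v' s z\<bar> \<le> K" "\<bar>L s z\<bar> \<le> K" if "s \<in> {-1, 1}" "z \<in> ?I" for s z
    using A(2) B(2) C(2) that le by (meson order_trans)+
  show thesis
  proof
    show "K > 0" by fact
    fix \<omega> t assume \<omega>: "\<omega> \<in> space M" "0 \<le> t" "t \<le> T"
    have s: "\<xi> t \<omega> \<in> {-1, 1}" using chain_values[OF \<omega>(1,2)] by auto
    show "\<bar>drift t \<omega>\<bar> \<le> K" "\<bar>Z t \<omega>\<bar> \<le> K"
      unfolding drift_def Z_def by (intro discounted_bound v s X_range \<omega>)+
  qed (use v in auto)
qed

lemma drift_integrable: "\<omega> \<in> space M \<Longrightarrow> (\<lambda>u. drift u \<omega>) integrable_on {0..t}"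
  and drift_integral_adapted:
    "0 \<le> t \<Longrightarrow> (\<lambda>\<omega>. integral {0..t} (\<lambda>u. drift u \<omega>)) \<in> borel_measurable (F t)"
proof -
  obtain K where K: "\<And>\<omega> u. \<omega> \<in> space M \<Longrightarrow> 0 \<le> u \<Longrightarrow> u \<le> t \<Longrightarrow> \<bar>drift u \<omega>\<bar> \<le> K"
    using process_bounds[of t] by metis
  show "(\<lambda>u. drift u \<omega>) integrable_on {0..t}" if "\<omega> \<in> space M"
  proof (cases "0 \<le> t")
    case True
    then show ?thesis
      by (rule right_continuous_time_integral(1)[of t drift "F t" K \<omega>])
        (use that K in \<open>auto intro: drift_adapted drift_right_continuous\<close>)
  qed auto
  show "(\<lambda>\<omega>. integral {0..t} (\<lambda>u. drift u \<omega>)) \<in> borel_measurable (F t)" if "0 \<le> t"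
    using that by (rule right_continuous_time_integral(2)[of t drift "F t" K])
      (use K in \<open>auto intro: drift_adapted drift_right_continuous\<close>)
qed

lemma Mart_adapted: "0 \<le> t \<Longrightarrow> Mart t \<in> borel_measurable (F t)"
  unfolding Mart_def by (intro borel_measurable_diff Z_adapted drift_integral_adapted)

lemma Mart_borel: "0 \<le> t \<Longrightarrow> Mart t \<in> borel_measurable (P s\<^sub>0)"
  by (intro borel_P\<^sub>0 adapted_borel[OF Mart_adapted])

lemma drift_integral_increment:
  assumes "\<omega> \<in> space M" "0 \<le> t" "0 \<le> h"
    and "\<And>u. t \<le> u \<Longrightarrow> u \<le> t + h \<Longrightarrow> \<bar>drift u \<omega>\<bar> \<le> K"
  shows "\<bar>integral {0..t + h} (\<lambda>u. drift u \<omega>) - integral {0..t} (\<lambda>u. drift u \<omega>)\<bar> \<le> K * h"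
  using assms by (intro time_integral_increment_bound drift_integrable) auto

lemma Mart_bounded:
  obtains K where "\<And>\<omega> t. \<omega> \<in> space M \<Longrightarrow> 0 \<le> t \<Longrightarrow> t \<le> T \<Longrightarrow> \<bar>Mart t \<omega>\<bar> \<le> K"
proof -
  obtain K where K: "K > 0" "\<And>\<omega> t. \<omega> \<in> space M \<Longrightarrow> 0 \<le> t \<Longrightarrow> t \<le> T \<Longrightarrow> \<bar>drift t \<omega>\<bar> \<le> K"
    "\<And>\<omega> t. \<omega> \<in> space M \<Longrightarrow> 0 \<le> t \<Longrightarrow> t \<le> T \<Longrightarrow> \<bar>Z t \<omega>\<bar> \<le> K"
    using process_bounds[of T] by metis
  have "\<bar>Mart t \<omega>\<bar> \<le> K + K * T" if \<omega>: "\<omega> \<in> space M" "0 \<le> t" "t \<le> T" for \<omega> t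
  proof -
    have "\<bar>integral {0..t} (\<lambda>u. drift u \<omega>)\<bar> \<le> K * t"
      using drift_integral_increment[OF \<omega>(1), of 0 t K] K(2)[OF \<omega>(1)] \<omega> by simp
    also have "\<dots> \<le> K * T" using K(1) \<omega> by simp
    finally show ?thesis using K(3)[OF \<omega>] unfolding Mart_def by linarith
  qed
  then show thesis by (rule that)
qed

lemma Mart_right_continuous:
  assumes \<omega>: "\<omega> \<in> space M" "0 \<le> t"
  shows "continuous (at_right t) (\<lambda>t. Mart t \<omega>)"
proof -
  have "continuous_on {0..t + 1} (\<lambda>t. integral {0..t} (\<lambda>u. drift u \<omega>))"
    by (rule indefinite_integral_continuous_1[OF drift_integrable[OF \<omega>(1)]])
  then have "continuous (at t within {0..t + 1}) (\<lambda>t. integral {0..t} (\<lambda>u. drift u \<omega>))"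
    using \<omega>(2) by (simp add: continuous_on_eq_continuous_within)
  then have "continuous (at t within {t..t + 1}) (\<lambda>t. integral {0..t} (\<lambda>u. drift u \<omega>))"
    by (rule continuous_within_subset) (use \<omega>(2) in auto)
  then have "continuous (at_right t) (\<lambda>t. integral {0..t} (\<lambda>u. drift u \<omega>))"
    by (simp add: at_within_Icc_at_right)
  then show ?thesis
    unfolding Mart_def by (intro continuous_intros Z_right_continuous \<omega>)
qed

text \<open>The value gap is taken at the price of time \<open>t\<close>, so each term is a factor
  known at time \<open>t\<close> times a transition indicator, the form that
  \<open>markov_expectation\<close> evaluates.\<close>

definition jump :: "real \<Rightarrow> real \<Rightarrow> 'a \<Rightarrow> real" where
  "jump t h \<omega> = (\<Sum>s\<in>{-1, 1}. exp (- \<rho> * t) * (v (- s) (X t \<omega>) - v s (X t \<omega>))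
     * of_bool (\<xi> t \<omega> = s \<and> \<xi> (t + h) \<omega> = - s))"

definition smooth :: "real \<Rightarrow> real \<Rightarrow> 'a \<Rightarrow> real" where
  "smooth t h \<omega> = Mart (t + h) \<omega> - Mart t \<omega> - jump t h \<omega>"

text \<open>With the jump part removed, both values of \<open>v\<close> belong to the final state,
  and only time and price differ. The remainder is therefore of order \<open>h\<close> on every
  path, however often the chain switches in between.\<close>

lemma smooth_eq:
  assumes "\<omega> \<in> space M" "0 \<le> t" "0 \<le> h"
  shows "smooth t h \<omega> = (exp (- \<rho> * (t + h)) * v (\<xi> (t + h) \<omega>) (X (t + h) \<omega>)
      - exp (- \<rho> * t) * v (\<xi> (t + h) \<omega>) (X t \<omega>))
    - (integral {0..t + h} (\<lambda>u. drift u \<omega>) - integral {0..t} (\<lambda>u. drift u \<omega>))"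
  using chain_values[OF assms(1,2)] chain_values[OF assms(1), of "t + h"] assms(2,3)
  by (auto simp: smooth_def jump_def Mart_def Z_def algebra_simps)

lemma value_gap_adapted:
  "s \<in> {-1, 1} \<Longrightarrow> 0 \<le> t \<Longrightarrow>
    (\<lambda>\<omega>. exp (- \<rho> * t) * (v (- s) (X t \<omega>) - v s (X t \<omega>))) \<in> borel_measurable (F t)"
  using state_function_adapted[of "\<lambda>_. v s" t] state_function_adapted[of "\<lambda>_. v (- s)" t] cont_v
  by (intro borel_measurable_times borel_measurable_const borel_measurable_diff) auto

lemma jump_borel:
  assumes "0 \<le> t" "0 \<le> h"
  shows "jump t h \<in> borel_measurable (P s\<^sub>0)"
proof -
  have [measurable]: "\<xi> t \<in> borel_measurable (P s\<^sub>0)" "\<xi> (t + h) \<in> borel_measurable (P s\<^sub>0)"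
    using assms by (auto intro!: borel_P\<^sub>0 chain_borel)
  have [measurable]: "(\<lambda>\<omega>. exp (- \<rho> * t) * (v (- s) (X t \<omega>) - v s (X t \<omega>))) \<in> borel_measurable (P s\<^sub>0)"
    if "s \<in> {-1, 1}" for s
    using that assms by (intro borel_P\<^sub>0 adapted_borel[OF value_gap_adapted]) auto
  show ?thesis
    unfolding jump_def
    by (intro borel_measurable_sum borel_measurable_times[where f = "\<lambda>\<omega>. exp (- \<rho> * t) * (v (- s) (X t \<omega>) - v s (X t \<omega>))" for s]) measurable
qed

lemma smooth_borel: "0 \<le> t \<Longrightarrow> 0 \<le> h \<Longrightarrow> smooth t h \<in> borel_measurable (P s\<^sub>0)"
  unfolding smooth_def by (intro borel_measurable_diff Mart_borel jump_borel) auto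

lemma value_gap_bound:
  obtains K where "K > 0"
    "\<And>\<omega> t s. \<omega> \<in> space M \<Longrightarrow> 0 \<le> t \<Longrightarrow> t \<le> T \<Longrightarrow> s \<in> {-1, 1} \<Longrightarrow>
      \<bar>exp (- \<rho> * t) * (v (- s) (X t \<omega>) - v s (X t \<omega>))\<bar> \<le> K"
proof -
  obtain K where K: "K > 0" "\<And>s z. s \<in> {-1, 1} \<Longrightarrow>
      z \<in> {x - (\<mu> + \<sigma>) * T .. x + (\<mu> + \<sigma>) * T} \<Longrightarrow> \<bar>v s z\<bar> \<le> K"
    using process_bounds[of T] by metis
  show thesis
  proof (rule that)
    show "2 * K > 0" using K by simp
    fix \<omega> t s assume *: "\<omega> \<in> space M" "0 \<le> t" "t \<le> T" "s \<in> {-1, 1 :: real}"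
    have "- s \<in> {-1, 1}" using *(4) by auto
    from K(2)[OF this X_range[OF *(1-3)]] K(2)[OF *(4) X_range[OF *(1-3)]]
    have "\<bar>v (- s) (X t \<omega>) - v s (X t \<omega>)\<bar> \<le> 2 * K" by linarith
    then show "\<bar>exp (- \<rho> * t) * (v (- s) (X t \<omega>) - v s (X t \<omega>))\<bar> \<le> 2 * K"
      by (rule discounted_bound[OF *(2)])
  qed
qed

lemma jump_expectation:
  assumes A: "A \<in> sets (F t)" and t: "0 \<le> t" and h: "0 \<le> h"
  shows "(\<integral>\<omega>. indicator A \<omega> * jump t h \<omega> \<partial>P s\<^sub>0) = (\<Sum>s\<in>{-1, 1}. p h s (- s) *
    (\<integral>\<omega>. indicator A \<omega> * (exp (- \<rho> * t) * (v (- s) (X t \<omega>) - v s (X t \<omega>))) * of_bool (\<xi> t \<omega> = s) \<partial>P s\<^sub>0))"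
proof -
  let ?U = "\<lambda>s \<omega>. indicator A \<omega> * (exp (- \<rho> * t) * (v (- s) (X t \<omega>) - v s (X t \<omega>)))"
  obtain K where K: "\<And>\<omega> s. \<omega> \<in> space M \<Longrightarrow> s \<in> {-1, 1} \<Longrightarrow>
      \<bar>exp (- \<rho> * t) * (v (- s) (X t \<omega>) - v s (X t \<omega>))\<bar> \<le> K"
    using value_gap_bound[of t] t by (metis order_refl)
  have U: "?U s \<in> borel_measurable (F t)" if "s \<in> {-1, 1}" for s
    using A by (intro borel_measurable_times[OF borel_measurable_indicator value_gap_adapted[OF that t]])
  have UK: "\<bar>?U s \<omega>\<bar> \<le> K" if "s \<in> {-1, 1}" "\<omega> \<in> space M" for s \<omega>
    using K[OF that(2,1)] order_trans[OF abs_ge_zero K[OF that(2,1)]]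
    by (cases "\<omega> \<in> A") auto
  have [measurable]: "\<xi> t \<in> borel_measurable (P s\<^sub>0)" "\<xi> (t + h) \<in> borel_measurable (P s\<^sub>0)"
    using t h by (auto intro!: borel_P\<^sub>0 chain_borel)
  have int: "integrable (P s\<^sub>0) (\<lambda>\<omega>. ?U s \<omega> * of_bool (\<xi> t \<omega> = s \<and> \<xi> (t + h) \<omega> = - s))"
    if "s \<in> {-1, 1}" for s
  proof (rule Prob.integrable_const_bound[of _ K])
    have [measurable]: "?U s \<in> borel_measurable (P s\<^sub>0)"
      by (intro borel_P\<^sub>0 adapted_borel[OF U[OF that]])
    show "(\<lambda>\<omega>. ?U s \<omega> * of_bool (\<xi> t \<omega> = s \<and> \<xi> (t + h) \<omega> = - s)) \<in> borel_measurable (P s\<^sub>0)"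
      by (rule borel_measurable_times[where f = "?U s"]) measurable
    show "AE \<omega> in P s\<^sub>0. norm (?U s \<omega> * of_bool (\<xi> t \<omega> = s \<and> \<xi> (t + h) \<omega> = - s)) \<le> K"
      using UK[OF that] order_trans[OF abs_ge_zero UK[OF that]] by (intro AE_I2) (auto simp: space_P\<^sub>0 of_bool_def)
  qed
  have "(\<integral>\<omega>. indicator A \<omega> * jump t h \<omega> \<partial>P s\<^sub>0)
      = (\<integral>\<omega>. (\<Sum>s\<in>{-1, 1}. ?U s \<omega> * of_bool (\<xi> t \<omega> = s \<and> \<xi> (t + h) \<omega> = - s)) \<partial>P s\<^sub>0)"
    by (simp add: jump_def algebra_simps)
  also have "\<dots> = (\<Sum>s\<in>{-1, 1}. \<integral>\<omega>. ?U s \<omega> * of_bool (\<xi> t \<omega> = s \<and> \<xi> (t + h) \<omega> = - s) \<partial>P s\<^sub>0)"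
    by (rule Bochner_Integration.integral_sum) (rule int)
  also have "\<dots> = (\<Sum>s\<in>{-1, 1}. p h s (- s) * (\<integral>\<omega>. ?U s \<omega> * of_bool (\<xi> t \<omega> = s) \<partial>P s\<^sub>0))"
    by (intro sum.cong refl markov_expectation[OF initial _ _ t h U UK]) auto
  finally show ?thesis .
qed

lemma smooth_bound:
  obtains K where "K > 0" "\<And>\<omega> t h. \<omega> \<in> space M \<Longrightarrow> 0 \<le> t \<Longrightarrow> 0 \<le> h \<Longrightarrow> t + h \<le> T \<Longrightarrow> \<bar>smooth t h \<omega>\<bar> \<le> K * h"
proof -
  let ?I = "{x - (\<mu> + \<sigma>) * T .. x + (\<mu> + \<sigma>) * T}"
  obtain K where K: "K > 0"
    "\<And>\<omega> t. \<omega> \<in> space M \<Longrightarrow> 0 \<le> t \<Longrightarrow> t \<le> T \<Longrightarrow> \<bar>drift t \<omega>\<bar> \<le> K"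
    "\<And>s z. s \<in> {-1, 1} \<Longrightarrow> z \<in> ?I \<Longrightarrow> \<bar>v s z\<bar> \<le> K"
    "\<And>s z. s \<in> {-1, 1} \<Longrightarrow> z \<in> ?I \<Longrightarrow> \<bar>v' s z\<bar> \<le> K"
    using process_bounds[of T] by metis
  have lip: "\<bar>v s z - v s z'\<bar> \<le> K * \<bar>z - z'\<bar>" if "s \<in> {-1, 1}" "z \<in> ?I" "z' \<in> ?I" for s z z'
    using field_differentiable_bound[of ?I "v s" "v' s" K z z'] deriv_v[OF that(1)] K(4)[OF that(1)] that
    by (auto intro: has_field_derivative_at_within)
  \<comment> \<open>The three terms stem from discounting, the movement of the price and the drift
    integral.\<close>
  have "\<bar>smooth t h \<omega>\<bar> \<le> (\<rho> * K + K * (\<mu> + \<sigma>) + K) * h"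
    if \<omega>: "\<omega> \<in> space M" and t: "0 \<le> t" "0 \<le> h" "t + h \<le> T" for \<omega> t h
  proof -
    define s where "s = \<xi> (t + h) \<omega>"
    have s: "s \<in> {-1, 1}" using chain_values[OF \<omega>, of "t + h"] t by (auto simp: s_def)
    have X: "X (t + h) \<omega> \<in> ?I" "X t \<omega> \<in> ?I" using X_range[OF \<omega>] t by auto
    have e: "exp (- \<rho> * (t + h)) = exp (- \<rho> * t) * exp (- \<rho> * h)"
      by (simp add: exp_add[symmetric] algebra_simps)
    have "exp (- \<rho> * (t + h)) * v s (X (t + h) \<omega>) - exp (- \<rho> * t) * v s (X t \<omega>)
      = exp (- \<rho> * t) * ((exp (- \<rho> * h) - 1) * v s (X (t + h) \<omega>) + (v s (X (t + h) \<omega>) - v s (X t \<omega>)))"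
      unfolding e by (simp add: algebra_simps)
    also have "\<bar>\<dots>\<bar> \<le> \<rho> * K * h + K * (\<mu> + \<sigma>) * h"
    proof (rule discounted_bound[OF t(1)])
      have "1 + (- \<rho> * h) \<le> exp (- \<rho> * h)" by (rule exp_ge_add_one_self)
      moreover have "exp (- \<rho> * h) \<le> 1" using pos t by simp
      ultimately have "\<bar>exp (- \<rho> * h) - 1\<bar> \<le> \<rho> * h" by simp
      then have "\<bar>(exp (- \<rho> * h) - 1) * v s (X (t + h) \<omega>)\<bar> \<le> (\<rho> * h) * K"
        unfolding abs_mult using K(3)[OF s X(1)] pos t by (intro mult_mono) auto
      moreover have "K * \<bar>X (t + h) \<omega> - X t \<omega>\<bar> \<le> K * ((\<mu> + \<sigma>) * h)"
        using X_increment(3)[OF \<omega> t(1,2)] K(1) by (intro mult_left_mono) auto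
      then have "\<bar>v s (X (t + h) \<omega>) - v s (X t \<omega>)\<bar> \<le> K * ((\<mu> + \<sigma>) * h)"
        using lip[OF s X] by simp
      ultimately show "\<bar>(exp (- \<rho> * h) - 1) * v s (X (t + h) \<omega>) + (v s (X (t + h) \<omega>) - v s (X t \<omega>))\<bar>
          \<le> \<rho> * K * h + K * (\<mu> + \<sigma>) * h"
        unfolding mult.assoc mult.commute[of K h] mult.left_commute[of h] by (auto simp: algebra_simps abs_le_iff)
    qed
    moreover have "\<bar>integral {0..t + h} (\<lambda>u. drift u \<omega>) - integral {0..t} (\<lambda>u. drift u \<omega>)\<bar> \<le> K * h"
      using \<omega> t by (intro drift_integral_increment K(2)) auto
    ultimately show ?thesis
      unfolding smooth_eq[OF \<omega> t(1,2)] s_def distrib_right by linarith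
  qed
  moreover have "\<rho> * K + K * (\<mu> + \<sigma>) + K > 0"
    using K(1) pos by (intro add_nonneg_pos add_nonneg_nonneg mult_nonneg_nonneg) auto
  ultimately show thesis by (rule that[rotated])
qed

text \<open>Right after \<open>t\<close> the chain does not switch, so the limit is the derivative
  along the flow of a fixed state minus the drift. Everything cancels except the switching term of
  the generator.\<close>

lemma smooth_limit:
  assumes \<omega>: "\<omega> \<in> space M" and t: "0 \<le> t"
  shows "((\<lambda>h. smooth t h \<omega> / h) \<longlongrightarrow>
    - lam * (exp (- \<rho> * t) * (v (- \<xi> t \<omega>) (X t \<omega>) - v (\<xi> t \<omega>) (X t \<omega>)))) (at_right 0)"
proof -
  define s where "s = \<xi> t \<omega>"
  have s: "s \<in> {-1, 1}" using chain_values[OF \<omega> t] by (auto simp: s_def)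
  let ?f = "\<lambda>h. exp (- \<rho> * (t + h)) * v s (X (t + h) \<omega>)"
  have "((\<lambda>h. v s (X (t + h) \<omega>)) has_real_derivative v' s (X (t + 0) \<omega>) * (\<mu> + \<sigma> * s)) (at_right 0)"
    using deriv_v[OF s, of "X (t + 0) \<omega>"] X_right_derivative[OF \<omega> t] unfolding s_def
    by (intro DERIV_chain') auto
  moreover have "((\<lambda>h. exp (- \<rho> * (t + h))) has_real_derivative - \<rho> * exp (- \<rho> * t)) (at_right 0)"
    by (auto intro!: derivative_eq_intros)
  ultimately have "(?f has_real_derivative - \<rho> * exp (- \<rho> * t) * v s (X (t + 0) \<omega>)
      + v' s (X (t + 0) \<omega>) * (\<mu> + \<sigma> * s) * exp (- \<rho> * (t + 0))) (at_right 0)"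
    by (intro DERIV_mult)
  then have "((\<lambda>h. (?f h - ?f 0) / h) \<longlongrightarrow> - \<rho> * exp (- \<rho> * t) * v s (X t \<omega>)
      + v' s (X t \<omega>) * (\<mu> + \<sigma> * s) * exp (- \<rho> * t)) (at_right 0)"
    by (simp add: has_field_derivative_iff)
  from tendsto_diff[OF this time_integral_right_derivative[OF drift_integrable[OF \<omega>] t drift_right_continuous[OF \<omega> t]]]
  have lim: "((\<lambda>h. (?f h - ?f 0) / h
      - (integral {0..t + h} (\<lambda>u. drift u \<omega>) - integral {0..t} (\<lambda>u. drift u \<omega>)) / h)
    \<longlongrightarrow> - lam * (exp (- \<rho> * t) * (v (- s) (X t \<omega>) - v s (X t \<omega>)))) (at_right 0)"
    unfolding drift_def L_def s_def[symmetric] by (simp add: algebra_simps)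
  have "eventually (\<lambda>h. \<xi> (t + h) \<omega> = s) (at_right 0)"
    using chain_eventually_right[OF \<omega> t] unfolding s_def
    by (subst (asm) at_right_to_0) (simp add: eventually_filtermap add.commute)
  moreover have "eventually (\<lambda>h. 0 < h) (at_right (0 :: real))"
    by (rule eventually_at_right_less)
  ultimately have "eventually (\<lambda>h. (?f h - ?f 0) / h
      - (integral {0..t + h} (\<lambda>u. drift u \<omega>) - integral {0..t} (\<lambda>u. drift u \<omega>)) / h
      = smooth t h \<omega> / h) (at_right 0)"
    by eventually_elim (simp add: smooth_eq[OF \<omega> t] diff_divide_distrib)
  from Lim_transform_eventually[OF lim this] show ?thesis unfolding s_def .
qed

lemma jump_rate: "s \<in> {-1, 1} \<Longrightarrow> ((\<lambda>h. p h s (- s) / h) \<longlongrightarrow> lam) (at_right 0)"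
  using generator[of s "- s"] by auto

lemma jump_rate_bound:
  obtains \<delta> where "0 < \<delta>" "\<And>h s. s \<in> {-1, 1} \<Longrightarrow> 0 < h \<Longrightarrow> h < \<delta> \<Longrightarrow> p h s (- s) \<le> (lam + 1) * h"
proof -
  have "eventually (\<lambda>h. p h s (- s) / h < lam + 1) (at_right 0)" if "s \<in> {-1, 1}" for s
    by (rule order_tendstoD[OF jump_rate[OF that]]) simp
  then have "eventually (\<lambda>h. \<forall>s\<in>{-1, 1}. p h s (- s) / h < lam + 1) (at_right 0)"
    by (intro eventually_ball_finite) auto
  then obtain \<delta> where \<delta>: "\<delta> > 0" "\<And>h s. 0 < h \<Longrightarrow> h < \<delta> \<Longrightarrow> s \<in> {-1, 1} \<Longrightarrow> p h s (- s) / h < lam + 1"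
    unfolding eventually_at_right_field by blast
  show thesis
    using \<delta> by (intro that[of \<delta>]) (auto simp: pos_divide_less_eq less_imp_le)
qed

text \<open>Divided by \<open>h\<close>, the smooth part converges under the expectation to minus
  \<open>lam\<close> times the expected value gap, and the jump part to plus the same quantity by
  the switching rate. Both parts are of order \<open>h\<close> uniformly in time, which gives
  continuity.\<close>

lemma Mart_constant_expectation:
  assumes A: "A \<in> sets (F t\<^sub>0)" and t\<^sub>0: "0 \<le> t\<^sub>0" "t\<^sub>0 \<le> T"
  shows "(\<integral>\<omega>. indicator A \<omega> * Mart T \<omega> \<partial>P s\<^sub>0) = (\<integral>\<omega>. indicator A \<omega> * Mart t\<^sub>0 \<omega> \<partial>P s\<^sub>0)"
proof -
  define f where "f t = (\<integral>\<omega>. indicator A \<omega> * Mart t \<omega> \<partial>P s\<^sub>0)" for t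
  define gap where "gap t s \<omega> = exp (- \<rho> * t) * (v (- s) (X t \<omega>) - v s (X t \<omega>))" for t s \<omega>
  define J where "J t s = (\<integral>\<omega>. indicator A \<omega> * gap t s \<omega> * of_bool (\<xi> t \<omega> = s) \<partial>P s\<^sub>0)" for t s
  have At: "A \<in> sets (F t)" if "t\<^sub>0 \<le> t" for t
    using A natural_filtration_mono[OF ennreal_leI[OF that]] by auto
  have [measurable]: "A \<in> sets (P s\<^sub>0)"
    using A natural_filtration_subset sets_P[OF initial] by auto
  have intA: "integrable (P s\<^sub>0) (\<lambda>\<omega>. indicator A \<omega> * g \<omega>)"
    if "g \<in> borel_measurable (P s\<^sub>0)" "\<And>\<omega>. \<omega> \<in> space M \<Longrightarrow> \<bar>g \<omega>\<bar> \<le> K" for g :: "'a \<Rightarrow> real" and K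
  proof (rule Prob.integrable_const_bound[of _ K])
    show "(\<lambda>\<omega>. indicator A \<omega> * g \<omega>) \<in> borel_measurable (P s\<^sub>0)" using that(1) by measurable
    show "AE \<omega> in P s\<^sub>0. norm (indicator A \<omega> * g \<omega>) \<le> K"
      using that(2) order_trans[OF abs_ge_zero that(2)]
      by (intro AE_I2) (auto simp: space_P\<^sub>0 indicator_def)
  qed
  have boundA: "\<bar>\<integral>\<omega>. indicator A \<omega> * g \<omega> \<partial>P s\<^sub>0\<bar> \<le> K"
    if "g \<in> borel_measurable (P s\<^sub>0)" "\<And>\<omega>. \<omega> \<in> space M \<Longrightarrow> \<bar>g \<omega>\<bar> \<le> K" for g :: "'a \<Rightarrow> real" and K
  proof -
    have *: "\<bar>indicator A \<omega> * g \<omega>\<bar> \<le> K" if "\<omega> \<in> space M" for \<omega>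
      using \<open>\<And>\<omega>. \<omega> \<in> space M \<Longrightarrow> \<bar>g \<omega>\<bar> \<le> K\<close>[OF that] by (auto simp: indicator_def)
    have "(\<integral>\<omega>. indicator A \<omega> * g \<omega> \<partial>P s\<^sub>0) \<le> K"
      by (rule Prob.integral_le_const[OF intA[OF that]]) (use * in \<open>auto simp: space_P\<^sub>0 abs_le_iff\<close>)
    moreover have "- K \<le> (\<integral>\<omega>. indicator A \<omega> * g \<omega> \<partial>P s\<^sub>0)"
      by (rule Prob.integral_ge_const[OF intA[OF that] AE_I2]) (use * in \<open>fastforce simp: space_P\<^sub>0 abs_le_iff\<close>)+
    ultimately show ?thesis by (simp add: abs_le_iff)
  qed
  \<comment> \<open>The horizon \<open>T + 1\<close> leaves room for a step of length up to 1 from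
    any time before \<open>T\<close>.\<close>
  obtain K\<^sub>M where KM: "\<And>\<omega> t. \<omega> \<in> space M \<Longrightarrow> 0 \<le> t \<Longrightarrow> t \<le> T + 1 \<Longrightarrow> \<bar>Mart t \<omega>\<bar> \<le> K\<^sub>M"
    using Mart_bounded[of "T + 1"] by blast
  obtain K\<^sub>S where KS: "K\<^sub>S > 0" "\<And>\<omega> t h. \<omega> \<in> space M \<Longrightarrow> 0 \<le> t \<Longrightarrow> 0 \<le> h \<Longrightarrow> t + h \<le> T + 1 \<Longrightarrow>
      \<bar>smooth t h \<omega>\<bar> \<le> K\<^sub>S * h"
    using smooth_bound[of "T + 1"] by blast
  obtain K\<^sub>G where KG: "K\<^sub>G > 0"
    "\<And>\<omega> t s. \<omega> \<in> space M \<Longrightarrow> 0 \<le> t \<Longrightarrow> t \<le> T + 1 \<Longrightarrow> s \<in> {-1, 1} \<Longrightarrow> \<bar>gap t s \<omega>\<bar> \<le> K\<^sub>G"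
    unfolding gap_def using value_gap_bound[of "T + 1"] by blast
  have gap_borel: "gap t s \<in> borel_measurable (P s\<^sub>0)" if "s \<in> {-1, 1}" "0 \<le> t" for t s
    unfolding gap_def by (intro borel_P\<^sub>0 adapted_borel[OF value_gap_adapted[OF that]])
  have chain_P\<^sub>0 [measurable]: "\<xi> t \<in> borel_measurable (P s\<^sub>0)" if "0 \<le> t" for t
    using that by (intro borel_P\<^sub>0 chain_borel)
  have gap_ind_borel: "(\<lambda>\<omega>. gap t s \<omega> * of_bool (\<xi> t \<omega> = s)) \<in> borel_measurable (P s\<^sub>0)"
    if "s \<in> {-1, 1}" "0 \<le> t" for t s
    using that by (intro borel_measurable_times[OF gap_borel]) measurable
  have gap_ind_bound: "\<bar>gap t s \<omega> * of_bool (\<xi> t \<omega> = s)\<bar> \<le> K\<^sub>G"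
    if "\<omega> \<in> space M" "0 \<le> t" "t \<le> T + 1" "s \<in> {-1, 1}" for t s \<omega>
    using KG(2)[OF that] KG(1) by (auto simp: of_bool_def)
  have incr: "f (t + h) - f t = (\<integral>\<omega>. indicator A \<omega> * smooth t h \<omega> \<partial>P s\<^sub>0)
      + (\<Sum>s\<in>{-1, 1}. p h s (- s) * J t s)"
    if t: "t\<^sub>0 \<le> t" "0 \<le> h" "t + h \<le> T + 1" for t h
  proof -
    have t0: "0 \<le> t" using t t\<^sub>0 by simp
    have i1: "integrable (P s\<^sub>0) (\<lambda>\<omega>. indicator A \<omega> * Mart (t + h) \<omega>)"
      "integrable (P s\<^sub>0) (\<lambda>\<omega>. indicator A \<omega> * Mart t \<omega>)"
      "integrable (P s\<^sub>0) (\<lambda>\<omega>. indicator A \<omega> * smooth t h \<omega>)"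
      using t t0 by (auto intro!: intA[OF Mart_borel KM] intA[OF smooth_borel KS(2)])
    have "f (t + h) - f t - (\<integral>\<omega>. indicator A \<omega> * smooth t h \<omega> \<partial>P s\<^sub>0)
        = (\<integral>\<omega>. indicator A \<omega> * Mart (t + h) \<omega> - indicator A \<omega> * Mart t \<omega>
            - indicator A \<omega> * smooth t h \<omega> \<partial>P s\<^sub>0)"
      unfolding f_def using i1 by simp
    also have "\<dots> = (\<integral>\<omega>. indicator A \<omega> * jump t h \<omega> \<partial>P s\<^sub>0)"
      by (rule Bochner_Integration.integral_cong) (auto simp: smooth_def algebra_simps)
    also have "\<dots> = (\<Sum>s\<in>{-1, 1}. p h s (- s) * J t s)"
      unfolding J_def gap_def by (rule jump_expectation[OF At[OF t(1)] t0 t(2)])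
    finally show ?thesis by simp
  qed
  have J_bound: "\<bar>J t s\<bar> \<le> K\<^sub>G" if "0 \<le> t" "t \<le> T + 1" "s \<in> {-1, 1}" for t s
    using boundA[OF gap_ind_borel[OF that(3,1)] gap_ind_bound[OF _ that]]
    by (simp add: J_def mult.assoc)
  obtain \<delta> where \<delta>: "0 < \<delta>" "\<And>h s. s \<in> {-1, 1} \<Longrightarrow> 0 < h \<Longrightarrow> h < \<delta> \<Longrightarrow> p h s (- s) \<le> (lam + 1) * h"
    using jump_rate_bound by blast
  have "f T = f t\<^sub>0"
  proof (rule constant_if_right_derivative_zero[OF t\<^sub>0(2)])
    show "continuous_on {t\<^sub>0..T} f"
    proof (rule continuous_on_if_increment_bound[OF \<delta>(1)])
      fix t h assume t: "t\<^sub>0 \<le> t" "0 \<le> h" "h < \<delta>" "t + h \<le> T"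
      \<comment> \<open>One jump term for each of the two states, with \<open>lam + 1\<close> a
        bound on the switching rate for small \<open>h\<close>.\<close>
      show "\<bar>f (t + h) - f t\<bar> \<le> (K\<^sub>S + 2 * ((lam + 1) * K\<^sub>G)) * h"
      proof (cases "h = 0")
        case False
        then have "0 < h" using t by simp
        have "\<bar>\<integral>\<omega>. indicator A \<omega> * smooth t h \<omega> \<partial>P s\<^sub>0\<bar> \<le> K\<^sub>S * h"
          using t t\<^sub>0 by (intro boundA smooth_borel KS(2)) auto
        moreover have "\<bar>p h s (- s) * J t s\<bar> \<le> ((lam + 1) * h) * K\<^sub>G" if "s \<in> {-1, 1}" for s
          unfolding abs_mult using \<delta>(2)[OF that \<open>0 < h\<close> t(3)] J_bound[of t s] that t t\<^sub>0
          by (intro mult_mono) (auto intro: order_trans[OF measure_nonneg])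
        from this[of 1] this[of "-1"]
        have "\<bar>\<Sum>s\<in>{-1, 1}. p h s (- s) * J t s\<bar> \<le> 2 * (((lam + 1) * h) * K\<^sub>G)" by simp
        ultimately show ?thesis
          using incr[of t h] t by (simp add: algebra_simps)
      qed simp
    qed
    fix t assume t: "t\<^sub>0 \<le> t" "t < T"
    then have t0: "0 \<le> t" using t\<^sub>0 by simp
    define lm where "lm \<omega> = - lam * gap t (\<xi> t \<omega>) \<omega>" for \<omega>
    have lm_eq: "lm \<omega> = (\<Sum>s\<in>{-1, 1}. - lam * (gap t s \<omega> * of_bool (\<xi> t \<omega> = s)))" if "\<omega> \<in> space M" for \<omega>
      using chain_values[OF that t0] by (auto simp: lm_def)
    have lm_borel: "lm \<in> borel_measurable (P s\<^sub>0)"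
      using t0 by (subst measurable_cong[OF lm_eq])
        (auto simp: space_P\<^sub>0 simp del: sum.insert intro!: borel_measurable_sum borel_measurable_times[OF borel_measurable_const] gap_ind_borel)
    have smooth_lim: "((\<lambda>h. (\<integral>\<omega>. indicator A \<omega> * smooth t h \<omega> \<partial>P s\<^sub>0) / h) \<longlongrightarrow>
        (\<integral>\<omega>. indicator A \<omega> * lm \<omega> \<partial>P s\<^sub>0)) (at_right 0)"
      unfolding tendsto_at_iff_sequentially comp_def
    proof (intro allI impI)
      fix H :: "nat \<Rightarrow> real" assume H: "\<forall>i. H i \<in> {0<..} - {0}" "H \<longlonglongrightarrow> 0"
      \<comment> \<open>The dominating bound holds only for steps within the horizon, so an initial
        segment of the sequence is dropped.\<close>
      have "eventually (\<lambda>i. H i < 1) sequentially"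
        by (rule order_tendstoD[OF H(2)]) simp
      then obtain n where n: "\<And>i. n \<le> i \<Longrightarrow> H i < 1" by (auto simp: eventually_sequentially)
      have "(\<lambda>i. \<integral>\<omega>. indicator A \<omega> * smooth t (H (i + n)) \<omega> / H (i + n) \<partial>P s\<^sub>0)
          \<longlonglongrightarrow> (\<integral>\<omega>. indicator A \<omega> * lm \<omega> \<partial>P s\<^sub>0)"
      proof (rule integral_dominated_convergence[where w = "\<lambda>_. K\<^sub>S"])
        show "(\<lambda>\<omega>. indicator A \<omega> * lm \<omega>) \<in> borel_measurable (P s\<^sub>0)"
          using lm_borel by measurable
        show "(\<lambda>\<omega>. indicator A \<omega> * smooth t (H (i + n)) \<omega> / H (i + n)) \<in> borel_measurable (P s\<^sub>0)" for i
          using smooth_borel[OF t0, of "H (i + n)"] H(1) by (auto intro!: borel_measurable_divide borel_measurable_times simp: less_imp_le)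
        show "AE \<omega> in P s\<^sub>0. (\<lambda>i. indicator A \<omega> * smooth t (H (i + n)) \<omega> / H (i + n))
            \<longlonglongrightarrow> indicator A \<omega> * lm \<omega>"
        proof (rule AE_I2)
          fix \<omega> assume "\<omega> \<in> space (P s\<^sub>0)"
          then have \<omega>: "\<omega> \<in> space M" by (simp add: space_P\<^sub>0)
          have "(\<lambda>i. smooth t (H i) \<omega> / H i) \<longlonglongrightarrow> lm \<omega>"
            using smooth_limit[OF \<omega> t0] H
            unfolding tendsto_at_iff_sequentially comp_def lm_def gap_def by blast
          then have "(\<lambda>i. smooth t (H (i + n)) \<omega> / H (i + n)) \<longlonglongrightarrow> lm \<omega>"
            by (rule LIMSEQ_ignore_initial_segment)
          from tendsto_mult[OF tendsto_const this]
          show "(\<lambda>i. indicator A \<omega> * smooth t (H (i + n)) \<omega> / H (i + n)) \<longlonglongrightarrow> indicator A \<omega> * lm \<omega>"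
            by simp
        qed
        show "AE \<omega> in P s\<^sub>0. norm (indicator A \<omega> * smooth t (H (i + n)) \<omega> / H (i + n)) \<le> K\<^sub>S" for i
        proof (rule AE_I2)
          fix \<omega> assume "\<omega> \<in> space (P s\<^sub>0)"
          then have \<omega>: "\<omega> \<in> space M" by (simp add: space_P\<^sub>0)
          have "0 < H (i + n)" "H (i + n) < 1" using H(1) n[of "i + n"] by auto
          then have "\<bar>smooth t (H (i + n)) \<omega>\<bar> / H (i + n) \<le> K\<^sub>S"
            using KS(2)[OF \<omega> t0, of "H (i + n)"] t by (simp add: pos_divide_le_eq)
          then show "norm (indicator A \<omega> * smooth t (H (i + n)) \<omega> / H (i + n)) \<le> K\<^sub>S"
            using KS(1) \<open>0 < H (i + n)\<close> by (auto simp: indicator_def)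
        qed
      qed simp
      then have "(\<lambda>i. (\<integral>\<omega>. indicator A \<omega> * smooth t (H (i + n)) \<omega> \<partial>P s\<^sub>0) / H (i + n))
          \<longlonglongrightarrow> (\<integral>\<omega>. indicator A \<omega> * lm \<omega> \<partial>P s\<^sub>0)"
        by simp
      then show "(\<lambda>i. (\<integral>\<omega>. indicator A \<omega> * smooth t (H i) \<omega> \<partial>P s\<^sub>0) / H i)
          \<longlonglongrightarrow> (\<integral>\<omega>. indicator A \<omega> * lm \<omega> \<partial>P s\<^sub>0)"
        by (rule LIMSEQ_offset)
    qed
    have jump_lim: "((\<lambda>h. \<Sum>s\<in>{-1, 1}. p h s (- s) / h * J t s) \<longlongrightarrow> (\<Sum>s\<in>{-1, 1}. lam * J t s)) (at_right 0)"
      by (intro tendsto_sum tendsto_mult jump_rate tendsto_const)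
    have "(\<integral>\<omega>. indicator A \<omega> * lm \<omega> \<partial>P s\<^sub>0)
        = (\<integral>\<omega>. (\<Sum>s\<in>{-1, 1}. - lam * (indicator A \<omega> * (gap t s \<omega> * of_bool (\<xi> t \<omega> = s)))) \<partial>P s\<^sub>0)"
      by (rule Bochner_Integration.integral_cong)
        (auto simp: space_P\<^sub>0 lm_eq algebra_simps)
    also have "\<dots> = (\<Sum>s\<in>{-1, 1}. \<integral>\<omega>. - lam * (indicator A \<omega> * (gap t s \<omega> * of_bool (\<xi> t \<omega> = s))) \<partial>P s\<^sub>0)"
      using t0 t gap_ind_bound by (intro Bochner_Integration.integral_sum integrable_mult_right intA[of _ K\<^sub>G] gap_ind_borel) auto
    also have "\<dots> = - (\<Sum>s\<in>{-1, 1}. lam * J t s)"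
      unfolding sum_negf[symmetric] by (intro sum.cong refl) (simp add: J_def mult.assoc)
    finally have "((\<lambda>h. (\<integral>\<omega>. indicator A \<omega> * smooth t h \<omega> \<partial>P s\<^sub>0) / h
        + (\<Sum>s\<in>{-1, 1}. p h s (- s) / h * J t s)) \<longlongrightarrow> 0) (at_right 0)"
      using tendsto_add[OF smooth_lim jump_lim] by simp
    moreover have "eventually (\<lambda>h. (\<integral>\<omega>. indicator A \<omega> * smooth t h \<omega> \<partial>P s\<^sub>0) / h
        + (\<Sum>s\<in>{-1, 1}. p h s (- s) / h * J t s) = (f (t + h) - f t) / h) (at_right 0)"
      unfolding eventually_at_right_field
      by (intro exI[of _ 1]) (use t in \<open>auto simp: incr add_divide_distrib\<close>)
    ultimately show "((\<lambda>h. (f (t + h) - f t) / h) \<longlongrightarrow> 0) (at_right 0)"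
      by (rule Lim_transform_eventually)
  qed
  then show ?thesis by (simp add: f_def)
qed

section \<open>Optional stopping at bounded times\<close>

lemma completion_prob: "prob_space (completion (P s\<^sub>0))"
  by (intro prob_spaceI) (simp add: Prob.emeasure_space_1)

sublocale Compl: prob_space "completion (P s\<^sub>0)"
  by (rule completion_prob)

text \<open>A stopping time bounded by \<open>T\<close>. Events are required only for
  \<open>t < T\<close>, since from \<open>T\<close> on they are the whole space; this fits the
  truncation of an extended-valued stopping time at \<open>T\<close>.\<close>

definition admissible :: "real \<Rightarrow> ('a \<Rightarrow> real) \<Rightarrow> bool" where
  "admissible T \<theta> \<longleftrightarrow> (\<forall>\<omega>\<in>space M. 0 \<le> \<theta> \<omega> \<and> \<theta> \<omega> \<le> T) \<and>
     (\<forall>t. 0 \<le> t \<and> t < T \<longrightarrow> {\<omega> \<in> space M. \<theta> \<omega> \<le> t} \<in> sets (Fc (ennreal t)))"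

text \<open>The cell that contains \<theta> is known at its right end point. The last cell may reach
  beyond \<open>T\<close>, hence the minimum.\<close>

lemma admissible_grid_event:
  assumes \<theta>: "admissible T \<theta>" and T: "0 \<le> T"
  shows "{\<omega> \<in> space M. nat \<lceil>real (Suc n) * \<theta> \<omega>\<rceil> = k} \<in> sets (Fc (ennreal (min T (real k / real (Suc n)))))"
proof -
  have le: "{\<omega> \<in> space M. \<theta> \<omega> \<le> t} \<in> sets (Fc (ennreal (min T t)))" if "0 \<le> t" for t
  proof (cases "t < T")
    case True
    then show ?thesis using \<theta> that by (simp add: admissible_def min_def)
  next
    case False
    then have "{\<omega> \<in> space M. \<theta> \<omega> \<le> t} = space (Fc (ennreal (min T t)))"
      using \<theta> by (fastforce simp: admissible_def)
    then show ?thesis by (metis sets.top)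
  qed
  have iff: "nat \<lceil>real (Suc n) * \<theta> \<omega>\<rceil> \<le> j \<longleftrightarrow> \<theta> \<omega> \<le> real j / real (Suc n)" for j \<omega>
    by (simp add: nat_le_iff ceiling_le_iff pos_le_divide_eq mult.commute del: of_nat_Suc)
  show ?thesis
  proof (cases k)
    case 0
    have "{\<omega> \<in> space M. nat \<lceil>real (Suc n) * \<theta> \<omega>\<rceil> = k} = {\<omega> \<in> space M. \<theta> \<omega> \<le> real k / real (Suc n)}"
      using iff[of _ 0] unfolding 0 by auto
    then show ?thesis using le[of "real k / real (Suc n)"] by simp
  next
    case (Suc j)
    have eq_Suc: "m = Suc j \<longleftrightarrow> m \<le> Suc j \<and> \<not> m \<le> j" for m by auto
    have "{\<omega> \<in> space M. nat \<lceil>real (Suc n) * \<theta> \<omega>\<rceil> = k} =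
      {\<omega> \<in> space M. \<theta> \<omega> \<le> real k / real (Suc n)} - {\<omega> \<in> space M. \<theta> \<omega> \<le> real j / real (Suc n)}"
      unfolding Suc eq_Suc iff by blast
    moreover have "{\<omega> \<in> space M. \<theta> \<omega> \<le> real j / real (Suc n)} \<in> sets (Fc (ennreal (min T (real k / real (Suc n)))))"
    proof (rule subsetD[OF completed_mono le])
      show "ennreal (min T (real j / real (Suc n))) \<le> ennreal (min T (real k / real (Suc n)))"
        unfolding Suc by (intro ennreal_leI min.mono divide_right_mono) auto
    qed simp
    ultimately show ?thesis using le[of "real k / real (Suc n)"] by auto
  qed
qed

lemma grid_sum:
  assumes \<theta>: "admissible T \<theta>" and \<omega>: "\<omega> \<in> space M"
  shows "(\<Sum>k\<le>nat \<lceil>real (Suc n) * T\<rceil>. indicator {\<omega> \<in> space M. nat \<lceil>real (Suc n) * \<theta> \<omega>\<rceil> = k} \<omega> * (g k :: real))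
    = g (nat \<lceil>real (Suc n) * \<theta> \<omega>\<rceil>)"
proof -
  let ?k = "nat \<lceil>real (Suc n) * \<theta> \<omega>\<rceil>"
  have "?k \<le> nat \<lceil>real (Suc n) * T\<rceil>"
    using \<theta> \<omega> by (intro nat_mono ceiling_mono mult_left_mono) (auto simp: admissible_def)
  moreover have "(\<Sum>k\<le>nat \<lceil>real (Suc n) * T\<rceil>. indicator {\<omega> \<in> space M. nat \<lceil>real (Suc n) * \<theta> \<omega>\<rceil> = k} \<omega> * g k)
    = (\<Sum>k\<le>nat \<lceil>real (Suc n) * T\<rceil>. if ?k = k then g k else 0)"
    using \<omega> by (intro sum.cong) (auto simp: indicator_def)
  ultimately show ?thesis by (simp add: sum.delta')
qed

lemma grid_limit:
  assumes rc: "continuous (at_right u) W" and u: "0 \<le> u" "u \<le> T"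
  shows "(\<lambda>n. W (min T (real (nat \<lceil>real (Suc n) * u\<rceil>) / real (Suc n))) :: real) \<longlonglongrightarrow> W u"
proof (rule continuous_at_right_sequentially[OF rc])
  have eq: "real (nat \<lceil>real (Suc n) * u\<rceil>) = real_of_int \<lceil>real (Suc n) * u\<rceil>" for n
    using u(1) by (simp add: of_nat_nat mult_nonneg_nonneg del: of_nat_Suc)
  show "u \<le> min T (real (nat \<lceil>real (Suc n) * u\<rceil>) / real (Suc n))" for n
    unfolding eq using grid_above_tendsto(2)[of u n] u(2) by simp
  have "(\<lambda>n. min T (real_of_int \<lceil>real (Suc n) * u\<rceil> / real (Suc n))) \<longlonglongrightarrow> min T u"
    by (intro tendsto_min tendsto_const grid_above_tendsto)
  then show "(\<lambda>n. min T (real (nat \<lceil>real (Suc n) * u\<rceil>) / real (Suc n))) \<longlonglongrightarrow> u"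
    unfolding eq using u(2) by (simp only: min_absorb2)
qed

lemma sampled_borel:
  assumes \<theta>: "admissible T \<theta>" and T: "0 \<le> T"
    and W: "\<And>t. 0 \<le> t \<Longrightarrow> W t \<in> borel_measurable (P s\<^sub>0)"
    and rc: "\<And>\<omega> t. \<omega> \<in> space M \<Longrightarrow> 0 \<le> t \<Longrightarrow> continuous (at_right t) (\<lambda>t. W t \<omega> :: real)"
  shows "(\<lambda>\<omega>. W (\<theta> \<omega>) \<omega>) \<in> borel_measurable (completion (P s\<^sub>0))"
proof (rule borel_measurable_LIMSEQ_real)
  show "(\<lambda>n. W (min T (real (nat \<lceil>real (Suc n) * \<theta> \<omega>\<rceil>) / real (Suc n))) \<omega>) \<longlonglongrightarrow> W (\<theta> \<omega>) \<omega>"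
    if "\<omega> \<in> space (completion (P s\<^sub>0))" for \<omega>
    using that \<theta> by (intro grid_limit rc) (auto simp: admissible_def space_P\<^sub>0)
  fix n
  have "(\<lambda>\<omega>. \<Sum>k\<le>nat \<lceil>real (Suc n) * T\<rceil>. indicator {\<omega> \<in> space M. nat \<lceil>real (Suc n) * \<theta> \<omega>\<rceil> = k} \<omega>
      * W (min T (real k / real (Suc n))) \<omega>) \<in> borel_measurable (completion (P s\<^sub>0))"
    using completed_almost_natural[OF initial admissible_grid_event[OF \<theta> T]] T
    by (intro borel_measurable_sum borel_measurable_times borel_measurable_indicator measurable_completion W) auto
  then show "(\<lambda>\<omega>. W (min T (real (nat \<lceil>real (Suc n) * \<theta> \<omega>\<rceil>) / real (Suc n))) \<omega>)
      \<in> borel_measurable (completion (P s\<^sub>0))"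
    by (rule measurable_cong[THEN iffD1, rotated]) (rule grid_sum[OF \<theta>], simp add: space_P\<^sub>0)
qed

lemma Mart_constant_expectation_completed:
  assumes A: "A \<in> sets (Fc (ennreal t))" and t: "0 \<le> t" "t \<le> T"
  shows "(\<integral>\<omega>. indicator A \<omega> * Mart t \<omega> \<partial>completion (P s\<^sub>0)) = (\<integral>\<omega>. indicator A \<omega> * Mart T \<omega> \<partial>completion (P s\<^sub>0))"
proof -
  obtain A' where A': "A' \<in> sets (F t)" "AE \<omega> in completion (P s\<^sub>0). \<omega> \<in> A \<longleftrightarrow> \<omega> \<in> A'"
    and Ac [measurable]: "A \<in> sets (completion (P s\<^sub>0))"
    using completed_almost_natural[OF initial A] by auto
  have A'P [measurable]: "A' \<in> sets (P s\<^sub>0)"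
    using A'(1) natural_filtration_subset sets_P[OF initial] by auto
  have eq: "(\<integral>\<omega>. indicator A \<omega> * Mart u \<omega> \<partial>completion (P s\<^sub>0)) = (\<integral>\<omega>. indicator A' \<omega> * Mart u \<omega> \<partial>P s\<^sub>0)"
    if "0 \<le> u" for u
  proof -
    have [measurable]: "Mart u \<in> borel_measurable (P s\<^sub>0)" by (rule Mart_borel[OF that])
    have [measurable]: "Mart u \<in> borel_measurable (completion (P s\<^sub>0))" by (rule measurable_completion) measurable
    have "(\<integral>\<omega>. indicator A \<omega> * Mart u \<omega> \<partial>completion (P s\<^sub>0)) = (\<integral>\<omega>. indicator A' \<omega> * Mart u \<omega> \<partial>completion (P s\<^sub>0))"
    proof (rule integral_cong_AE)
      show "AE \<omega> in completion (P s\<^sub>0). indicator A \<omega> * Mart u \<omega> = indicator A' \<omega> * Mart u \<omega>"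
        using A'(2) by eventually_elim (simp add: indicator_def)
      show "(\<lambda>\<omega>. indicator A' \<omega> * Mart u \<omega>) \<in> borel_measurable (completion (P s\<^sub>0))"
        by (rule measurable_completion) measurable
    qed measurable
    also have "\<dots> = (\<integral>\<omega>. indicator A' \<omega> * Mart u \<omega> \<partial>P s\<^sub>0)"
      by (rule integral_completion) measurable
    finally show ?thesis .
  qed
  show ?thesis
    unfolding eq[OF t(1)] eq[OF order_trans[OF t]] by (rule Mart_constant_expectation[OF A'(1) t, symmetric])
qed

lemma Mart_0: "(\<integral>\<omega>. Mart 0 \<omega> \<partial>completion (P s\<^sub>0)) = v s\<^sub>0 x"
proof -
  have "(\<integral>\<omega>. Mart 0 \<omega> \<partial>completion (P s\<^sub>0)) = (\<integral>\<omega>. Mart 0 \<omega> \<partial>P s\<^sub>0)"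
    by (rule integral_completion) (simp add: Mart_borel)
  also have "\<dots> = (\<integral>\<omega>. v s\<^sub>0 x \<partial>P s\<^sub>0)"
  proof (rule integral_cong_AE)
    show "AE \<omega> in P s\<^sub>0. Mart 0 \<omega> = v s\<^sub>0 x"
      using start[OF initial] by eventually_elim (simp add: Mart_def Z_def)
  qed (simp_all add: Mart_borel)
  finally show ?thesis by (simp add: Prob.prob_space)
qed

lemma Mart_Compl_integrable:
  assumes "A \<in> sets (completion (P s\<^sub>0))" "0 \<le> t"
  shows "integrable (completion (P s\<^sub>0)) (\<lambda>\<omega>. indicator A \<omega> * Mart t \<omega>)"
proof -
  obtain K where K: "\<And>\<omega>. \<omega> \<in> space M \<Longrightarrow> \<bar>Mart t \<omega>\<bar> \<le> K"
    using Mart_bounded[of t] assms(2) by (metis order_refl)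
  show ?thesis
  proof (rule Compl.integrable_const_bound[of _ K])
    show "(\<lambda>\<omega>. indicator A \<omega> * Mart t \<omega>) \<in> borel_measurable (completion (P s\<^sub>0))"
      using assms by (intro borel_measurable_times borel_measurable_indicator measurable_completion Mart_borel)
    show "AE \<omega> in completion (P s\<^sub>0). norm (indicator A \<omega> * Mart t \<omega>) \<le> K"
      using K order_trans[OF abs_ge_zero K] by (intro AE_I2) (auto simp: space_P\<^sub>0 indicator_def)
  qed
qed

text \<open>With \<theta> rounded up to a grid, each cell is an event of its grid time, so
  \<open>Mart\<close> at that time may be replaced by \<open>Mart T\<close> and the cells add up to
  the whole space. Right continuity and a uniform bound then remove the rounding.\<close>

lemma optional_stopping:
  assumes \<theta>: "admissible T \<theta>" and T: "0 \<le> T"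
  shows "integrable (completion (P s\<^sub>0)) (\<lambda>\<omega>. Mart (\<theta> \<omega>) \<omega>)"
    and "(\<integral>\<omega>. Mart (\<theta> \<omega>) \<omega> \<partial>completion (P s\<^sub>0)) = v s\<^sub>0 x"
proof -
  let ?C = "completion (P s\<^sub>0)"
  obtain K where K: "\<And>\<omega> t. \<omega> \<in> space M \<Longrightarrow> 0 \<le> t \<Longrightarrow> t \<le> T \<Longrightarrow> \<bar>Mart t \<omega>\<bar> \<le> K"
    using Mart_bounded[of T] by blast
  have meas: "(\<lambda>\<omega>. Mart (\<theta> \<omega>) \<omega>) \<in> borel_measurable ?C"
    by (intro sampled_borel[OF \<theta> T] Mart_borel Mart_right_continuous)
  show "integrable ?C (\<lambda>\<omega>. Mart (\<theta> \<omega>) \<omega>)"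
  proof (rule Compl.integrable_const_bound[of _ K])
    show "AE \<omega> in ?C. norm (Mart (\<theta> \<omega>) \<omega>) \<le> K"
      using K \<theta> by (intro AE_I2) (auto simp: space_P\<^sub>0 admissible_def)
  qed (rule meas)
  define Eg where "Eg n k = {\<omega> \<in> space M. nat \<lceil>real (Suc n) * \<theta> \<omega>\<rceil> = k}" for n k
  define r where "r n k = min T (real k / real (Suc n))" for n k :: nat
  have Eg: "Eg n k \<in> sets (Fc (ennreal (r n k)))" for n k
    unfolding Eg_def r_def by (rule admissible_grid_event[OF \<theta> T])
  have EgC: "Eg n k \<in> sets ?C" for n k
    using completed_almost_natural[OF initial Eg] by simp
  have r: "0 \<le> r n k" "r n k \<le> T" for n k using T by (auto simp: r_def)
  have grid: "(\<integral>\<omega>. Mart (r n (nat \<lceil>real (Suc n) * \<theta> \<omega>\<rceil>)) \<omega> \<partial>?C) = v s\<^sub>0 x" for n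
  proof -
    have "(\<integral>\<omega>. Mart (r n (nat \<lceil>real (Suc n) * \<theta> \<omega>\<rceil>)) \<omega> \<partial>?C)
      = (\<integral>\<omega>. (\<Sum>k\<le>nat \<lceil>real (Suc n) * T\<rceil>. indicator (Eg n k) \<omega> * Mart (r n k) \<omega>) \<partial>?C)"
      unfolding Eg_def
      by (rule Bochner_Integration.integral_cong[OF refl])
        (rule grid_sum[OF \<theta>, symmetric], simp add: space_P\<^sub>0)
    also have "\<dots> = (\<Sum>k\<le>nat \<lceil>real (Suc n) * T\<rceil>. \<integral>\<omega>. indicator (Eg n k) \<omega> * Mart (r n k) \<omega> \<partial>?C)"
      by (intro Bochner_Integration.integral_sum Mart_Compl_integrable EgC r)
    \<comment> \<open>The martingale property, applied on each cell from its own grid time to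
      \<open>T\<close>.\<close>
    also have "\<dots> = (\<Sum>k\<le>nat \<lceil>real (Suc n) * T\<rceil>. \<integral>\<omega>. indicator (Eg n k) \<omega> * Mart T \<omega> \<partial>?C)"
      by (intro sum.cong refl Mart_constant_expectation_completed Eg r)
    also have "\<dots> = (\<integral>\<omega>. (\<Sum>k\<le>nat \<lceil>real (Suc n) * T\<rceil>. indicator (Eg n k) \<omega> * Mart T \<omega>) \<partial>?C)"
      by (intro Bochner_Integration.integral_sum[symmetric] Mart_Compl_integrable EgC T)
    also have "\<dots> = (\<integral>\<omega>. Mart T \<omega> \<partial>?C)"
      unfolding Eg_def
      by (rule Bochner_Integration.integral_cong[OF refl]) (rule grid_sum[OF \<theta>], simp add: space_P\<^sub>0)
    also have "\<dots> = (\<integral>\<omega>. indicator (space M) \<omega> * Mart T \<omega> \<partial>?C)"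
      by (rule Bochner_Integration.integral_cong) (auto simp: space_P\<^sub>0)
    also have "\<dots> = (\<integral>\<omega>. indicator (space M) \<omega> * Mart 0 \<omega> \<partial>?C)"
      using T sets.top[of "Fc (ennreal 0)"] by (intro Mart_constant_expectation_completed[symmetric]) auto
    also have "\<dots> = (\<integral>\<omega>. Mart 0 \<omega> \<partial>?C)"
      by (rule Bochner_Integration.integral_cong) (auto simp: space_P\<^sub>0)
    finally show ?thesis using Mart_0 by simp
  qed
  have "(\<lambda>n. \<integral>\<omega>. Mart (r n (nat \<lceil>real (Suc n) * \<theta> \<omega>\<rceil>)) \<omega> \<partial>?C) \<longlonglongrightarrow> (\<integral>\<omega>. Mart (\<theta> \<omega>) \<omega> \<partial>?C)"
  proof (rule integral_dominated_convergence[where w = "\<lambda>_. K"])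
    show "(\<lambda>\<omega>. Mart (r n (nat \<lceil>real (Suc n) * \<theta> \<omega>\<rceil>)) \<omega>) \<in> borel_measurable ?C" for n
    proof -
      have "(\<lambda>\<omega>. \<Sum>k\<le>nat \<lceil>real (Suc n) * T\<rceil>. indicator (Eg n k) \<omega> * Mart (r n k) \<omega>) \<in> borel_measurable ?C"
        by (intro borel_measurable_sum borel_measurable_times borel_measurable_indicator EgC measurable_completion Mart_borel r)
      then show ?thesis
        unfolding Eg_def
        by (rule measurable_cong[THEN iffD1, rotated]) (rule grid_sum[OF \<theta>], simp add: space_P\<^sub>0)
    qed
    show "AE \<omega> in ?C. (\<lambda>n. Mart (r n (nat \<lceil>real (Suc n) * \<theta> \<omega>\<rceil>)) \<omega>) \<longlonglongrightarrow> Mart (\<theta> \<omega>) \<omega>"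
      unfolding r_def using \<theta>
      by (intro AE_I2 grid_limit Mart_right_continuous) (auto simp: space_P\<^sub>0 admissible_def)
    show "AE \<omega> in ?C. norm (Mart (r n (nat \<lceil>real (Suc n) * \<theta> \<omega>\<rceil>)) \<omega>) \<le> K" for n
      using K r by (intro AE_I2) (auto simp: space_P\<^sub>0 simp del: of_nat_Suc)
  qed (use meas in auto)
  then have "(\<lambda>n. v s\<^sub>0 x) \<longlonglongrightarrow> (\<integral>\<omega>. Mart (\<theta> \<omega>) \<omega> \<partial>?C)"
    by (simp only: grid)
  then show "(\<integral>\<omega>. Mart (\<theta> \<omega>) \<omega> \<partial>?C) = v s\<^sub>0 x"
    by (rule LIMSEQ_unique[OF _ tendsto_const])
qed

lemma Z_stopped_integrable:
  assumes \<theta>: "admissible T \<theta>" and T: "0 \<le> T"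
  shows "integrable (completion (P s\<^sub>0)) (\<lambda>\<omega>. Z (\<theta> \<omega>) \<omega>)"
proof -
  obtain K where K: "\<And>\<omega> t. \<omega> \<in> space M \<Longrightarrow> 0 \<le> t \<Longrightarrow> t \<le> T \<Longrightarrow> \<bar>Z t \<omega>\<bar> \<le> K"
    using process_bounds[of T] by metis
  show ?thesis
  proof (rule Compl.integrable_const_bound[of _ K])
    show "AE \<omega> in completion (P s\<^sub>0). norm (Z (\<theta> \<omega>) \<omega>) \<le> K"
      using K \<theta> by (intro AE_I2) (auto simp: space_P\<^sub>0 admissible_def)
    show "(\<lambda>\<omega>. Z (\<theta> \<omega>) \<omega>) \<in> borel_measurable (completion (P s\<^sub>0))"
      by (intro sampled_borel[OF \<theta> T] Z_right_continuous borel_P\<^sub>0 adapted_borel[OF Z_adapted])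
  qed
qed

lemma supersolution_expectation:
  assumes \<theta>: "admissible T \<theta>" and T: "0 \<le> T"
    and L: "\<And>s z. s \<in> {-1, 1} \<Longrightarrow> L s z \<le> 0"
  shows "(\<integral>\<omega>. Z (\<theta> \<omega>) \<omega> \<partial>completion (P s\<^sub>0)) \<le> v s\<^sub>0 x"
proof -
  have "(\<integral>\<omega>. Z (\<theta> \<omega>) \<omega> \<partial>completion (P s\<^sub>0)) \<le> (\<integral>\<omega>. Mart (\<theta> \<omega>) \<omega> \<partial>completion (P s\<^sub>0))"
  proof (intro integral_mono Z_stopped_integrable[OF \<theta> T] optional_stopping(1)[OF \<theta> T])
    fix \<omega> assume "\<omega> \<in> space (completion (P s\<^sub>0))"
    then have \<omega>: "\<omega> \<in> space M" by (simp add: space_P\<^sub>0)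
    have "integral {0..\<theta> \<omega>} (\<lambda>u. drift u \<omega>) \<le> integral {0..\<theta> \<omega>} (\<lambda>_. 0)"
    proof (rule Henstock_Kurzweil_Integration.integral_le[OF drift_integrable[OF \<omega>] integrable_0])
      fix u assume "u \<in> {0..\<theta> \<omega>}"
      then have "\<xi> u \<omega> \<in> {-1, 1}" using chain_values[OF \<omega>, of u] by auto
      then show "drift u \<omega> \<le> 0" using L by (simp add: drift_def mult_le_0_iff)
    qed
    then show "Z (\<theta> \<omega>) \<omega> \<le> Mart (\<theta> \<omega>) \<omega>" by (simp add: Mart_def)
  qed
  then show ?thesis using optional_stopping(2)[OF \<theta> T] by simp
qed

lemma solution_expectation:
  assumes \<theta>: "admissible T \<theta>" and T: "0 \<le> T"
    and L: "\<And>\<omega> u. \<omega> \<in> space M \<Longrightarrow> 0 \<le> u \<Longrightarrow> u < \<theta> \<omega> \<Longrightarrow> L (\<xi> u \<omega>) (X u \<omega>) = 0"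
  shows "(\<integral>\<omega>. Z (\<theta> \<omega>) \<omega> \<partial>completion (P s\<^sub>0)) = v s\<^sub>0 x"
proof -
  have "Z (\<theta> \<omega>) \<omega> = Mart (\<theta> \<omega>) \<omega>" if \<omega>: "\<omega> \<in> space M" for \<omega>
  proof -
    have "integral {0..\<theta> \<omega>} (\<lambda>u. drift u \<omega>) = integral {0..\<theta> \<omega>} (\<lambda>_. 0)"
      \<comment> \<open>The drift may be nonzero at \<theta> itself, where the path has reached the
        contact set; one point does not affect the integral.\<close>
      by (rule integral_spike[of "{\<theta> \<omega>}"]) (use L[OF \<omega>] in \<open>auto simp: drift_def\<close>)
    then show ?thesis by (simp add: Mart_def)
  qed
  then show ?thesis
    using optional_stopping(2)[OF \<theta> T]
    by (subst Bochner_Integration.integral_cong[OF refl, where g = "\<lambda>\<omega>. Mart (\<theta> \<omega>) \<omega>"]) (auto simp: space_P\<^sub>0)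
qed

end

subsection \<open>Verification\<close>

locale switching_stopping = switching lam M P \<xi> + smooth_fit lam \<mu> \<sigma> a \<rho> um
  for lam :: real and M :: "'a measure" and P :: "real \<Rightarrow> 'a measure"
    and \<xi> :: "real \<Rightarrow> 'a \<Rightarrow> real" and \<mu> \<sigma> a \<rho> um :: real
begin

definition payoff :: "real \<Rightarrow> ennreal \<Rightarrow> 'a \<Rightarrow> real" where
  "payoff y = reward \<mu> \<sigma> a \<rho> \<xi> y"

lemma test_function_value:
  "s \<in> {-1, 1} \<Longrightarrow> test_function lam M P \<xi> \<mu> \<sigma> \<rho> s v v'"
  by unfold_locales (use params v_derivative v'_continuous in auto)

text \<open>For the stopping time truncated at \<open>n\<close>, the reward is at most the
  discounted candidate, whose expectation is controlled. The truncated rewards are bounded by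
  \<open>y + a\<close> and converge to the reward, also where \<tau> is infinite.\<close>

lemma expected_payoff_le:
  assumes y: "0 < y" and s: "s \<in> {-1, 1}" and \<tau>: "stopping_time Fc \<tau>"
  shows "(\<integral>\<omega>. payoff y (\<tau> \<omega>) \<omega> \<partial>completion (P s)) \<le> v s (ln y)"
proof -
  define x where "x = ln y"
  interpret T: test_function lam M P \<xi> \<mu> \<sigma> \<rho> x s v v'
    by (rule test_function_value[OF s])
  let ?C = "completion (P s)"
  define R where "R t \<omega> = exp (- \<rho> * t) * (exp (T.X t \<omega>) - a)" for t \<omega>
  define \<theta> where "\<theta> n \<omega> = enn2real (min (\<tau> \<omega>) (ennreal (real n)))" for n \<omega>
  have price_X: "price \<mu> \<sigma> \<xi> y t \<omega> = exp (T.X t \<omega>)" for t \<omega>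
    unfolding T.X_def unfolding price_def x_def occ_def using y by (simp add: exp_add)
  have payoff_R: "payoff y t \<omega> = R (enn2real t) \<omega>" if "t < \<infinity>" for t \<omega>
    using that by (auto simp: payoff_def reward_def price_X R_def)
  have R_bound: "\<bar>R t \<omega>\<bar> \<le> y * exp (- ((\<rho> - \<mu> - \<sigma>) * t)) + a * exp (- \<rho> * t)"
    if "\<omega> \<in> space M" "0 \<le> t" for t \<omega>
  proof -
    have "T.X t \<omega> \<le> x + (\<mu> + \<sigma>) * t" using T.X_increment(2)[OF that(1), of 0 t] that(2) by simp
    then have "exp (- \<rho> * t) * exp (T.X t \<omega>) \<le> exp (- \<rho> * t) * exp (x + (\<mu> + \<sigma>) * t)" by simp
    also have "\<dots> = exp x * exp (- ((\<rho> - \<mu> - \<sigma>) * t))"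
      by (simp add: mult_exp_exp algebra_simps)
    also have "exp x = y" using y by (simp add: x_def)
    finally show ?thesis
      unfolding R_def using params by (simp add: right_diff_distrib abs_le_iff mult.commute) (smt (verit) exp_gt_zero mult_pos_pos)
  qed
  have R_le: "\<bar>R t \<omega>\<bar> \<le> y + a" if "\<omega> \<in> space M" "0 \<le> t" for t \<omega>
  proof -
    have "y * exp (- ((\<rho> - \<mu> - \<sigma>) * t)) \<le> y * 1" using params y that by (intro mult_left_mono) auto
    moreover have "a * exp (- \<rho> * t) \<le> a * 1" using params that by (intro mult_left_mono) auto
    ultimately show ?thesis using R_bound[OF that] by simp
  qed
  have R_meas: "R t \<in> borel_measurable (P s)" if "0 \<le> t" for t
  proof -
    have [measurable]: "T.X t \<in> borel_measurable (P s)"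
      by (intro T.borel_P\<^sub>0 T.adapted_borel[OF T.X_adapted[OF that]])
    show ?thesis unfolding R_def by measurable
  qed
  have R_rc: "continuous (at_right t) (\<lambda>t. R t \<omega>)" if "\<omega> \<in> space M" "0 \<le> t" for t \<omega>
    unfolding R_def using T.X_right_continuous[OF that] by (intro continuous_intros)
  have adm: "T.admissible (real n) (\<theta> n)" for n
    unfolding T.admissible_def
  proof (intro conjI ballI allI impI)
    show "0 \<le> \<theta> n \<omega>" for \<omega> by (simp add: \<theta>_def)
    show "\<theta> n \<omega> \<le> real n" for \<omega>
      unfolding \<theta>_def by (rule enn2real_leI) auto
    fix t assume t: "0 \<le> t \<and> t < real n"
    have "\<theta> n \<omega> \<le> t \<longleftrightarrow> \<tau> \<omega> \<le> ennreal t" for \<omega>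
    proof -
      \<comment> \<open>\<open>enn2real\<close> sends infinity to 0; finiteness of the minimum rules
        this default out.\<close>
      have "min (\<tau> \<omega>) (ennreal (real n)) < \<infinity>" by (simp add: min_less_iff_disj)
      then have "\<theta> n \<omega> \<le> t \<longleftrightarrow> min (\<tau> \<omega>) (ennreal (real n)) \<le> ennreal t"
        unfolding \<theta>_def using t by (metis enn2real_leI enn2real_nonneg ennreal_enn2real ennreal_leI infinity_ennreal_def)
      also have "\<dots> \<longleftrightarrow> \<tau> \<omega> \<le> ennreal t"
        using t by (simp add: min_le_iff_disj ennreal_le_iff2)
      finally show ?thesis .
    qed
    then show "{\<omega> \<in> space M. \<theta> n \<omega> \<le> t} \<in> sets (Fc (ennreal t))"
      using stopping_timeD[OF \<tau>, of "ennreal t"] by (simp add: pred_def)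
  qed
  have \<theta>0: "0 \<le> \<theta> n \<omega>" for n \<omega> by (simp add: \<theta>_def)
  have R\<theta>_meas: "(\<lambda>\<omega>. R (\<theta> n \<omega>) \<omega>) \<in> borel_measurable ?C" for n
    by (rule T.sampled_borel[OF adm _ R_meas R_rc]) auto
  have le: "(\<integral>\<omega>. R (\<theta> n \<omega>) \<omega> \<partial>?C) \<le> v s (ln y)" for n
  proof -
    have "(\<integral>\<omega>. R (\<theta> n \<omega>) \<omega> \<partial>?C) \<le> (\<integral>\<omega>. T.Z (\<theta> n \<omega>) \<omega> \<partial>?C)"
    proof (rule integral_mono)
      show "integrable ?C (\<lambda>\<omega>. R (\<theta> n \<omega>) \<omega>)"
        by (rule T.Compl.integrable_const_bound[of _ "y + a", OF AE_I2 R\<theta>_meas])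
          (use R_le \<theta>0 in \<open>auto simp: T.space_P\<^sub>0\<close>)
      show "integrable ?C (\<lambda>\<omega>. T.Z (\<theta> n \<omega>) \<omega>)" by (rule T.Z_stopped_integrable[OF adm]) simp
      fix \<omega> assume "\<omega> \<in> space ?C"
      then have "\<omega> \<in> space M" by (simp add: T.space_P\<^sub>0)
      then have "\<xi> (\<theta> n \<omega>) \<omega> \<in> {-1, 1}" using chain_values[OF _ \<theta>0] by auto
      from v_ge[OF this] show "R (\<theta> n \<omega>) \<omega> \<le> T.Z (\<theta> n \<omega>) \<omega>"
        unfolding R_def T.Z_def by (intro mult_left_mono) auto
    qed
    also have "\<dots> \<le> v s x"
      by (rule T.supersolution_expectation[OF adm]) (use L_nonpos in \<open>auto simp: T.L_def L_def\<close>)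
    finally show ?thesis by (simp add: x_def)
  qed
  have lim: "(\<lambda>n. R (\<theta> n \<omega>) \<omega>) \<longlonglongrightarrow> payoff y (\<tau> \<omega>) \<omega>" if \<omega>: "\<omega> \<in> space M" for \<omega>
  proof (cases "\<tau> \<omega> = \<infinity>")
    case True
    \<comment> \<open>As \<rho> > \<mu> + \<sigma>, discounting beats even the largest growth rate
      of the price, which matches the reward 0 at infinity.\<close>
    have lim0: "(\<lambda>n. y * exp (- ((\<rho> - \<mu> - \<sigma>) * real n)) + a * exp (- \<rho> * real n)) \<longlonglongrightarrow> 0"
    proof -
      have z: "(\<lambda>n. exp (- (c * real n))) \<longlonglongrightarrow> 0" if "0 < c" for c :: real
        using that by (intro filterlim_compose[OF exp_at_bot] filterlim_compose[OF filterlim_uminus_at_bot_at_top]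
            filterlim_tendsto_pos_mult_at_top[OF tendsto_const] filterlim_real_sequentially)
      show ?thesis
        using tendsto_add[OF tendsto_mult[OF tendsto_const z] tendsto_mult[OF tendsto_const z], of "\<rho> - \<mu> - \<sigma>" \<rho> y a]
          params by simp
    qed
    have "norm (R (\<theta> n \<omega>) \<omega>) \<le> y * exp (- ((\<rho> - \<mu> - \<sigma>) * real n)) + a * exp (- \<rho> * real n)" for n
      using R_bound[OF \<omega>, of "real n"] True by (simp add: \<theta>_def)
    then have "(\<lambda>n. R (\<theta> n \<omega>) \<omega>) \<longlonglongrightarrow> 0"
      by (rule Lim_null_comparison[OF always_eventually[OF allI] lim0])
    then show ?thesis using True by (simp add: payoff_def reward_def)
  next
    case False
    then obtain r where r: "\<tau> \<omega> = ennreal r" "0 \<le> r" by (cases "\<tau> \<omega>") auto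
    obtain N where N: "r \<le> real N" using real_arch_simple by blast
    have "\<theta> n \<omega> = r" if "N \<le> n" for n
    proof -
      have "ennreal r \<le> ennreal (real n)" using N that by (intro ennreal_leI) linarith
      then show ?thesis using r by (simp add: \<theta>_def min_absorb1)
    qed
    then have "eventually (\<lambda>n. R (\<theta> n \<omega>) \<omega> = payoff y (\<tau> \<omega>) \<omega>) sequentially"
      using r payoff_R[of "\<tau> \<omega>" \<omega>] by (intro eventually_sequentiallyI[of N]) simp
    then show ?thesis by (rule tendsto_eventually)
  qed
  have "(\<lambda>n. \<integral>\<omega>. R (\<theta> n \<omega>) \<omega> \<partial>?C) \<longlonglongrightarrow> (\<integral>\<omega>. payoff y (\<tau> \<omega>) \<omega> \<partial>?C)"
  proof (rule integral_dominated_convergence[where w = "\<lambda>_. y + a"])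
    show "(\<lambda>\<omega>. payoff y (\<tau> \<omega>) \<omega>) \<in> borel_measurable ?C"
      by (rule borel_measurable_LIMSEQ_real[OF lim R\<theta>_meas]) (simp add: T.space_P\<^sub>0)
    show "AE \<omega> in ?C. (\<lambda>n. R (\<theta> n \<omega>) \<omega>) \<longlonglongrightarrow> payoff y (\<tau> \<omega>) \<omega>"
      using lim by (intro AE_I2) (simp add: T.space_P\<^sub>0)
    show "AE \<omega> in ?C. norm (R (\<theta> n \<omega>) \<omega>) \<le> y + a" for n
      using R_le \<theta>0 by (intro AE_I2) (simp add: T.space_P\<^sub>0)
  qed (use R\<theta>_meas in auto)
  then show ?thesis
    by (rule LIMSEQ_le_const2) (use le in auto)
qed

text \<open>The candidate time is the first entry into the contact set. Before it the generator
  vanishes along the path; at it the candidate equals the payoff.\<close>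

lemma optimal_stopping_time:
  assumes y: "0 < y" and s: "s \<in> {-1, 1}"
  shows "\<exists>\<tau>. stopping_time Fc \<tau> \<and> (\<integral>\<omega>. payoff y (\<tau> \<omega>) \<omega> \<partial>completion (P s)) = v s (ln y)"
proof -
  define x where "x = ln y"
  interpret T: test_function lam M P \<xi> \<mu> \<sigma> \<rho> x s v v'
    by (rule test_function_value[OF s])
  define stop where "stop t \<omega> \<longleftrightarrow> (\<xi> t \<omega> = 1 \<and> ln up \<le> T.X t \<omega>) \<or> (\<xi> t \<omega> = -1 \<and> ln um \<le> T.X t \<omega>)" for t \<omega>
  \<comment> \<open>By this time even the smaller drift has carried the log price to
    \<open>ln up\<close>, where both states stop.\<close>
  define T\<^sub>0 where "T\<^sub>0 = max 0 ((ln up - x) / (\<mu> - \<sigma>))"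
  define \<theta> where "\<theta> \<omega> = Inf {t. 0 \<le> t \<and> stop t \<omega>}" for \<omega>
  have T0: "0 \<le> T\<^sub>0" by (simp add: T\<^sub>0_def)
  have bdd: "bdd_below {t. 0 \<le> t \<and> stop t \<omega>}" for \<omega> by (rule bdd_belowI[of _ 0]) auto
  have stop_T0: "stop T\<^sub>0 \<omega>" if \<omega>: "\<omega> \<in> space M" for \<omega>
  proof -
    have "(ln up - x) / (\<mu> - \<sigma>) \<le> T\<^sub>0" by (simp add: T\<^sub>0_def)
    then have "ln up - x \<le> (\<mu> - \<sigma>) * T\<^sub>0" using params by (simp add: pos_divide_le_eq mult.commute)
    also have "\<dots> \<le> T.X T\<^sub>0 \<omega> - x" using T.X_increment(1)[OF \<omega> order_refl T0] by simp
    finally have "ln up \<le> T.X T\<^sub>0 \<omega>" by simp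
    then show ?thesis using ln_um_up chain_values[OF \<omega> T0] by (auto simp: stop_def)
  qed
  have ne: "{t. 0 \<le> t \<and> stop t \<omega>} \<noteq> {}" if "\<omega> \<in> space M" for \<omega>
    using stop_T0[OF that] T0 by auto
  have \<theta>_bounds: "0 \<le> \<theta> \<omega>" "\<theta> \<omega> \<le> T\<^sub>0" if "\<omega> \<in> space M" for \<omega>
    unfolding \<theta>_def using ne[OF that] stop_T0[OF that] T0
    by (auto intro!: cInf_greatest cInf_lower bdd)
  \<comment> \<open>The price never decreases and the state is constant for a short time, so
    stopping persists to the right.\<close>
  have stop_right: "eventually (\<lambda>u. stop u \<omega>) (at_right t)" if \<omega>: "\<omega> \<in> space M" "0 \<le> t" and st: "stop t \<omega>" for \<omega> t
    using chain_eventually_right[OF \<omega>] eventually_at_right_less[of t]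
  proof eventually_elim
    case (elim u)
    have "0 \<le> (\<mu> - \<sigma>) * (u - t)" using params elim by simp
    then have "T.X t \<omega> \<le> T.X u \<omega>" using T.X_increment(1)[OF \<omega>, of "u - t"] elim by simp
    then show ?case using st elim by (auto simp: stop_def)
  qed
  have not_stop_right: "eventually (\<lambda>u. \<not> stop u \<omega>) (at_right t)"
    if \<omega>: "\<omega> \<in> space M" "0 \<le> t" and st: "\<not> stop t \<omega>" for \<omega> t
  proof -
    define c where "c = (if \<xi> t \<omega> = 1 then ln up else ln um)"
    have "T.X t \<omega> < c" using st chain_values[OF \<omega>] by (auto simp: stop_def c_def)
    then have "eventually (\<lambda>u. T.X u \<omega> < c) (at_right t)"
      using T.X_right_continuous[OF \<omega>] by (intro order_tendstoD) (auto simp: continuous_within)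
    with chain_eventually_right[OF \<omega>] show ?thesis
      by eventually_elim (auto simp: stop_def c_def split: if_splits)
  qed
  \<comment> \<open>The infimum is attained: a continuation point is followed by an interval of
    continuation points.\<close>
  have stop_\<theta>: "stop (\<theta> \<omega>) \<omega>" if \<omega>: "\<omega> \<in> space M" for \<omega>
  proof (rule ccontr)
    assume "\<not> stop (\<theta> \<omega>) \<omega>"
    from not_stop_right[OF \<omega> \<theta>_bounds(1)[OF \<omega>] this]
    obtain c where c: "\<theta> \<omega> < c" "\<And>u. \<theta> \<omega> < u \<Longrightarrow> u < c \<Longrightarrow> \<not> stop u \<omega>"
      unfolding eventually_at_right_field by blast
    from cInf_lessD[OF ne[OF \<omega>] c(1)[unfolded \<theta>_def]]
    obtain t where t: "0 \<le> t" "stop t \<omega>" "t < c" by auto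
    moreover have "\<theta> \<omega> \<le> t" unfolding \<theta>_def using t by (intro cInf_lower bdd) auto
    ultimately show False using c(2)[of t] \<open>\<not> stop (\<theta> \<omega>) \<omega>\<close> by (cases "t = \<theta> \<omega>") auto
  qed
  have not_stop_before: "\<not> stop u \<omega>" if "0 \<le> u" "u < \<theta> \<omega>" for u \<omega>
  proof
    assume "stop u \<omega>"
    then have "\<theta> \<omega> \<le> u" unfolding \<theta>_def using that by (intro cInf_lower bdd) auto
    then show False using that by simp
  qed
  have stop_event: "{\<omega> \<in> space M. stop q \<omega>} \<in> sets (F r)" if "0 \<le> q" "q \<le> r" for q r
  proof -
    have [measurable]: "T.X q \<in> borel_measurable (F r)" "\<xi> q \<in> borel_measurable (F r)"
      using T.adapted_mono[OF T.X_adapted] chain_adapted that by (auto intro: ennreal_leI)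
    have "{\<omega> \<in> space (F r). stop q \<omega>} \<in> sets (F r)"
      unfolding stop_def by measurable
    then show ?thesis by simp
  qed
  have event: "{\<omega> \<in> space M. \<theta> \<omega> \<le> r} \<in> sets (F r)" if r: "0 \<le> r" for r
  proof -
    \<comment> \<open>By persistence to the right, stopping before \<open>r\<close> is visible at a
      rational time before \<open>r\<close>. The event is thus a countable union that belongs to the
      natural filtration at time \<open>r\<close>.\<close>
    have iff: "\<theta> \<omega> \<le> r \<longleftrightarrow> stop r \<omega> \<or> (\<exists>q\<in>\<rat> \<inter> {0..<r}. stop q \<omega>)" if \<omega>: "\<omega> \<in> space M" for \<omega>
    proof
      assume "\<theta> \<omega> \<le> r"
      show "stop r \<omega> \<or> (\<exists>q\<in>\<rat> \<inter> {0..<r}. stop q \<omega>)"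
      proof (cases "\<theta> \<omega> = r")
        case True
        then show ?thesis using stop_\<theta>[OF \<omega>] by auto
      next
        case False
        then have "\<theta> \<omega> < r" using \<open>\<theta> \<omega> \<le> r\<close> by simp
        obtain c where c: "\<theta> \<omega> < c" "\<And>u. \<theta> \<omega> < u \<Longrightarrow> u < c \<Longrightarrow> stop u \<omega>"
          using stop_right[OF \<omega> \<theta>_bounds(1)[OF \<omega>] stop_\<theta>[OF \<omega>]]
          unfolding eventually_at_right_field by blast
        obtain q where q: "q \<in> \<rat>" "\<theta> \<omega> < q" "q < min c r"
          using Rats_dense_in_real[of "\<theta> \<omega>" "min c r"] c(1) \<open>\<theta> \<omega> < r\<close> by auto
        then show ?thesis using c(2)[of q] \<theta>_bounds(1)[OF \<omega>] by (intro disjI2 bexI[of _ q]) auto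
      qed
    next
      assume "stop r \<omega> \<or> (\<exists>q\<in>\<rat> \<inter> {0..<r}. stop q \<omega>)"
      then obtain q where "0 \<le> q" "q \<le> r" "stop q \<omega>" using r by auto
      then show "\<theta> \<omega> \<le> r" using not_stop_before[of q \<omega>] by linarith
    qed
    have "{\<omega> \<in> space M. \<theta> \<omega> \<le> r} = {\<omega> \<in> space M. stop r \<omega>} \<union> (\<Union>q\<in>\<rat> \<inter> {0..<r}. {\<omega> \<in> space M. stop q \<omega>})"
      using iff by auto
    moreover have "(\<Union>q\<in>\<rat> \<inter> {0..<r}. {\<omega> \<in> space M. stop q \<omega>}) \<in> sets (F r)"
      by (intro sets.countable_UN'' countable_Int1 countable_rat stop_event) auto
    ultimately show ?thesis using stop_event[OF r order_refl] by auto
  qed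
  have st: "stopping_time Fc (\<lambda>\<omega>. ennreal (\<theta> \<omega>))"
  proof
    fix t :: ennreal
    show "Measurable.pred (Fc t) (\<lambda>\<omega>. ennreal (\<theta> \<omega>) \<le> t)"
    proof (cases t)
      case (real r)
      have "{\<omega> \<in> space M. ennreal (\<theta> \<omega>) \<le> t} = {\<omega> \<in> space M. \<theta> \<omega> \<le> r}"
        using \<theta>_bounds(1) real by auto
      then show ?thesis
        using event[OF real(1)] natural_subset_completed[of t] real by (auto simp: pred_def)
    qed simp
  qed
  have adm: "T.admissible T\<^sub>0 \<theta>"
    unfolding T.admissible_def using \<theta>_bounds event natural_subset_completed by blast
  have "(\<integral>\<omega>. payoff y (ennreal (\<theta> \<omega>)) \<omega> \<partial>completion (P s)) = (\<integral>\<omega>. T.Z (\<theta> \<omega>) \<omega> \<partial>completion (P s))"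
  proof (rule Bochner_Integration.integral_cong[OF refl])
    fix \<omega> assume "\<omega> \<in> space (completion (P s))"
    then have \<omega>: "\<omega> \<in> space M" by (simp add: T.space_P\<^sub>0)
    have "T.Z (\<theta> \<omega>) \<omega> = exp (- \<rho> * \<theta> \<omega>) * (exp (T.X (\<theta> \<omega>) \<omega>) - a)"
      using stop_\<theta>[OF \<omega>] v_above by (auto simp: stop_def T.Z_def)
    moreover have "price \<mu> \<sigma> \<xi> y (\<theta> \<omega>) \<omega> = exp (T.X (\<theta> \<omega>) \<omega>)"
      unfolding T.X_def unfolding price_def x_def occ_def using y by (simp add: exp_add)
    ultimately show "payoff y (ennreal (\<theta> \<omega>)) \<omega> = T.Z (\<theta> \<omega>) \<omega>"
      using \<theta>_bounds(1)[OF \<omega>] by (simp add: payoff_def reward_def)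
  qed
  also have "\<dots> = v s x"
  proof (rule T.solution_expectation[OF adm T0])
    fix \<omega> u assume u: "\<omega> \<in> space M" "0 \<le> u" "u < \<theta> \<omega>"
    then have "L (\<xi> u \<omega>) (T.X u \<omega>) = 0"
      using not_stop_before[OF u(2,3)] chain_values[OF u(1,2)] L_plus_zero L_below(2) by (auto simp: stop_def)
    then show "T.L (\<xi> u \<omega>) (T.X u \<omega>) = 0" by (simp add: T.L_def L_def)
  qed
  finally show ?thesis using st by (auto simp: x_def)
qed

section \<open>The value function and its thresholds\<close>

lemma value_function_eq:
  assumes "0 < y" "s \<in> {-1, 1}"
  shows "value_function \<mu> \<sigma> a \<rho> M P \<xi> y s = v s (ln y)"
  unfolding value_function_def
proof (rule cSup_eq_maximum)
  show "v s (ln y) \<in> (\<lambda>\<tau>. \<integral>\<omega>. reward \<mu> \<sigma> a \<rho> \<xi> y (\<tau> \<omega>) \<omega> \<partial>completion (P s)) ` {\<tau>. stopping_time Fc \<tau>}"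
    using optimal_stopping_time[OF assms] unfolding payoff_def by force
qed (use expected_payoff_le[OF assms] in \<open>auto simp: payoff_def\<close>)

text \<open>The price 0 has no logarithm and is treated directly: every reward is then at most 0,
  and never stopping attains 0.\<close>

lemma value_function_0:
  assumes "s \<in> {-1, 1}"
  shows "value_function \<mu> \<sigma> a \<rho> M P \<xi> 0 s = 0"
  unfolding value_function_def
proof (rule cSup_eq_maximum)
  let ?E = "\<lambda>\<tau>. \<integral>\<omega>. reward \<mu> \<sigma> a \<rho> \<xi> 0 (\<tau> \<omega>) \<omega> \<partial>completion (P s)"
  have "?E (\<lambda>_. \<infinity>) = 0" by (simp add: reward_def)
  then show "0 \<in> ?E ` {\<tau>. stopping_time Fc \<tau>}"
    by (intro image_eqI[where x = "\<lambda>_. \<infinity>"]) (simp_all add: stopping_time_const)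
  fix e assume "e \<in> ?E ` {\<tau>. stopping_time Fc \<tau>}"
  then obtain \<tau> where e: "e = ?E \<tau>" by auto
  have "0 \<le> (\<integral>\<omega>. - reward \<mu> \<sigma> a \<rho> \<xi> 0 (\<tau> \<omega>) \<omega> \<partial>completion (P s))"
    using params by (intro Bochner_Integration.integral_nonneg) (simp add: reward_def price_def)
  then show "e \<le> 0" by (simp add: e)
qed

lemma thresholds:
  "is_threshold a (\<lambda>y. value_function \<mu> \<sigma> a \<rho> M P \<xi> y 1) (ereal up)"
  "is_threshold a (\<lambda>y. value_function \<mu> \<sigma> a \<rho> M P \<xi> y (-1)) (ereal um)"
proof -
  have iff: "0 \<le> y \<and> value_function \<mu> \<sigma> a \<rho> M P \<xi> y s = y - a \<longleftrightarrow> u \<le> y"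
    if s: "s \<in> {-1, 1}" and u: "0 < u"
      and gt: "\<And>z. z < ln u \<Longrightarrow> exp z - a < v s z" and eq: "\<And>z. ln u \<le> z \<Longrightarrow> v s z = exp z - a"
    for s u y
  proof -
    consider "y < 0" | "y = 0" | "0 < y" by linarith
    then show ?thesis
    proof cases
      case 2
      then show ?thesis using value_function_0[OF s] u params by simp
    next
      case 3
      then show ?thesis
        using value_function_eq[OF 3 s] gt[of "ln y"] eq[of "ln y"] u by (cases "y < u") auto
    qed (use u in auto)
  qed
  show "is_threshold a (\<lambda>y. value_function \<mu> \<sigma> a \<rho> M P \<xi> y 1) (ereal up)"
    unfolding is_threshold_def using iff[of 1 up] v_plus_gt v_above(2) up_pos by auto
  show "is_threshold a (\<lambda>y. value_function \<mu> \<sigma> a \<rho> M P \<xi> y (-1)) (ereal um)"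
    unfolding is_threshold_def using iff[of "-1" um] v_minus_gt v_above(1) um(1) by auto
qed

lemma value_formulas:
  assumes "0 \<le> y"
  shows "y \<le> um \<Longrightarrow> value_function \<mu> \<sigma> a \<rho> M P \<xi> y (-1) = Cm * \<omega>m * y powr \<Omega>m + Cp * \<omega>p * y powr \<Omega>p"
    and "um \<le> y \<Longrightarrow> value_function \<mu> \<sigma> a \<rho> M P \<xi> y (-1) = y - a"
    and "y \<le> um \<Longrightarrow> value_function \<mu> \<sigma> a \<rho> M P \<xi> y 1 = Cm * y powr \<Omega>m + Cp * y powr \<Omega>p"
    and "um \<le> y \<Longrightarrow> y \<le> up \<Longrightarrow> value_function \<mu> \<sigma> a \<rho> M P \<xi> y 1 = b * y - a * (lam / (lam + \<rho>)) + C * y powr \<Omega>"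
    and "up \<le> y \<Longrightarrow> value_function \<mu> \<sigma> a \<rho> M P \<xi> y 1 = y - a"
  \<comment> \<open>At \<open>y = 0\<close> only the lowest branches apply, and
    \<open>0 powr q = 0\<close> gives the value 0.\<close>
  using assms v_formulas[of y] value_function_eq[of y] value_function_0 um
  by (cases "y = 0"; simp)+

end

theorem theorem16:
  fixes lam \<mu> \<sigma> a \<rho> :: real
    and M :: "'a measure" and P :: "real \<Rightarrow> 'a measure" and \<xi> :: "real \<Rightarrow> 'a \<Rightarrow> real"
    and b \<Omega> \<Omega>p \<Omega>m \<omega>p \<omega>m :: real
    and g :: "real \<Rightarrow> real \<Rightarrow> real"
  assumes "lam > 0" "\<mu> > 0" "\<sigma> > 0" "a > 0" "\<rho> > 0"
    and "switching_chain lam M P \<xi>"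
    and "g = value_function \<mu> \<sigma> a \<rho> M P \<xi>"
    and "b = lam / (lam + \<rho> - \<mu> - \<sigma>)"
    and "\<Omega> = (lam + \<rho>) / (\<mu> + \<sigma>)"
    and "\<Omega>p = ((lam + \<rho>) * \<mu> + sqrt (lam\<^sup>2 * \<mu>\<^sup>2 + \<sigma>\<^sup>2 * (\<rho>\<^sup>2 + 2 * lam * \<rho>))) / (\<mu>\<^sup>2 - \<sigma>\<^sup>2)"
    and "\<Omega>m = ((lam + \<rho>) * \<mu> - sqrt (lam\<^sup>2 * \<mu>\<^sup>2 + \<sigma>\<^sup>2 * (\<rho>\<^sup>2 + 2 * lam * \<rho>))) / (\<mu>\<^sup>2 - \<sigma>\<^sup>2)"
    and "\<omega>p = 1 + \<rho> / lam - (\<mu> + \<sigma>) / lam * \<Omega>p"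
    and "\<omega>m = 1 + \<rho> / lam - (\<mu> + \<sigma>) / lam * \<Omega>m"
    and "\<rho> > \<mu> + \<sigma>" "\<mu> - \<sigma> > 0"
  shows "\<exists>up um :: real.
    is_threshold a (\<lambda>y. g y 1) (ereal up) \<and>
    is_threshold a (\<lambda>y. g y (-1)) (ereal um) \<and>
    up = a * (\<rho> / (\<rho> - \<mu> - \<sigma>)) \<and>
    (let C = (1 - b) / (\<Omega> * up powr (\<Omega> - 1));
         N = \<omega>p * \<Omega>p - \<omega>m * \<Omega>m - lam * \<omega>p * \<omega>m / (lam + \<rho>) * (\<Omega>p - \<Omega>m);
         D = \<omega>p * (\<Omega>p - 1) - \<omega>m * (\<Omega>m - 1)
             - lam * \<omega>p * \<omega>m / (lam + \<rho> - \<mu> - \<sigma>) * (\<Omega>p - \<Omega>m);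
         \<Phi> = (\<lambda>u. u - C * (\<omega>p * \<omega>m * (\<Omega>p - \<Omega>m) / D) * u powr \<Omega>);
         Cp = um powr (- \<Omega>p) * ((um * (\<Omega>m - 1) - a * \<Omega>m) / (\<omega>p * (\<Omega>m - \<Omega>p)));
         Cm = um powr (- \<Omega>m) * ((um * (\<Omega>p - 1) - a * \<Omega>p) / (\<omega>m * (\<Omega>p - \<Omega>m)))
     in
       (0 \<le> um \<and> \<Phi> um = a * (N / D) \<and> (\<forall>u\<ge>0. \<Phi> u = a * (N / D) \<longrightarrow> um \<le> u)) \<and>
       (\<forall>y. 0 \<le> y \<and> y \<le> um \<longrightarrow> g y (-1) = Cm * \<omega>m * y powr \<Omega>m + Cp * \<omega>p * y powr \<Omega>p) \<and>
       (\<forall>y. um \<le> y \<longrightarrow> g y (-1) = y - a) \<and>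
       (\<forall>y. 0 \<le> y \<and> y \<le> um \<longrightarrow> g y 1 = Cm * y powr \<Omega>m + Cp * y powr \<Omega>p) \<and>
       (\<forall>y. um \<le> y \<and> y \<le> up \<longrightarrow> g y 1 = b * y - a * (lam / (lam + \<rho>)) + C * y powr \<Omega>) \<and>
       (\<forall>y. up \<le> y \<longrightarrow> g y 1 = y - a))"
proof -
  interpret SP: stopping_problem lam \<mu> \<sigma> a \<rho>
    using assms by unfold_locales auto
  obtain um where um: "0 < um" "um < SP.up" "SP.H um = 0" using SP.H_root_exists by blast
  interpret MC: markov_chain_family "{-1, 1}" "\<lambda>x y. if x = y then - lam else lam" M P \<xi>
    using assms(6) by (simp add: switching_chain_def)
  interpret S: switching_stopping lam M P \<xi> \<mu> \<sigma> a \<rho> um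
    by unfold_locales (use um in auto)
  have constants: "b = SP.b" "\<Omega> = SP.\<Omega>" "\<Omega>p = SP.\<Omega>p" "\<Omega>m = SP.\<Omega>m" "\<omega>p = SP.\<omega>p" "\<omega>m = SP.\<omega>m"
    using assms by (simp_all add: SP.b_def SP.\<Omega>_def SP.\<Omega>p_def SP.\<Omega>m_def SP.\<omega>p_def SP.\<omega>m_def SP.discr_def)
  \<comment> \<open>The upper branches in the goal carry no explicit \<open>0 \<le> y\<close>, which
    \<open>S.value_formulas\<close> asks for.\<close>
  have nonneg: "um \<le> y \<Longrightarrow> 0 \<le> y" "SP.up \<le> y \<Longrightarrow> 0 \<le> y" for y
    using um(1) SP.up_pos by simp_all
  show ?thesis
    unfolding assms(7) constants Let_def
    by (rule exI[of _ SP.up], rule exI[of _ um],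
        unfold SP.C_def[symmetric] SP.N_def[symmetric] SP.D_def[symmetric] SP.\<Phi>_def[symmetric]
          S.Cp_def[symmetric] S.Cm_def[symmetric] SP.\<Phi>_iff,
        intro conjI allI impI S.thresholds SP.up_def um(3) S.value_formulas)
      (use um(1) S.um_least nonneg in auto)
qed

end
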